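(* Let $(\mathbf{E}_h^n,\mathbf{H}_h^n)$ be a solution of the abstract space-time discontinuous Galerkin method defined in the context. Then $$\tfrac12\big(\|\epsilon^{1/2}\mathbf{E}_h^n(t^n)\|_\Omega^2+\|\mu^{1/2}\mathbf{H}_h^n(t^n)\|_\Omega^2\big)-\tfrac12\big(\|\epsilon^{1/2}\mathbf{E}_h^{n}(t^{n-1})\|_\Omega^2+\|\mu^{1/2}\mathbf{H}_h^{n}(t^{n-1})\|_\Omega^2\big)$$ $$=-\int_{\partial\Omega\times I^n}\Big(\beta|\mathbf{n}\times\mathbf{H}_h^n|^2+\mathbf{n}\times\mathbf{g}\cdot\mathbf{H}_h^n\Big)-\tfrac12\|\epsilon^{1/2}(\mathbf{E}_h^n(t^{n-1})-\mathbf{E}_h^{n-1}(t^{n-1}))\|_\Omega^2-\tfrac12\|\mu^{1/2}(\mathbf{H}_h^n(t^{n-1})-\mathbf{H}_h^{n-1}(t^{n-1}))\|_\Omega^2 .$$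
   Context: Setting. $\Omega\subset\mathbb{R}^3$ is a bounded polyhedral Lipschitz domain and $\Omega_h=\{K\}$ is a non-overlapping partition of $\Omega$ into simple regular elements $K$ (tetrahedra, parallelepipeds, prisms, etc.). Interior interfaces are $f=\partial K_1\cap\partial K_2$, $K_1\neq K_2\in\Omega_h$, and boundary faces are $f=\partial K\cap\partial\Omega$. $0=t^0<t^1<\dots<t^N=T$ and $I^n=[t^{n-1},t^n]$. The material parameters $\epsilon,\mu>0$ are time-independent and piecewise constant (constant on each element $K$); $\beta\ge 0$ is a parameter; $\mathbf{E}^0,\mathbf{H}^0$ are given (square-integrable) initial fields on $\Omega$ and $\mathbf{g}$ is a given (square-integrable) boundary excitation on $\partial\Omega\times(0,T)$. $\mathbf{n}$ denotes the outward unit normal on $\partial K$ or on $\partial\Omega$. $\|\cdot\|_D$ is the $L^2(D)$-norm. A vector field on $\Omega_h\times I^n$ is piecewise smooth if its restriction to each $K\times I^n$ is smooth up to the boundary; no continuity between elements is required. On an interface $f=\partial K_1\cap\partial K_2$ with traces $\mathbf{E}_1,\mathbf{E}_2$ from $K_1,K_2$, $\{\mathbf{E}\}=\frac12(\mathbf{E}_1+\mathbf{E}_2)$. Abstract space-time discontinuous Galerkin method. For each $n\ge1$ let $(\mathcal{V}_E^n,\mathcal{V}_H^n)$ be a linear space of pairs of piecewise smooth vector fields on $\Omega_h\times I^n$ (not specified further). Set $\mathbf{E}_h^0=\mathbf{E}^0$, $\mathbf{H}_h^0=\mathbf{H}^0$ (regarded as values at $t^0=0$). For $n\ge1$ find consecutively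 $(\mathbf{E}_h^n,\mathbf{H}_h^n)\in(\mathcal{V}_E^n,\mathcal{V}_H^n)$ with $$B^n(\mathbf{E}_h^n,\mathbf{H}_h^n;\mathbf{v},\mathbf{w})=R^n(\mathbf{E}_h^{n-1},\mathbf{H}_h^{n-1};\mathbf{v},\mathbf{w})\quad\text{for all }(\mathbf{v},\mathbf{w})\in(\mathcal{V}_E^n,\mathcal{V}_H^n),$$ where $$B^n(\mathbf{E},\mathbf{H};\mathbf{v},\mathbf{w})=\sum_{K\in\Omega_h}\int_{K\times I^n}(\epsilon\partial_t\mathbf{E}-\mathrm{curl}\,\mathbf{H})\cdot\mathbf{v}+(\mu\partial_t\mathbf{H}+\mathrm{curl}\,\mathbf{E})\cdot\mathbf{w}$$ $$+\sum_{K\in\Omega_h}\int_K\epsilon\mathbf{E}(t^{n-1})\cdot\mathbf{v}(t^{n-1})+\mu\mathbf{H}(t^{n-1})\cdot\mathbf{w}(t^{n-1})$$ $$+\sum_{K\in\Omega_h}\int_{\partial K\times I^n}\mathbf{n}\times(\mathbf{H}-\mathbf{H}^* )\cdot\mathbf{v}-\mathbf{n}\times(\mathbf{E}-\mathbf{E}^* )\cdot\mathbf{w},$$ $$R^n(\mathbf{E},\mathbf{H};\mathbf{v},\mathbf{w})=\sum_{K\in\Omega_h}\int_K\epsilon\mathbf{E}(t^{n-1})\cdot\mathbf{v}(t^{n-1})+\mu\mathbf{H}(t^{n-1})\cdot\mathbf{w}(t^{n-1})-\int_{\partial\Omega\times I^n}\mathbf{n}\times\mathbf{g}\cdot\mathbf{w}.$$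 The numerical fluxes are $\mathbf{E}^*=\{\mathbf{E}\}$, $\mathbf{H}^*=\{\mathbf{H}\}$ on interior interfaces, and on boundary faces $\mathbf{H}^*=\mathbf{H}$ and $\mathbf{n}\times\mathbf{E}^*=\beta\,\mathbf{n}\times(\mathbf{H}\times\mathbf{n})$. Here $\mathbf{E}_h^{n-1}(t^{n-1})$ is the value at the final time of slab $n-1$, while $\mathbf{E}_h^n(t^{n-1})$ is the value at the initial time of slab $n$; likewise for $\mathbf{H}$.
   Formalization: The subtracted energy is that of the previous slab's final values E_h^{n-1}(t^{n-1}), H_h^{n-1}(t^{n-1}), not of E_h^n(t^{n-1}), H_h^n(t^{n-1}); as printed the identity fails, e.g. for zero trial spaces with E^0 a nonzero constant and H^0 = g = 0. *)

theory Defs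
  imports "HOL-Analysis.Analysis"
begin

type_synonym field = "real^3 \<Rightarrow> real \<Rightarrow> real^3"

subsection \<open>Domain and mesh\<close>

text \<open>Near every boundary point, the set is the region below the graph of a Lipschitz function
  of the coordinates orthogonal to a unit vector \<open>e\<close>.\<close>

definition lipschitz_boundary :: "(real^3) set \<Rightarrow> bool" where
  "lipschitz_boundary \<Omega> \<longleftrightarrow> (\<forall>x\<in>frontier \<Omega>. \<exists>e U L. \<exists>\<phi> :: real^3 \<Rightarrow> real.
     norm e = 1 \<and> open U \<and> x \<in> U \<and> L-lipschitz_on {y. y \<bullet> e = 0} \<phi> \<and>
     \<Omega> \<inter> U = {y \<in> U. y \<bullet> e < \<phi> (y - (y \<bullet> e) *\<^sub>R e)})"

definition polyhedral_lipschitz_domain :: "(real^3) set \<Rightarrow> bool" where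
  "polyhedral_lipschitz_domain \<Omega> \<longleftrightarrow>
     open \<Omega> \<and> connected \<Omega> \<and> \<Omega> \<noteq> {} \<and> bounded \<Omega> \<and> lipschitz_boundary \<Omega> \<and>
     (\<exists>P. finite P \<and> (\<forall>p\<in>P. polytope p) \<and> closure \<Omega> = \<Union>P)"

text \<open>Elements are closed convex polytopes with nonempty interior. The mesh need not be conforming.\<close>

definition element_partition :: "(real^3) set \<Rightarrow> (real^3) set set \<Rightarrow> bool" where
  "element_partition \<Omega> \<K> \<longleftrightarrow>
     finite \<K> \<and> (\<forall>K\<in>\<K>. polytope K \<and> interior K \<noteq> {}) \<and>
     pairwise (\<lambda>K K'. interior K \<inter> interior K' = {}) \<K> \<and> \<Union>\<K> = closure \<Omega>"

text \<open>Values on the element boundaries are irrelevant, here and for all fields below.\<close>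

definition piecewise_constant :: "(real^3) set set \<Rightarrow> (real^3 \<Rightarrow> real) \<Rightarrow> bool" where
  "piecewise_constant \<K> c \<longleftrightarrow> (\<forall>K\<in>\<K>. c constant_on interior K)"

definition time_grid :: "real \<Rightarrow> nat \<Rightarrow> (nat \<Rightarrow> real) \<Rightarrow> bool" where
  "time_grid T N t \<longleftrightarrow> t 0 = 0 \<and> (\<forall>i<N. t i < t (Suc i)) \<and> t N = T"

subsection \<open>Piecewise smooth fields\<close>

primrec continuously_differentiable ::
    "nat \<Rightarrow> ('a::real_normed_vector \<Rightarrow> 'b::real_normed_vector) \<Rightarrow> bool" where
  "continuously_differentiable 0 f \<longleftrightarrow> continuous_on UNIV f"
| "continuously_differentiable (Suc k) f \<longleftrightarrow>
     f differentiable_on UNIV \<and>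
     (\<forall>v. continuously_differentiable k (\<lambda>x. frechet_derivative f (at x) v))"

definition smooth :: "('a::real_normed_vector \<Rightarrow> 'b::real_normed_vector) \<Rightarrow> bool" where
  "smooth f \<longleftrightarrow> (\<forall>k. continuously_differentiable k f)"

text \<open>Smoothness up to the boundary of \<open>K \<times> I\<close> means the existence of a smooth extension.
  Fields are not required to be continuous, or to have any particular value, on the
  element boundaries; there they enter only through their one-sided traces.\<close>

definition piecewise_smooth :: "(real^3) set set \<Rightarrow> real set \<Rightarrow> field \<Rightarrow> bool" where
  "piecewise_smooth \<K> I u \<longleftrightarrow> (\<forall>K\<in>\<K>. \<exists>G :: (real^3) \<times> real \<Rightarrow> real^3.
     smooth G \<and> (\<forall>x\<in>interior K. \<forall>t\<in>I. u x t = G (x, t)))"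

definition linear_space_of_pairs :: "(field \<times> field) set \<Rightarrow> bool" where
  "linear_space_of_pairs V \<longleftrightarrow>
     ((\<lambda>x t. 0), (\<lambda>x t. 0)) \<in> V \<and>
     (\<forall>(v, w)\<in>V. \<forall>(v', w')\<in>V. ((\<lambda>x t. v x t + v' x t), (\<lambda>x t. w x t + w' x t)) \<in> V) \<and>
     (\<forall>(v, w)\<in>V. \<forall>c. ((\<lambda>x t. c *\<^sub>R v x t), (\<lambda>x t. c *\<^sub>R w x t)) \<in> V)"

definition inner_trace :: "(real^3) set \<Rightarrow> field \<Rightarrow> field" where
  "inner_trace D u x t = Lim (at x within interior D) (\<lambda>y. u y t)"

definition time_deriv :: "field \<Rightarrow> field" where
  "time_deriv u x t = vector_derivative (u x) (at t)"

definition partial :: "3 \<Rightarrow> 3 \<Rightarrow> (real^3 \<Rightarrow> real^3) \<Rightarrow> real^3 \<Rightarrow> real" where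
  "partial j i F x = frechet_derivative F (at x) (axis j 1) $ i"

definition curl :: "field \<Rightarrow> field" where
  "curl u x t = (let F = (\<lambda>y. u y t) in
     vector [partial 2 3 F x - partial 3 2 F x,
             partial 3 1 F x - partial 1 3 F x,
             partial 1 2 F x - partial 2 1 F x])"

subsection \<open>Integration on polyhedral surfaces\<close>

definition square_integrable :: "'a measure \<Rightarrow> ('a \<Rightarrow> real^3) \<Rightarrow> bool" where
  "square_integrable M f \<longleftrightarrow> f \<in> borel_measurable M \<and> integrable M (\<lambda>x. (norm (f x))\<^sup>2)"

definition L2_norm :: "(real^3) set \<Rightarrow> (real^3 \<Rightarrow> real^3) \<Rightarrow> real" where
  "L2_norm D f = sqrt (LINT x|lebesgue_on D. (norm (f x))\<^sup>2)"

text \<open>Two-dimensional Lebesgue measure on a plane \<open>P\<close>, through an isometric parametrisation;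
  it does not depend on the parametrisation chosen.\<close>

definition plane_area :: "(real^3) set \<Rightarrow> (real^3) measure" where
  "plane_area P = distr lborel borel
     (SOME \<phi> :: real^2 \<Rightarrow> real^3. (\<forall>y z. dist (\<phi> y) (\<phi> z) = dist y z) \<and> range \<phi> = P)"

text \<open>Area of a polyhedral surface, summed over all planes. Only finitely many planes meet such
  a surface in positive area, and distinct planes intersect in null sets. On polyhedral
  surfaces this is the surface measure; it vanishes on curved surfaces.\<close>

definition polyhedral_area :: "(real^3) measure" where
  "polyhedral_area = measure_of UNIV (sets borel)
     (\<lambda>A. \<integral>\<^sup>+P. emeasure (plane_area P) A \<partial>count_space {P. affine P \<and> aff_dim P = 2})"

text \<open>Surface measure times Lebesgue measure on \<open>S \<times> I\<close>, completed so that the values of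
  traces and normals on edges play no role.\<close>

definition surface_time_measure :: "(real^3) set \<Rightarrow> real set \<Rightarrow> ((real^3) \<times> real) measure" where
  "surface_time_measure S I =
     completion (restrict_space polyhedral_area S \<Otimes>\<^sub>M restrict_space lborel I)"

text \<open>The normal is defined where \<open>D\<close> is locally a half-space; on a polyhedral boundary this is
  everywhere except on edges and vertices.\<close>

definition outward_normal :: "(real^3) set \<Rightarrow> real^3 \<Rightarrow> real^3" where
  "outward_normal D x = (THE n. norm n = 1 \<and>
     (\<exists>r>0. closure D \<inter> ball x r = {y \<in> ball x r. (y - x) \<bullet> n \<le> 0}))"

subsection \<open>The space-time discontinuous Galerkin method\<close>

text \<open>Up to edges, a point of \<open>frontier K\<close> lies on the boundary of the domain or on that of
  exactly one other element.\<close>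

definition neighbour :: "(real^3) set set \<Rightarrow> (real^3) set \<Rightarrow> real^3 \<Rightarrow> (real^3) set" where
  "neighbour \<K> K x = (THE K'. K' \<in> \<K> \<and> K' \<noteq> K \<and> x \<in> frontier K')"

definition average :: "(real^3) set set \<Rightarrow> (real^3) set \<Rightarrow> field \<Rightarrow> field" where
  "average \<K> K u x t = (1/2) *\<^sub>R (inner_trace K u x t + inner_trace (neighbour \<K> K x) u x t)"

definition H_flux :: "(real^3) set \<Rightarrow> (real^3) set set \<Rightarrow> (real^3) set \<Rightarrow> field \<Rightarrow> field" where
  "H_flux \<Omega> \<K> K H x t = (if x \<in> frontier \<Omega> then inner_trace K H x t else average \<K> K H x t)"

text \<open>The tangential flux \<open>n \<times> E\<^sup>*\<close>. On the boundary only this tangential part is prescribed.\<close>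

definition nE_flux ::
    "(real^3) set \<Rightarrow> (real^3) set set \<Rightarrow> real \<Rightarrow> (real^3) set \<Rightarrow> field \<Rightarrow> field \<Rightarrow> field" where
  "nE_flux \<Omega> \<K> \<beta> K E H x t = (let n = outward_normal K x in
     if x \<in> frontier \<Omega> then \<beta> *\<^sub>R cross3 n (cross3 (inner_trace K H x t) n)
     else cross3 n (average \<K> K E x t))"

text \<open>The slab is \<open>{a..b}\<close>; \<open>n \<times> (E - E\<^sup>*)\<close> is written as \<open>n \<times> E - n \<times> E\<^sup>*\<close>.\<close>

definition dg_B ::
    "(real^3) set \<Rightarrow> (real^3) set set \<Rightarrow> (real^3 \<Rightarrow> real) \<Rightarrow> (real^3 \<Rightarrow> real) \<Rightarrow> real \<Rightarrow>
     real \<Rightarrow> real \<Rightarrow> field \<Rightarrow> field \<Rightarrow> field \<Rightarrow> field \<Rightarrow> real" where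
  "dg_B \<Omega> \<K> \<epsilon> \<mu> \<beta> a b E H v w =
     (\<Sum>K\<in>\<K>. LINT (x, t)|lebesgue_on (K \<times> {a..b}).
        (\<epsilon> x *\<^sub>R time_deriv E x t - curl H x t) \<bullet> v x t
        + (\<mu> x *\<^sub>R time_deriv H x t + curl E x t) \<bullet> w x t)
     + (\<Sum>K\<in>\<K>. LINT x|lebesgue_on K. \<epsilon> x * (E x a \<bullet> v x a) + \<mu> x * (H x a \<bullet> w x a))
     + (\<Sum>K\<in>\<K>. LINT (x, t)|surface_time_measure (frontier K) {a..b}.
          cross3 (outward_normal K x) (inner_trace K H x t - H_flux \<Omega> \<K> K H x t) \<bullet> inner_trace K v x t
          - (cross3 (outward_normal K x) (inner_trace K E x t) - nE_flux \<Omega> \<K> \<beta> K E H x t)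
              \<bullet> inner_trace K w x t)"

definition dg_R ::
    "(real^3) set \<Rightarrow> (real^3) set set \<Rightarrow> (real^3 \<Rightarrow> real) \<Rightarrow> (real^3 \<Rightarrow> real) \<Rightarrow> field \<Rightarrow>
     real \<Rightarrow> real \<Rightarrow> field \<Rightarrow> field \<Rightarrow> field \<Rightarrow> field \<Rightarrow> real" where
  "dg_R \<Omega> \<K> \<epsilon> \<mu> g a b E H v w =
     (\<Sum>K\<in>\<K>. LINT x|lebesgue_on K. \<epsilon> x * (E x a \<bullet> v x a) + \<mu> x * (H x a \<bullet> w x a))
     - (LINT (x, t)|surface_time_measure (frontier \<Omega>) {a..b}.
          cross3 (outward_normal \<Omega> x) (g x t) \<bullet> inner_trace \<Omega> w x t)"

text \<open>\<open>Eh n\<close> and \<open>Hh n\<close> are the fields on slab \<open>n\<close>, so \<open>Eh (n - 1)\<close> at \<open>t (n - 1)\<close> is the final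
  value on the preceding slab and \<open>Eh n\<close> at \<open>t (n - 1)\<close> the initial value on slab \<open>n\<close>. For \<open>n = 0\<close>
  only the values at \<open>t 0\<close> matter. The energy identity balances slab \<open>n\<close> against the former value; with the
  latter in its place it fails, for instance if \<open>V 1\<close> is the zero space, \<open>E0\<close> is a nonzero
  constant and \<open>H0\<close> and \<open>g\<close> vanish.\<close>

definition dg_solution ::
    "(real^3) set \<Rightarrow> (real^3) set set \<Rightarrow> (real^3 \<Rightarrow> real) \<Rightarrow> (real^3 \<Rightarrow> real) \<Rightarrow> real \<Rightarrow> field \<Rightarrow>
     (real^3 \<Rightarrow> real^3) \<Rightarrow> (real^3 \<Rightarrow> real^3) \<Rightarrow> nat \<Rightarrow> (nat \<Rightarrow> real) \<Rightarrow>
     (nat \<Rightarrow> (field \<times> field) set) \<Rightarrow> (nat \<Rightarrow> field) \<Rightarrow> (nat \<Rightarrow> field) \<Rightarrow> bool" where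
  "dg_solution \<Omega> \<K> \<epsilon> \<mu> \<beta> g E0 H0 N t V Eh Hh \<longleftrightarrow>
     (\<forall>x\<in>\<Omega>. Eh 0 x (t 0) = E0 x \<and> Hh 0 x (t 0) = H0 x) \<and>
     (\<forall>n\<in>{1..N}. (Eh n, Hh n) \<in> V n \<and>
        (\<forall>(v, w)\<in>V n.
           dg_B \<Omega> \<K> \<epsilon> \<mu> \<beta> (t (n - 1)) (t n) (Eh n) (Hh n) v w =
           dg_R \<Omega> \<K> \<epsilon> \<mu> g (t (n - 1)) (t n) (Eh (n - 1)) (Hh (n - 1)) v w))"

end

theory Submission
  imports Defs
begin

text \<open>Testing the scheme with the solution itself turns the time derivatives into differences of
  energies, and completing the square against the previous slab produces the jump terms. It remains
  to see that the curl and flux terms reduce to the dissipation on \<open>\<partial>\<Omega>\<close>. By the divergence theorem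
  on each element the curl terms become the fluxes of \<open>E \<times> H\<close> through the element boundary; on an
  interior face these combine with the centred numerical fluxes to \<open>n \<bullet> (E\<^sub>K \<times> H\<^sub>L + E\<^sub>L \<times> H\<^sub>K) / 2\<close>, which
  cancels between the two elements \<open>K\<close> and \<open>L\<close> because their normals are opposite. All this holds off the edges,
  which lie in intersections of distinct face planes and hence are null sets.\<close>

subsection \<open>Area of planes\<close>

text \<open>The divergence theorem must hold for a surface measure of which only plane charts are
  known. To reach it, space is read as a bundle of lines in a fixed direction \<open>e\<close> over
  each face plane. Lebesgue measure then carries the factor
  \<open>\<bar>a \<bullet> e\<bar>\<close>, and counting exits against entries restores the sign of
  \<open>a \<bullet> e\<close>. The components need not vanish anywhere, so a line integral has no
  zero to start from: the integrand is continued behind the polytope by a piece whose integral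
  supplies the missing value. The other obstacle is that the integrands of the scheme are
  undetermined on null sets, while the integral of a non-integrable function is 0 by convention, so
  sums cannot be split freely. Every term is therefore replaced by a Borel function defined
  everywhere and bounded on bounded sets, built from the smooth extensions by sums over faces or
  elements with indicators (\<open>normal_field\<close>, \<open>surface_term\<close>,
  \<open>boundary_dissipation\<close>). These are balanced at fixed time and then integrated in
  time. Only the excitation \<open>g\<close> is unbounded; it enters through its square
  integrability.\<close>

lemma dist_preserving_affine:
  fixes \<phi> :: "'a::real_inner \<Rightarrow> 'b::real_inner"
  assumes "\<And>y z. dist (\<phi> y) (\<phi> z) = dist y z"
  obtains L where "linear L" "\<forall>y. norm (L y) = norm y" "\<forall>y. \<phi> y = \<phi> 0 + L y"
proof
  define L where "L = (\<lambda>y. \<phi> y - \<phi> 0)"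
  have n: "norm (L y) = norm y" for y
    using assms[of y 0] by (simp add: L_def dist_norm)
  have d: "norm (L y - L z) = norm (y - z)" for y z
    using assms[of y z] by (simp add: L_def dist_norm)
  have i: "L y \<bullet> L z = y \<bullet> z" for y z
    using d[of y z] n[of y] n[of z] by (simp add: dot_norm_neg)
  have "L (y + z) = L y + L z" for y z
  proof -
    \<comment> \<open>By \<open>i\<close> this squared norm equals that of
      \<open>(y + z) - y - z\<close>, which is zero. Homogeneity follows by the same device.\<close>
    have "(L (y + z) - L y - L z) \<bullet> (L (y + z) - L y - L z) = 0"
      by (simp add: inner_diff_left inner_diff_right i inner_add_left inner_add_right inner_commute)
    then have "L (y + z) - L y - L z = 0" by (simp only: inner_eq_zero_iff)
    then show ?thesis by (metis add.commute diff_add_cancel diff_diff_add right_minus_eq)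
  qed
  moreover have "L (c *\<^sub>R y) = c *\<^sub>R L y" for c y
  proof -
    have "(L (c *\<^sub>R y) - c *\<^sub>R L y) \<bullet> (L (c *\<^sub>R y) - c *\<^sub>R L y) = 0"
      by (simp add: inner_diff_left inner_diff_right i)
    then show ?thesis by simp
  qed
  ultimately show "linear L" by (rule linearI)
  show "\<forall>y. norm (L y) = norm y" by (simp add: n)
  show "\<forall>y. \<phi> y = \<phi> 0 + L y" by (simp add: L_def)
qed

text \<open>\<open>plane_area\<close> selects its chart by \<open>SOME\<close>. Exhibiting one
  isometric chart makes the choice meaningful; whichever chart is selected is then a point plus a
  linear isometry, which is all that integration over the plane requires.\<close>

lemma plane_chart:
  fixes a :: "real^3"
  assumes "a \<noteq> 0"
  obtains L :: "real^2 \<Rightarrow> real^3" and p where "linear L" "\<forall>y. norm (L y) = norm y"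
    "range (\<lambda>y. p + L y) = {x. a \<bullet> x = b}"
    "plane_area {x. a \<bullet> x = b} = distr lborel borel (\<lambda>y. p + L y)"
    "(\<lambda>y. p + L y) \<in> borel_measurable borel"
proof -
  let ?P = "{x. a \<bullet> x = b}"
  let ?Q = "\<lambda>\<phi> :: real^2 \<Rightarrow> real^3. (\<forall>y z. dist (\<phi> y) (\<phi> z) = dist y z) \<and> range \<phi> = ?P"
  \<comment> \<open>The foot of the perpendicular from the origin to the plane.\<close>
  define q where "q = (b / (a \<bullet> a)) *\<^sub>R a"
  have q: "a \<bullet> q = b" using assms by (simp add: q_def)
  have "dim {x. a \<bullet> x = 0} = 2" using assms by (simp add: dim_hyperplane)
  then obtain f :: "real^2 \<Rightarrow> real^3" where f: "linear f" "range f = {x. a \<bullet> x = 0}" "\<And>x. norm (f x) = norm x"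
    using isometry_subspaces[of "UNIV :: (real^2) set" "{x. a \<bullet> x = 0}"]
    using subspace_hyperplane[of a] by (auto simp: dim_UNIV)
  have "?Q (\<lambda>y. q + f y)"
  proof (intro conjI allI)
    show "dist (q + f y) (q + f z) = dist y z" for y z
      using f(3)[of "y - z"] by (simp add: dist_norm linear_diff[OF f(1)])
    have "x \<in> range (\<lambda>y. q + f y) \<longleftrightarrow> x - q \<in> range f" for x
      by (auto simp: image_iff algebra_simps)
    then show "range (\<lambda>y. q + f y) = ?P"
      using q by (auto simp: f(2) inner_diff_right)
  qed
  then have "\<exists>\<phi>. ?Q \<phi>" by (rule exI[of ?Q])
  then have S: "?Q (SOME \<phi>. ?Q \<phi>)" by (rule someI_ex)
  define \<phi> where "\<phi> = (SOME \<phi>. ?Q \<phi>)"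
  have \<phi>: "dist (\<phi> y) (\<phi> z) = dist y z" "range \<phi> = ?P" for y z
    using S unfolding \<phi>_def by auto
  obtain L where L: "linear L" "\<forall>y. norm (L y) = norm y" "\<forall>y. \<phi> y = \<phi> 0 + L y"
    using dist_preserving_affine[of \<phi>] \<phi>(1) by blast
  then have \<phi>L: "(\<lambda>y. \<phi> 0 + L y) = \<phi>" by (metis ext)
  show thesis
  proof
    show "range (\<lambda>y. \<phi> 0 + L y) = ?P" unfolding \<phi>L by (rule \<phi>(2))
    have "plane_area ?P = distr lborel borel \<phi>" by (simp add: plane_area_def \<phi>_def)
    then show "plane_area ?P = distr lborel borel (\<lambda>y. \<phi> 0 + L y)"
      unfolding \<phi>L .
    show "(\<lambda>y. \<phi> 0 + L y) \<in> borel_measurable borel"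
      using L(1) by (intro borel_measurable_continuous_onI continuous_intros linear_continuous_on)
        (simp add: linear_conv_bounded_linear)
  qed (use L in auto)
qed


section \<open>Lebesgue measure fibred over a plane along oblique lines\<close>

lemma borel_measurable_vector2 [measurable]:
  fixes f g :: "'a \<Rightarrow> real"
  assumes [measurable]: "f \<in> borel_measurable M" "g \<in> borel_measurable M"
  shows "(\<lambda>x. vector [f x, g x] :: real^2) \<in> borel_measurable M"
proof -
  have "(\<lambda>x. vector [f x, g x] :: real^2) = (\<lambda>x. f x *\<^sub>R axis 1 1 + g x *\<^sub>R axis 2 1)"
    by (auto simp: fun_eq_iff vec_eq_iff forall_2 axis_def)
  then show ?thesis by simp
qed

lemma borel_measurable_vec_nth' [measurable (raw)]:
  "f \<in> borel_measurable M \<Longrightarrow> (\<lambda>x. (f x :: real^'n) $ i) \<in> borel_measurable M"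
  by (rule borel_measurable_continuous_on[where f = "\<lambda>x. x $ i"]) (simp add: continuous_on_component)

lemma Basis_vec2: "(Basis :: (real^2) set) = {axis 1 1, axis 2 1}"
  by (auto simp: Basis_vec_def UNIV_2)

lemma Basis_vec3: "(Basis :: (real^3) set) = {axis 1 1, axis 2 1, axis 3 1}"
  by (auto simp: Basis_vec_def UNIV_3)

text \<open>Charts of planes live on \<open>real^2\<close> and Fubini on product types; this
  identification joins the two. It preserves the side lengths of boxes, and boxes determine the
  measure.\<close>

lemma lborel_vec3_split:
  "(lborel :: ((real^2) \<times> real) measure) = distr lborel borel (\<lambda>x :: real^3. (vector [x$1, x$2], x$3))"
proof (rule lborel_eqI)
  let ?T = "\<lambda>x :: real^3. (vector [x$1, x$2] :: real^2, x$3)"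
  have T: "?T \<in> lborel \<rightarrow>\<^sub>M borel"
    unfolding borel_prod[symmetric] by measurable
  fix l u :: "(real^2) \<times> real"
  assume lu: "\<And>b. b \<in> Basis \<Longrightarrow> l \<bullet> b \<le> u \<bullet> b"
  define l' u' :: "real^3" where "l' = vector [fst l $ 1, fst l $ 2, snd l]"
    and "u' = vector [fst u $ 1, fst u $ 2, snd u]"
  have ax: "axis 1 1 \<noteq> (axis 2 1 :: real^3)" "axis 1 1 \<noteq> (axis 3 1 :: real^3)"
     "axis 2 1 \<noteq> (axis 3 1 :: real^3)" "axis 1 1 \<noteq> (axis 2 1 :: real^2)"
    by (simp_all add: axis_eq_axis)
  have pb: "(Basis :: ((real^2) \<times> real) set) = {(axis 1 1, 0), (axis 2 1, 0), (0, 1)}"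
    by (auto simp: Basis_prod_def Basis_vec2)
  have le: "l' \<bullet> b \<le> u' \<bullet> b" if "b \<in> Basis" for b
    using that lu[of "(axis 1 1, 0)"] lu[of "(axis 2 1, 0)"] lu[of "(0, 1)"]
    by (auto simp: Basis_vec3 pb l'_def u'_def inner_axis inner_prod_def vector_3)
  have "?T -` box l u = box l' u'"
    by (auto simp: box_def Basis_vec3 pb l'_def u'_def inner_axis inner_prod_def)
  then have "emeasure (distr lborel borel ?T) (box l u) = emeasure lborel (box l' u')"
    by (subst emeasure_distr[OF T]) auto
  also have "\<dots> = (\<Prod>b\<in>Basis. (u' - l') \<bullet> b)"
    using le by (rule emeasure_lborel_box)
  also have "(\<Prod>b\<in>Basis. (u' - l') \<bullet> b) = (\<Prod>b\<in>Basis. (u - l) \<bullet> b)"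
    using ax by (simp add: Basis_vec3 pb l'_def u'_def inner_axis inner_prod_def)
  finally show "emeasure (distr lborel borel ?T) (box l u) = (\<Prod>b\<in>Basis. (u - l) \<bullet> b)" .
qed simp

text \<open>Cavalieri's principle for oblique fibres. In coordinates the fibration is affine with
  columns \<open>u\<close>, \<open>v\<close>, \<open>e\<close>; since \<open>u\<close> and
  \<open>v\<close> are orthonormal and orthogonal to \<open>a\<close>, their cross product is
  \<open>a\<close> or \<open>- a\<close>, so the determinant has modulus
  \<open>\<bar>a \<bullet> e\<bar>\<close>.\<close>

lemma lborel_fibred_over_plane:
  fixes L :: "real^2 \<Rightarrow> real^3" and a e p :: "real^3"
  assumes L: "linear L" "\<And>y. norm (L y) = norm y" "\<And>y. a \<bullet> L y = 0"
    and a: "norm a = 1" and e: "a \<bullet> e \<noteq> 0"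
  shows "lborel = density (distr lborel borel (\<lambda>z. p + L (fst z) + snd z *\<^sub>R e)) (\<lambda>_. ennreal \<bar>a \<bullet> e\<bar>)"
proof (rule lborel_eqI)
  let ?T = "\<lambda>x :: real^3. (vector [x$1, x$2] :: real^2, x$3)"
  let ?\<Psi> = "\<lambda>z. p + L (fst z) + snd z *\<^sub>R e"
  define u v where "u = L (axis 1 1)" and "v = L (axis 2 1)"
  define f :: "real^3 \<Rightarrow> real^3" where "f x = (x$1) *\<^sub>R u + (x$2) *\<^sub>R v + (x$3) *\<^sub>R e" for x
  have Lv: "L y = (y$1) *\<^sub>R u + (y$2) *\<^sub>R v" for y
  proof -
    have "y = (y$1) *\<^sub>R axis 1 1 + (y$2) *\<^sub>R axis 2 1"
      by (auto simp: vec_eq_iff forall_2 axis_def)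
    then have "L y = L ((y$1) *\<^sub>R axis 1 1 + (y$2) *\<^sub>R axis 2 1)" by simp
    then show ?thesis
      by (simp only: u_def v_def linear_add[OF L(1)] linear_scale[OF L(1)])
  qed
  have Li: "L y \<bullet> L z = y \<bullet> z" for y z
    using L(2)[of "y - z"] L(2)[of y] L(2)[of z] by (simp add: dot_norm_neg linear_diff[OF L(1)])
  have uv: "norm u = 1" "norm v = 1" "u \<bullet> v = 0" "a \<bullet> u = 0" "a \<bullet> v = 0"
    by (auto simp: u_def v_def L Li norm_axis_1 inner_axis_axis)
  have det: "\<bar>det (matrix f)\<bar> = \<bar>a \<bullet> e\<bar>"
  proof -
    have "matrix f = transpose (vector [u, v, e])"
      by (auto simp: vec_eq_iff matrix_def transpose_def forall_3 f_def axis_def)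
    then have 1: "det (matrix f) = cross3 u v \<bullet> e"
      by (simp add: det_transpose dot_cross_det[symmetric] cross3_def inner_vec_def sum_3 algebra_simps)
    have n1: "norm (cross3 u v) = 1"
      using norm_cross_dot[of u v] uv power2_eq_imp_eq[of "norm (cross3 u v)" 1] by simp
    \<comment> \<open>The part \<open>?w\<close> of \<open>cross3 u v\<close> orthogonal to
      \<open>a\<close> also has zero cross product with \<open>a\<close>, hence it vanishes.\<close>
    have "cross3 u v = (a \<bullet> cross3 u v) *\<^sub>R a"
    proof -
      let ?w = "cross3 u v - (a \<bullet> cross3 u v) *\<^sub>R a"
      have "a \<bullet> a = 1" using a by (simp add: dot_square_norm)
      then have aw: "a \<bullet> ?w = 0" by (simp add: inner_diff_right)
      have "cross3 a (cross3 u v) = (a \<bullet> v) *\<^sub>R u - (a \<bullet> u) *\<^sub>R v"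
        by (simp add: cross3_def vec_eq_iff forall_3 inner_vec_def sum_3 algebra_simps)
      then have "cross3 a ?w = 0"
        using uv by (simp add: Cross3.right_diff_distrib cross_mult_right)
      then have "?w = 0" using norm_cross_dot[of a ?w] a aw by simp
      then show ?thesis by simp
    qed
    then have eq: "cross3 u v = (a \<bullet> cross3 u v) *\<^sub>R a" .
    then have "norm (cross3 u v) = \<bar>a \<bullet> cross3 u v\<bar>" using a by (metis norm_scaleR mult.right_neutral)
    then have "\<bar>a \<bullet> cross3 u v\<bar> = 1" using n1 by simp
    moreover have "cross3 u v \<bullet> e = (a \<bullet> cross3 u v) * (a \<bullet> e)" using eq by (metis inner_scaleR_left)
    ultimately show ?thesis unfolding 1 by (simp add: abs_mult)
  qed
  have linf: "linear f"
    unfolding f_def by (intro linearI) (auto simp: algebra_simps)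
  have \<Psi>T: "?\<Psi> (?T x) = p + f x" for x
    by (simp add: f_def Lv)
  have inj: "inj f" using det e linf det_nz_iff_inj by fastforce
  have [measurable]: "L \<in> borel_measurable borel"
    using L(1) by (simp add: borel_measurable_continuous_onI linear_continuous_on linear_conv_bounded_linear)
  have \<Psi>m: "?\<Psi> \<in> borel_measurable borel"
    unfolding borel_prod[symmetric] by measurable
  have Tm: "?T \<in> borel_measurable lborel"
    unfolding borel_prod[symmetric] by measurable
  show "emeasure (density (distr lborel borel ?\<Psi>) (\<lambda>_. ennreal \<bar>a \<bullet> e\<bar>)) (box l r) = (\<Prod>b\<in>Basis. (r - l) \<bullet> b)"
    if lr: "\<And>b. b \<in> Basis \<Longrightarrow> l \<bullet> b \<le> r \<bullet> b" for l r
  proof -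
    \<comment> \<open>A box is measured through its preimage under the affine coordinates, whose
      linear part \<open>f\<close> scales volume by the determinant.\<close>
    define S where "S = f -` (box (l - p) (r - p))"
    have "emeasure (distr lborel borel ?\<Psi>) (box l r) = emeasure (lborel :: (_ \<times> _) measure) (?\<Psi> -` box l r)"
      using \<Psi>m by (subst emeasure_distr) auto
    also have "\<dots> = emeasure lborel (?T -` (?\<Psi> -` box l r))"
      using \<Psi>m Tm by (subst lborel_vec3_split, subst emeasure_distr) (auto intro: measurable_sets_borel)
    also have "?T -` (?\<Psi> -` box l r) = S"
    proof (intro set_eqI)
      fix x
      have "x \<in> ?T -` (?\<Psi> -` box l r) \<longleftrightarrow> ?\<Psi> (?T x) \<in> box l r" by simp
      also have "\<dots> \<longleftrightarrow> x \<in> S"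
        unfolding \<Psi>T by (auto simp: S_def mem_box inner_diff_left inner_add_left algebra_simps)
      finally show "x \<in> ?T -` (?\<Psi> -` box l r) \<longleftrightarrow> x \<in> S" .
    qed
    finally have 1: "emeasure (distr lborel borel ?\<Psi>) (box l r) = emeasure lborel S" .
    have surj: "surj f" by (rule linear_injective_imp_surjective[OF linf inj refl])
    have fS: "f ` S = box (l - p) (r - p)" unfolding S_def using surj by (simp add: surj_image_vimage_eq)
    obtain g where g: "linear g" "\<And>x. g (f x) = x" "\<And>x. f (g x) = x"
      using linear_injective_isomorphism[OF linf inj] by auto
    have Sg: "S = g ` box (l - p) (r - p)"
    proof (intro set_eqI iffI)
      fix x assume "x \<in> S"
      then have "f x \<in> box (l - p) (r - p)" by (simp add: S_def)
      then have "g (f x) \<in> g ` box (l - p) (r - p)" by (rule imageI)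
      then show "x \<in> g ` box (l - p) (r - p)" by (simp only: g(2))
    next
      fix x assume "x \<in> g ` box (l - p) (r - p)"
      then obtain y where "x = g y" "y \<in> box (l - p) (r - p)" by (rule imageE)
      then show "x \<in> S" by (simp add: S_def g(3))
    qed
    have "S \<in> lmeasurable" unfolding Sg
      by (rule measurable_linear_image[OF g(1)]) simp
    moreover have "S \<in> sets borel" unfolding S_def
      using linf by (intro measurable_sets_borel[OF borel_measurable_continuous_onI])
         (auto simp: linear_continuous_on linear_conv_bounded_linear)
    ultimately have "emeasure lborel S = ennreal (measure lebesgue S)" "measure lebesgue S = measure lborel S"
      using emeasure_eq_measure2[of S lebesgue] by simp_all
    moreover have "measure lebesgue (f ` S) = \<bar>a \<bullet> e\<bar> * measure lebesgue S"
      using measure_linear_image[OF linf \<open>S \<in> lmeasurable\<close>] det by simp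
    moreover have "measure lebesgue (box (l - p) (r - p)) = (\<Prod>b\<in>Basis. (r - l) \<bullet> b)"
      using lr by (simp add: measure_lborel_box_eq inner_diff_left)
    ultimately show ?thesis
      by (simp add: emeasure_density_const 1 fS ennreal_mult[symmetric])
  qed
qed simp

section \<open>Null sets and finiteness of plane and surface area\<close>

lemma sets_plane_area [simp]: "sets (plane_area P) = sets borel"
  by (simp add: plane_area_def)

lemma space_plane_area [simp]: "space (plane_area P) = UNIV"
  by (simp add: plane_area_def)

text \<open>In a chart of the first plane the second has a linear equation with coefficient vector
  \<open>adjoint L c\<close>. Its solutions form a null set unless the equation is trivial; then the
  first plane lies in the second, and equal dimension makes them coincide.\<close>

lemma emeasure_plane_area_other_plane:
  fixes a c :: "real^3"
  assumes "a \<noteq> 0" "{x. a \<bullet> x = b} \<noteq> {x. c \<bullet> x = d}" "c \<noteq> 0"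
  shows "emeasure (plane_area {x. a \<bullet> x = b}) {x. c \<bullet> x = d} = 0"
proof -
  obtain L :: "real^2 \<Rightarrow> real^3" and p where L: "linear L" "\<forall>y. norm (L y) = norm y"
    "range (\<lambda>y. p + L y) = {x. a \<bullet> x = b}"
    "plane_area {x. a \<bullet> x = b} = distr lborel borel (\<lambda>y. p + L y)"
    "(\<lambda>y. p + L y) \<in> borel_measurable borel"
    by (rule plane_chart[OF assms(1), of b])
  let ?w = "adjoint L c"
  have w: "c \<bullet> (p + L y) = c \<bullet> p + ?w \<bullet> y" for y
    using adjoint_works[OF L(1), of y c] by (simp add: inner_add_right inner_commute)
  have "emeasure (plane_area {x. a \<bullet> x = b}) {x. c \<bullet> x = d} = emeasure lborel {y. ?w \<bullet> y = d - c \<bullet> p}"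
    using w by (subst L(4), subst emeasure_distr)
       (auto intro!: L(5) arg_cong2[where f=emeasure] borel_closed closed_hyperplane)
  also have "\<dots> = 0"
  proof (cases "?w = 0 \<and> d - c \<bullet> p = 0")
    case True
    then have "c \<bullet> (p + L y) = d" for y using w by simp
    then have sub: "{x. a \<bullet> x = b} \<subseteq> {x. c \<bullet> x = d}" using L(3) by (auto simp: set_eq_iff image_iff) metis
    have "{x. a \<bullet> x = b} = {x. c \<bullet> x = d}"
      using sub assms
      using L(3) by (intro affine_dim_equal) (auto simp: affine_hyperplane)
    then show ?thesis using assms(2) by simp
  next
    case False
    then have "negligible {y. ?w \<bullet> y = d - c \<bullet> p}" by (intro negligible_hyperplane) auto
    then show ?thesis
      by (simp add: negligible_iff_null_sets null_sets_completion_iff borel_closed closed_hyperplane null_setsD1)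
  qed
  finally show ?thesis .
qed

definition is_plane :: "(real^3) set \<Rightarrow> bool" where
  "is_plane P \<longleftrightarrow> (\<exists>a b. a \<noteq> 0 \<and> P = {x. a \<bullet> x = b})"

lemma is_planeI: "a \<noteq> 0 \<Longrightarrow> is_plane {x. a \<bullet> x = b}"
  by (auto simp: is_plane_def)

text \<open>Connects the equations used for faces with the affine planes over which
  \<open>polyhedral_area\<close> sums.\<close>

lemma is_plane_iff: "is_plane P \<longleftrightarrow> affine P \<and> aff_dim P = 2"
proof
  assume "is_plane P"
  then show "affine P \<and> aff_dim P = 2" by (auto simp: is_plane_def affine_hyperplane)
next
  assume "affine P \<and> aff_dim P = 2"
  then show "is_plane P"
    using aff_dim_eq_hyperplane[of P] by (simp add: is_plane_def hull_same)
qed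

lemma is_plane_closed: "is_plane P \<Longrightarrow> closed P"
  by (auto simp: is_plane_def closed_hyperplane)

lemma emeasure_plane_area_distinct:
  "is_plane P \<Longrightarrow> is_plane Q \<Longrightarrow> P \<noteq> Q \<Longrightarrow> emeasure (plane_area P) Q = 0"
  by (auto simp: is_plane_def intro!: emeasure_plane_area_other_plane)

lemma sets_polyhedral_area [simp, measurable_cong]: "sets polyhedral_area = sets borel"
  unfolding polyhedral_area_def using sets.sets_measure_of_eq[of borel] by simp

lemma space_polyhedral_area [simp]: "space polyhedral_area = UNIV"
  by (simp add: polyhedral_area_def)

text \<open>The family of planes is uncountable, but the sum over it is an integral against counting
  measure, and such integrals commute with countable sums of nonnegative terms. This gives the
  countable additivity that \<open>measure_of\<close> demands.\<close>

lemma emeasure_polyhedral_area: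
  assumes "A \<in> sets borel"
  shows "emeasure polyhedral_area A = (\<integral>\<^sup>+P. emeasure (plane_area P) A \<partial>count_space (Collect is_plane))"
proof -
  have eq: "Collect is_plane = {P. affine P \<and> aff_dim P = 2}" by (auto simp: is_plane_iff)
  show ?thesis unfolding eq
  proof (rule emeasure_measure_of[OF polyhedral_area_def])
    show "A \<in> sets polyhedral_area" using assms by simp
    show "positive (sets polyhedral_area) (\<lambda>A. \<integral>\<^sup>+P. emeasure (plane_area P) A \<partial>count_space {P. affine P \<and> aff_dim P = 2})"
      by (simp add: positive_def)
    show "countably_additive (sets polyhedral_area)
        (\<lambda>A. \<integral>\<^sup>+P. emeasure (plane_area P) A \<partial>count_space {P. affine P \<and> aff_dim P = 2})"
      by (auto simp: countably_additive_def nn_integral_suminf[symmetric] intro!: nn_integral_cong suminf_emeasure)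
  qed auto
qed

text \<open>All summands but one vanish, because every other plane regards \<open>P\<close> as a
  null set.\<close>

lemma emeasure_polyhedral_area_plane:
  assumes "is_plane P" "B \<subseteq> P" "B \<in> sets borel"
  shows "emeasure polyhedral_area B = emeasure (plane_area P) B"
proof -
  have "emeasure polyhedral_area B = (\<Sum>Q\<in>{P}. emeasure (plane_area Q) B)"
    unfolding emeasure_polyhedral_area[OF assms(3)]
  proof (rule nn_integral_count_space')
    fix Q assume "Q \<in> Collect is_plane" "Q \<notin> {P}"
    then have "emeasure (plane_area Q) P = 0" using emeasure_plane_area_distinct assms by simp
    then show "emeasure (plane_area Q) B = 0"
      using emeasure_mono[OF assms(2), of "plane_area Q"] is_plane_closed[OF assms(1)] by simp
  qed (use assms in auto)
  then show ?thesis by simp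
qed

lemma polyhedral_area_null_inter:
  assumes "is_plane P" "is_plane Q" "P \<noteq> Q"
  shows "P \<inter> Q \<in> null_sets polyhedral_area"
proof -
  have "emeasure (plane_area P) (P \<inter> Q) \<le> emeasure (plane_area P) Q"
    using assms by (intro emeasure_mono) (auto simp: is_plane_closed)
  then show ?thesis
    using assms emeasure_polyhedral_area_plane[of P "P \<inter> Q"] emeasure_plane_area_distinct[OF assms]
    by (auto simp: is_plane_closed null_sets_def)
qed

lemma emeasure_plane_area_bounded:
  assumes "is_plane P" "bounded B" "B \<in> sets borel"
  shows "emeasure (plane_area P) B < \<infinity>"
proof -
  obtain a b where ab: "a \<noteq> 0" "P = {x. a \<bullet> x = b}" using assms by (auto simp: is_plane_def)
  obtain L :: "real^2 \<Rightarrow> real^3" and p where L: "linear L" "\<forall>y. norm (L y) = norm y"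
    "plane_area P = distr lborel borel (\<lambda>y. p + L y)" "(\<lambda>y. p + L y) \<in> borel_measurable borel"
    unfolding ab(2) by (rule plane_chart[OF ab(1), of b])
  obtain r where r: "\<And>x. x \<in> B \<Longrightarrow> norm x \<le> r" using assms(2) by (auto simp: bounded_iff)
  have "(\<lambda>y. p + L y) -` B \<subseteq> cball 0 (r + norm p)"
  proof
    fix y assume "y \<in> (\<lambda>y. p + L y) -` B"
    then have "norm (p + L y) \<le> r" using r by auto
    then have "norm (L y) \<le> r + norm p" using norm_diff_ineq[of "L y" p] by (simp add: add.commute)
    then show "y \<in> cball 0 (r + norm p)" by (simp add: L(2))
  qed
  then have "bounded ((\<lambda>y. p + L y) -` B)" by (rule bounded_subset[OF bounded_cball])
  then have "emeasure lborel ((\<lambda>y. p + L y) -` B) < \<infinity>" by (rule emeasure_bounded_finite)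
  then show ?thesis
    using assms(3) by (simp add: L(3) emeasure_distr L(4))
qed

text \<open>Restricted to a subset of one plane, the surface measure and the plane area are the same
  measure.\<close>

lemma integral_polyhedral_area_plane:
  fixes f :: "real^3 \<Rightarrow> real"
  assumes "is_plane P" "F \<subseteq> P" "F \<in> sets borel"
  shows "(LINT x|polyhedral_area. indicator F x * f x) = (LINT x|plane_area P. indicator F x * f x)"
proof -
  have "restrict_space polyhedral_area F = restrict_space (plane_area P) F"
  proof (rule measure_eqI)
    show "sets (restrict_space polyhedral_area F) = sets (restrict_space (plane_area P) F)"
      by (intro sets_restrict_space_cong) simp
    fix A assume "A \<in> sets (restrict_space polyhedral_area F)"
    then have "A \<subseteq> F" "A \<in> sets borel" using assms(3) by (auto simp: sets_restrict_space)
    then show "emeasure (restrict_space polyhedral_area F) A = emeasure (restrict_space (plane_area P) F) A"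
      using assms emeasure_polyhedral_area_plane[of P A] by (simp add: emeasure_restrict_space)
  qed
  then show ?thesis
    using integral_restrict_space[of F polyhedral_area f] integral_restrict_space[of F "plane_area P" f] assms
    by simp
qed

lemma sum_single:
  assumes "finite I" "k \<in> I" "\<And>i. i \<in> I \<Longrightarrow> i \<noteq> k \<Longrightarrow> f i = 0"
  shows "sum f I = f k"
  using sum.mono_neutral_right[of I "{k}" f] assms by auto

subsection \<open>The divergence theorem on convex polytopes\<close>

text \<open>\<open>S\<close> is an interval whose ends come from upper bounds
  (\<open>0 < \<sigma> j\<close>) and lower bounds; \<open>V\<close> stands for the constraints
  independent of \<open>s\<close>. Since the \<open>u j\<close> are distinct, exactly one upper and
  one lower crossing lie in \<open>S\<close>, namely its ends \<open>r\<close> and \<open>l\<close>.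
  The sum thus asks whether the exit \<open>r\<close> is ahead of 0, minus whether the entry
  \<open>l\<close> is.\<close>

lemma signed_crossing_count:
  fixes u \<sigma> :: "'j \<Rightarrow> real"
  assumes J: "finite J" and \<sigma>: "\<And>j. j \<in> J \<Longrightarrow> \<sigma> j \<noteq> 0"
    and inj: "inj_on u J" and nz: "\<And>j. j \<in> J \<Longrightarrow> u j \<noteq> 0"
    and S: "S = {s. V \<and> (\<forall>j\<in>J. if 0 < \<sigma> j then s \<le> u j else u j \<le> s)}"
    and bdd: "bounded S"
  shows "(\<Sum>j\<in>J. sgn (\<sigma> j) * of_bool (0 \<le> u j \<and> u j \<in> S)) = (of_bool (0 \<in> S) :: real)"
proof (cases "S = {}")
  case True
  then show ?thesis by simp
next
  case False
  then obtain s0 where s0: "s0 \<in> S" by auto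
  let ?f = "\<lambda>j. sgn (\<sigma> j) * of_bool (0 \<le> u j \<and> u j \<in> S)"
  obtain B where B: "\<And>s. s \<in> S \<Longrightarrow> \<bar>s\<bar> \<le> B" using bdd by (auto simp: bounded_iff)
  define Up where "Up = {j\<in>J. 0 < \<sigma> j}"
  define Lo where "Lo = {j\<in>J. \<sigma> j < 0}"
  have fin: "finite Up" "finite Lo" using J by (auto simp: Up_def Lo_def)
  have JUL: "J = Up \<union> Lo" "Up \<inter> Lo = {}" using \<sigma> by (force simp: Up_def Lo_def)+
  have V: V using s0 by (simp add: S)
  have S': "s \<in> S \<longleftrightarrow> (\<forall>j\<in>Up. s \<le> u j) \<and> (\<forall>j\<in>Lo. u j \<le> s)" for s
    using V \<sigma> by (force simp: S Up_def Lo_def not_less)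
  have "Up \<noteq> {}"
  proof
    assume "Up = {}"
    \<comment> \<open>Without upper bounds \<open>S\<close> is closed under moving right, so it
      would leave every bounded set; the case of no lower bounds is symmetric.\<close>
    then have "max s0 (B + 1) \<in> S" using s0 by (auto simp: S' le_max_iff_disj)
    then show False using B[of "max s0 (B + 1)"] by linarith
  qed
  have "Lo \<noteq> {}"
  proof
    assume "Lo = {}"
    then have "min s0 (- B - 1) \<in> S" using s0 by (auto simp: S' min_le_iff_disj)
    then show False using B[of "min s0 (- B - 1)"] by linarith
  qed
  define r where "r = Min (u ` Up)"
  define l where "l = Max (u ` Lo)"
  have "r \<in> u ` Up" unfolding r_def using fin \<open>Up \<noteq> {}\<close> by (intro Min_in) auto
  then obtain jr where jr: "jr \<in> Up" "u jr = r" by auto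
  have "l \<in> u ` Lo" unfolding l_def using fin \<open>Lo \<noteq> {}\<close> by (intro Max_in) auto
  then obtain jl where jl: "jl \<in> Lo" "u jl = l" by auto
  have S2: "s \<in> S \<longleftrightarrow> l \<le> s \<and> s \<le> r" for s
    unfolding S' r_def l_def using fin \<open>Up \<noteq> {}\<close> \<open>Lo \<noteq> {}\<close> by auto
  have lr: "l \<le> r" using s0 S2 by force
  have ul: "u j \<le> l" if "j \<in> Lo" for j unfolding l_def using fin that by simp
  have ur: "r \<le> u j" if "j \<in> Up" for j unfolding r_def using fin that by simp
  have "jl \<noteq> jr" using jl jr JUL by auto
  then have "l \<noteq> r" using jl jr inj JUL by (auto simp: inj_on_def)
  have uniqU: "u j \<in> S \<longleftrightarrow> j = jr" if "j \<in> Up" for j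
  proof -
    have "u j \<in> S \<longleftrightarrow> u j = r" using ur[OF that] lr by (auto simp: S2)
    also have "\<dots> \<longleftrightarrow> j = jr" using inj JUL that jr by (auto simp: inj_on_def)
    finally show ?thesis .
  qed
  have uniqL: "u j \<in> S \<longleftrightarrow> j = jl" if "j \<in> Lo" for j
  proof -
    have "u j \<in> S \<longleftrightarrow> u j = l" using ul[OF that] lr by (auto simp: S2)
    also have "\<dots> \<longleftrightarrow> j = jl" using inj JUL that jl by (auto simp: inj_on_def)
    finally show ?thesis .
  qed
  have "(\<Sum>j\<in>Up. ?f j) = (\<Sum>j\<in>Up. if j = jr then of_bool (0 \<le> r) else (0::real))"
    using uniqU jr by (intro sum.cong) (auto simp: Up_def)
  also have "\<dots> = of_bool (0 \<le> r)" using fin jr by simp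
  finally have 1: "(\<Sum>j\<in>Up. ?f j) = (of_bool (0 \<le> r) :: real)" .
  have "(\<Sum>j\<in>Lo. ?f j) = (\<Sum>j\<in>Lo. if j = jl then - of_bool (0 \<le> l) else (0::real))"
    using uniqL jl by (intro sum.cong) (auto simp: Lo_def)
  also have "\<dots> = - of_bool (0 \<le> l)" using fin jl by simp
  finally have 2: "(\<Sum>j\<in>Lo. ?f j) = (- of_bool (0 \<le> l) :: real)" .
  \<comment> \<open>For an entry exactly at 0 the difference would be 0 although 0 lies in
    \<open>S\<close>.\<close>
  have "l \<noteq> 0" using nz jl JUL by auto
  moreover have "(\<Sum>j\<in>J. ?f j) = (of_bool (0 \<le> r) - of_bool (0 \<le> l) :: real)"
    unfolding JUL(1) sum.union_disjoint[OF fin JUL(2)] 1 2 by simp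
  ultimately show ?thesis using lr by (auto simp: S2)
qed

text \<open>Down to the level \<open>- m\<close> the integral of \<open>D\<close> is
  \<open>G x\<close> minus the value of \<open>G\<close> at the foot of the line on that level.
  \<open>h\<close> carries this foot value along one further unit of length, so the total is exactly
  \<open>G x\<close> and \<open>h\<close> still vanishes far behind.\<close>

lemma backward_line_integral:
  fixes G D :: "real^3 \<Rightarrow> real"
  assumes e: "norm e = 1"
    and deriv: "\<And>x. ((\<lambda>s. G (x + s *\<^sub>R e)) has_real_derivative D x) (at 0)"
    and D: "continuous_on UNIV D"
    and x: "- m \<le> x \<bullet> e"
  defines "h \<equiv> \<lambda>x. if - m \<le> x \<bullet> e then D x else if - m - 1 \<le> x \<bullet> e then G (x - (x \<bullet> e + m) *\<^sub>R e) else 0"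
  shows "has_bochner_integral lborel (\<lambda>s. indicator {..0} s * h (x + s *\<^sub>R e)) (G x)"
proof -
  define \<tau> where "\<tau> = x \<bullet> e + m"
  have \<tau>: "0 \<le> \<tau>" using x by (simp add: \<tau>_def)
  have ee: "e \<bullet> e = 1" using e by (simp add: dot_square_norm)
  let ?J = "{- \<tau> - 1..<- \<tau>}" and ?y = "x + (- \<tau>) *\<^sub>R e"
  have d: "((\<lambda>s. G (x + s *\<^sub>R e)) has_vector_derivative D (x + s *\<^sub>R e)) (at s within A)" for s A
  proof -
    have "((\<lambda>s'. G ((x + s *\<^sub>R e) + s' *\<^sub>R e)) has_real_derivative D (x + s *\<^sub>R e)) (at (s - s))"
      using deriv[of "x + s *\<^sub>R e"] by simp
    from DERIV_shift[THEN iffD1] this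
    have "((\<lambda>s'. G ((x + s *\<^sub>R e) + (s' - s) *\<^sub>R e)) has_real_derivative D (x + s *\<^sub>R e)) (at s)"
      using DERIV_shift[of "\<lambda>s'. G ((x + s *\<^sub>R e) + (s' - s) *\<^sub>R e)" _ 0 s] by (simp add: algebra_simps)
    then show ?thesis
      by (simp add: has_real_derivative_iff_has_vector_derivative has_vector_derivative_at_within algebra_simps)
  qed
  have "has_bochner_integral lborel (\<lambda>s. indicator {- \<tau>..0} s *\<^sub>R D (x + s *\<^sub>R e)) (G (x + 0 *\<^sub>R e) - G (?y))"
    using \<tau> by (intro has_bochner_integral_FTC_Icc d continuous_intros continuous_on_subset[OF D])
      (auto intro!: continuous_on_compose2[OF D] continuous_intros)
  \<comment> \<open>The interval has length one, so its contribution cancels the lower limit of the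
    fundamental theorem; being half-open, it does not overlap the first piece.\<close>
  moreover have "has_bochner_integral lborel (\<lambda>s. indicator ?J s *\<^sub>R G ?y) (measure lborel ?J *\<^sub>R G ?y)"
    by (intro has_bochner_integral_indicator) auto
  ultimately have "has_bochner_integral lborel (\<lambda>s. indicator {- \<tau>..0} s *\<^sub>R D (x + s *\<^sub>R e) + indicator ?J s *\<^sub>R G ?y)
     (G (x + 0 *\<^sub>R e) - G (?y) + measure lborel ?J *\<^sub>R G ?y)"
    by (rule has_bochner_integral_add)
  moreover have "indicator {- \<tau>..0} s *\<^sub>R D (x + s *\<^sub>R e) + indicator ?J s *\<^sub>R G ?y
     = indicator {..0} s * h (x + s *\<^sub>R e)" for s
  proof -
    have 1: "(x + s *\<^sub>R e) \<bullet> e = \<tau> - m + s" by (simp add: inner_add_left ee \<tau>_def)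
    have 2: "x + s *\<^sub>R e - ((x + s *\<^sub>R e) \<bullet> e + m) *\<^sub>R e = ?y"
      unfolding 1 by (simp add: algebra_simps)
    have 3: "x + s *\<^sub>R e - (\<tau> + s) *\<^sub>R e = x - \<tau> *\<^sub>R e" by (simp add: algebra_simps)
    show ?thesis using \<tau> unfolding h_def 2 1 by (auto simp: indicator_def 3)
  qed
  ultimately show ?thesis by simp
qed


lemma continuous_norm_bounded_on_cball:
  fixes f :: "'a::euclidean_space \<Rightarrow> 'b::real_normed_vector"
  assumes "continuous_on UNIV f"
  shows "\<exists>C. \<forall>x\<in>cball c r. norm (f x) \<le> C"
proof -
  have "compact (f ` cball c r)"
    using assms by (intro compact_continuous_image) (auto intro: continuous_on_subset)
  from compact_imp_bounded[OF this] show ?thesis by (simp add: bounded_iff)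
qed

text \<open>\<open>u x\<close> is the parameter at which the line through \<open>x\<close> meets the
  plane. The points with \<open>0 \<le> u x\<close> and crossing point in \<open>K\<close> form the
  half-infinite prism behind the facet. Fibring it over the plane leaves on each line the backward
  integral of \<open>h\<close>, which is \<open>G\<close> at the crossing point.\<close>

lemma crossing_integral:
  fixes G D :: "real^3 \<Rightarrow> real" and b :: real
  assumes a: "norm a = 1" and e: "norm e = 1" and ae: "a \<bullet> e \<noteq> 0"
    and K: "compact K" and m: "\<And>x. x \<in> K \<Longrightarrow> - m \<le> x \<bullet> e"
    and deriv: "\<And>x. ((\<lambda>s. G (x + s *\<^sub>R e)) has_real_derivative D x) (at 0)"
    and D: "continuous_on UNIV D" and G: "continuous_on UNIV G"
  defines "h \<equiv> \<lambda>x. if - m \<le> x \<bullet> e then D x else if - m - 1 \<le> x \<bullet> e then G (x - (x \<bullet> e + m) *\<^sub>R e) else 0"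
    and "u \<equiv> \<lambda>x. (b - a \<bullet> x) / (a \<bullet> e)"
  shows "integrable lborel (\<lambda>x. of_bool (0 \<le> u x \<and> x + u x *\<^sub>R e \<in> K) * h x)" (is ?I)
    and "(LINT x|lborel. of_bool (0 \<le> u x \<and> x + u x *\<^sub>R e \<in> K) * h x)
      = \<bar>a \<bullet> e\<bar> * (LINT x|plane_area {x. a \<bullet> x = b}. indicator K x * G x)" (is ?E)
proof -
  have [measurable]: "D \<in> borel_measurable borel" "G \<in> borel_measurable borel" "K \<in> sets borel"
    using D G K by (auto intro: borel_measurable_continuous_onI borel_compact)
  have [measurable]: "h \<in> borel_measurable borel" unfolding h_def by measurable
  have [measurable]: "u \<in> borel_measurable borel" unfolding u_def by measurable
  let ?f = "\<lambda>x. of_bool (0 \<le> u x \<and> x + u x *\<^sub>R e \<in> K) * h x"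
  have fm[measurable]: "?f \<in> borel_measurable borel" by measurable
  obtain r where r: "\<And>x. x \<in> K \<Longrightarrow> norm x \<le> r" using compact_imp_bounded[OF K] by (auto simp: bounded_iff)
  have ee: "e \<bullet> e = 1" using e by (simp add: dot_square_norm)
  \<comment> \<open>\<open>h\<close> vanishes below the level \<open>- m - 1\<close>, and the
    crossing point has level at most \<open>r\<close>; so \<open>u x\<close> is at most
    \<open>r + m + 1\<close>, and \<open>x\<close> is within that distance of a point of
    \<open>K\<close>.\<close>
  have supp: "norm x \<le> r + (r + m + 1)" if "?f x \<noteq> 0" for x
  proof -
    have x: "0 \<le> u x" "x + u x *\<^sub>R e \<in> K" "h x \<noteq> 0" using that by (auto simp: of_bool_def split: if_splits)
    have "(x + u x *\<^sub>R e) \<bullet> e \<le> r"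
      using norm_cauchy_schwarz[of "x + u x *\<^sub>R e" e] r[OF x(2)] e by simp
    moreover have "- m - 1 \<le> x \<bullet> e" using x(3) by (auto simp: h_def split: if_splits)
    ultimately have "u x \<le> r + m + 1" by (simp add: inner_add_left ee)
    moreover have "norm x \<le> norm (x + u x *\<^sub>R e) + norm (u x *\<^sub>R e)"
      using norm_triangle_ineq4[of "x + u x *\<^sub>R e" "u x *\<^sub>R e"] by simp
    ultimately show ?thesis using r[OF x(2)] x(1) e by simp
  qed
  define R where "R = r + (r + m + 1)"
  \<comment> \<open>Bounds the argument of \<open>G\<close> in \<open>h\<close>, which is displaced
    from \<open>x\<close> by at most
    \<open>\<bar>x \<bullet> e\<bar> + \<bar>m\<bar>\<close>.\<close>
  define R' where "R' = R + \<bar>R\<bar> + \<bar>m\<bar>"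
  obtain C1 where C1: "\<And>x. x \<in> cball 0 R \<Longrightarrow> norm (D x) \<le> C1"
    using continuous_norm_bounded_on_cball[OF D] by blast
  obtain C2 where C2: "\<And>x. x \<in> cball 0 R' \<Longrightarrow> norm (G x) \<le> C2"
    using continuous_norm_bounded_on_cball[OF G] by blast
  have hb: "norm (h x) \<le> \<bar>C1\<bar> + \<bar>C2\<bar>" if x: "x \<in> cball 0 R" for x
  proof -
    have "norm (x - (x \<bullet> e + m) *\<^sub>R e) \<le> norm x + norm ((x \<bullet> e + m) *\<^sub>R e)"
      by (rule norm_triangle_ineq4)
    also have "norm ((x \<bullet> e + m) *\<^sub>R e) \<le> \<bar>x \<bullet> e\<bar> + \<bar>m\<bar>" using e by simp
    also have "\<bar>x \<bullet> e\<bar> \<le> norm x" using Cauchy_Schwarz_ineq2[of x e] e by simp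
    finally have "x - (x \<bullet> e + m) *\<^sub>R e \<in> cball 0 R'" using x by (simp add: R'_def)
    from C2[OF this] C1[OF x] show ?thesis by (auto simp: h_def)
  qed
  show I: ?I
  proof (rule integrableI_bounded_set)
    show "cball 0 R \<in> sets lborel" by simp
    show "?f \<in> borel_measurable lborel" by simp
    show "emeasure lborel (cball 0 R :: (real^3) set) < \<infinity>" by (rule emeasure_bounded_finite) simp
    show "AE x in lborel. x \<in> cball 0 R \<longrightarrow> norm (?f x) \<le> \<bar>C1\<bar> + \<bar>C2\<bar>"
      using hb by (intro AE_I2) (auto simp: of_bool_def)
    show "AE x in lborel. x \<notin> cball 0 R \<longrightarrow> ?f x = 0"
      using supp unfolding R_def by (intro AE_I2) force
  qed
  have a0: "a \<noteq> 0" using a by auto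
  obtain L :: "real^2 \<Rightarrow> real^3" and p where L: "linear L" "\<forall>y. norm (L y) = norm y"
    "range (\<lambda>y. p + L y) = {x. a \<bullet> x = b}"
    "plane_area {x. a \<bullet> x = b} = distr lborel borel (\<lambda>y. p + L y)"
    "(\<lambda>y. p + L y) \<in> borel_measurable borel"
    by (rule plane_chart[OF a0, of b])
  have apL: "a \<bullet> (p + L y) = b" for y using L(3) by blast
  have ap: "a \<bullet> p = b" using apL[of 0] linear_0[OF L(1)] by simp
  have aL: "a \<bullet> L y = 0" for y using apL[of y] ap by (simp add: inner_add_right)
  let ?\<Psi> = "\<lambda>z. p + L (fst z) + snd z *\<^sub>R e"
  have [measurable]: "L \<in> borel_measurable borel"
    using L(1) by (simp add: borel_measurable_continuous_onI linear_continuous_on linear_conv_bounded_linear)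
  have \<Psi>m: "?\<Psi> \<in> borel_measurable borel"
    unfolding borel_prod[symmetric] by measurable
  have lb: "lborel = density (distr lborel borel ?\<Psi>) (\<lambda>_. ennreal \<bar>a \<bullet> e\<bar>)"
    by (rule lborel_fibred_over_plane) (use L a ae aL in auto)
  have I2: "integrable (lborel \<Otimes>\<^sub>M lborel) (\<lambda>z. ?f (?\<Psi> z))"
  proof -
    have "integrable (density (distr lborel borel ?\<Psi>) (\<lambda>_. ennreal \<bar>a \<bullet> e\<bar>)) ?f" using I lb by metis
    then have "integrable (distr lborel borel ?\<Psi>) (\<lambda>x. \<bar>a \<bullet> e\<bar> *\<^sub>R ?f x)"
      by (subst (asm) integrable_density) auto
    then have "integrable (distr lborel borel ?\<Psi>) ?f" using ae by simp
    then show ?thesis using \<Psi>m unfolding lborel_prod by (subst (asm) integrable_distr_eq) auto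
  qed
  have "(LINT x|lborel. ?f x) = (LINT x|density (distr lborel borel ?\<Psi>) (\<lambda>_. ennreal \<bar>a \<bullet> e\<bar>). ?f x)"
    using lb by simp
  also have "\<dots> = (LINT x|distr lborel borel ?\<Psi>. \<bar>a \<bullet> e\<bar> *\<^sub>R ?f x)"
    by (subst integral_density) auto
  also have "\<dots> = \<bar>a \<bullet> e\<bar> * (LINT z|(lborel \<Otimes>\<^sub>M lborel). ?f (?\<Psi> z))"
    using \<Psi>m unfolding lborel_prod by (subst integral_distr) auto
  also have "(LINT z|(lborel \<Otimes>\<^sub>M lborel). ?f (?\<Psi> z)) = (LINT y|lborel. LINT s|lborel. ?f (?\<Psi> (y, s)))"
    by (rule lborel_pair.integral_fst'[symmetric, OF I2])
  also have "\<dots> = (LINT y|lborel. indicator K (p + L y) * G (p + L y))"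
  proof (rule Bochner_Integration.integral_cong[OF refl])
    fix y
    \<comment> \<open>In the fibre coordinates the plane is at height 0, so being behind it means
      \<open>s \<le> 0\<close>.\<close>
    have us: "u (?\<Psi> (y, s)) = - s" for s
      using ae by (simp add: u_def inner_add_right ap aL field_simps)
    have "?f (?\<Psi> (y, s)) = indicator K (p + L y) * (indicator {..0} s * h ((p + L y) + s *\<^sub>R e))" for s
      unfolding us by (auto simp: indicator_def)
    then have "(LINT s|lborel. ?f (?\<Psi> (y, s))) = indicator K (p + L y) * (LINT s|lborel. indicator {..0} s * h ((p + L y) + s *\<^sub>R e))"
      by (simp only: integral_mult_right_zero)
    also have "\<dots> = indicator K (p + L y) * G (p + L y)"
    proof (cases "p + L y \<in> K")
      case True
      have "has_bochner_integral lborel (\<lambda>s. indicator {..0} s * h ((p + L y) + s *\<^sub>R e)) (G (p + L y))"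
        unfolding h_def by (rule backward_line_integral[OF e deriv D m[OF True]])
      then show ?thesis by (simp add: has_bochner_integral_integral_eq)
    qed simp
    finally show "(LINT s|lborel. ?f (?\<Psi> (y, s))) = indicator K (p + L y) * G (p + L y)" .
  qed
  also have "\<dots> = (LINT x|plane_area {x. a \<bullet> x = b}. indicator K x * G x)"
    unfolding L(4) by (rule integral_distr[symmetric]) auto
  finally show ?E .
qed


lemma AE_affine_nonzero:
  fixes c :: "'a::euclidean_space"
  assumes "c \<noteq> 0 \<or> d \<noteq> 0"
  shows "AE x in lborel. c \<bullet> x \<noteq> d"
proof -
  have "negligible {x. c \<bullet> x = d}" using assms by (intro negligible_hyperplane) auto
  then have "{x. c \<bullet> x = d} \<in> null_sets lborel"
    by (simp add: negligible_iff_null_sets null_sets_completion_iff borel_closed closed_hyperplane)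
  then show ?thesis by (auto dest: AE_not_in)
qed

definition halfspaces :: "((real^3) \<times> real) set \<Rightarrow> (real^3) set" where
  "halfspaces J = {x. \<forall>j\<in>J. fst j \<bullet> x \<le> snd j}"

definition bounding_plane :: "(real^3) \<times> real \<Rightarrow> (real^3) set" where
  "bounding_plane j = {x. fst j \<bullet> x = snd j}"

lemma closed_halfspaces: "closed (halfspaces J)"
proof -
  have "halfspaces J = (\<Inter>j\<in>J. {x. fst j \<bullet> x \<le> snd j})" by (auto simp: halfspaces_def)
  then show ?thesis by (auto intro: closed_halfspace_le)
qed

text \<open>Almost every line in direction \<open>e\<close> meets the bounding planes in distinct points, so that
  the point \<open>x\<close> lies in the polytope iff the number of exits minus the number of entries ahead of it
  is one. This writes the polytope as a signed sum of half-infinite prisms over its facets, on each of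
  which Fubini reduces the claim to the fundamental theorem of calculus.\<close>

lemma polytope_directional_divergence:
  fixes G D :: "real^3 \<Rightarrow> real"
  assumes J: "finite J" "\<And>j. j \<in> J \<Longrightarrow> norm (fst j) = 1" "inj_on bounding_plane J"
    and bdd: "bounded (halfspaces J)" and e: "norm e = 1"
    and deriv: "\<And>x. ((\<lambda>s. G (x + s *\<^sub>R e)) has_real_derivative D x) (at 0)"
    and D: "continuous_on UNIV D" and G: "continuous_on UNIV G"
  shows "(LINT x|lborel. indicator (halfspaces J) x * D x)
    = (\<Sum>j\<in>J. (fst j \<bullet> e) * (LINT x|plane_area (bounding_plane j). indicator (halfspaces J) x * G x))"
proof -
  let ?K = "halfspaces J"
  let ?S = "\<lambda>j. LINT x|plane_area (bounding_plane j). indicator ?K x * G x"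
  have K: "compact ?K" using bdd closed_halfspaces compact_eq_bounded_closed by blast
  obtain r where r: "\<And>x. x \<in> ?K \<Longrightarrow> norm x \<le> r" using bdd by (auto simp: bounded_iff)
  have m: "- r \<le> x \<bullet> e" if "x \<in> ?K" for x
    using r[OF that] Cauchy_Schwarz_ineq2[of x e] e by simp
  define h where "h = (\<lambda>x. if - r \<le> x \<bullet> e then D x else if - r - 1 \<le> x \<bullet> e then G (x - (x \<bullet> e + r) *\<^sub>R e) else 0)"
  define u where "u = (\<lambda>j x. (snd j - fst j \<bullet> x) / (fst j \<bullet> e))"
  \<comment> \<open>Faces parallel to \<open>e\<close> are never crossed, and their normal component
    in direction \<open>e\<close> is zero.\<close>
  define J' where "J' = {j\<in>J. fst j \<bullet> e \<noteq> 0}"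
  have finJ': "finite J'" using J by (simp add: J'_def)
  define \<theta> :: "(real^3) \<times> real \<Rightarrow> real^3 \<Rightarrow> real"
    where "\<theta> = (\<lambda>j x. of_bool (0 \<le> u j x \<and> x + u j x *\<^sub>R e \<in> ?K))"
  let ?T = "\<lambda>j. LINT x|lborel. \<theta> j x * h x"
  have cross: "integrable lborel (\<lambda>x. \<theta> j x * h x)"
     "?T j = \<bar>fst j \<bullet> e\<bar> * ?S j"
    if "j \<in> J'" for j
    using crossing_integral[OF J(2) e _ K m deriv D G, of j "snd j"] that
    unfolding \<theta>_def u_def h_def bounding_plane_def J'_def by auto
  have nz: "AE x in lborel. u j x \<noteq> 0" if "j \<in> J'" for j
  proof -
    have "fst j \<noteq> 0" using that J(2)[of j] by (auto simp: J'_def)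
    then have "AE x in lborel. fst j \<bullet> x \<noteq> snd j" by (intro AE_affine_nonzero) simp
    then show ?thesis using that by (auto simp: u_def J'_def)
  qed
  have dist: "AE x in lborel. u i x \<noteq> u j x" if ij: "i \<in> J'" "j \<in> J'" "i \<noteq> j" for i j
  proof -
    let ?a = "fst i \<bullet> e" and ?c = "fst j \<bullet> e"
    have nz: "?a \<noteq> 0" "?c \<noteq> 0" using ij by (auto simp: J'_def)
    let ?w = "?c *\<^sub>R fst i - ?a *\<^sub>R fst j" and ?d = "snd i * ?c - snd j * ?a"
    \<comment> \<open>The two crossings coincide exactly where \<open>?w \<bullet> x = ?d\<close>.
      This set is null unless \<open>?w\<close> and \<open>?d\<close> both vanish, and then the two
      faces would span the same plane.\<close>
    have "?w \<noteq> 0 \<or> ?d \<noteq> 0"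
    proof (rule ccontr)
      assume "\<not> ?thesis"
      then have w: "?c *\<^sub>R fst i = ?a *\<^sub>R fst j" and d: "?c * snd i = ?a * snd j" by (auto simp: mult.commute)
      have "fst i \<bullet> x = snd i \<longleftrightarrow> fst j \<bullet> x = snd j" for x
      proof -
        have "fst i \<bullet> x = snd i \<longleftrightarrow> ?c * (fst i \<bullet> x) = ?c * snd i" using nz by simp
        also have "?c * (fst i \<bullet> x) = ?a * (fst j \<bullet> x)" using w by (metis inner_scaleR_left)
        also have "?a * (fst j \<bullet> x) = ?c * snd i \<longleftrightarrow> fst j \<bullet> x = snd j" unfolding d using nz by simp
        finally show ?thesis .
      qed
      then have "bounding_plane i = bounding_plane j" by (simp add: bounding_plane_def)
      then show False using J(3) ij by (auto simp: J'_def inj_on_def)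
    qed
    then have "AE x in lborel. ?w \<bullet> x \<noteq> ?d" by (rule AE_affine_nonzero)
    then show ?thesis
      by (rule AE_mp) (use nz in \<open>auto intro!: AE_I2 simp: u_def inner_diff_left frac_eq_eq algebra_simps\<close>)
  qed
  have ae: "AE x in lborel. (\<forall>j\<in>J'. u j x \<noteq> 0) \<and> (\<forall>i\<in>J'. \<forall>j\<in>J'. i \<noteq> j \<longrightarrow> u i x \<noteq> u j x)"
    using nz dist finJ' by (intro AE_conjI AE_finite_allI) auto
  have count: "AE x in lborel. indicator ?K x * D x = (\<Sum>j\<in>J'. sgn (fst j \<bullet> e) * (\<theta> j x * h x))"
    using ae
  proof (rule AE_mp, intro AE_I2 impI)
    fix x
    assume x: "(\<forall>j\<in>J'. u j x \<noteq> 0) \<and> (\<forall>i\<in>J'. \<forall>j\<in>J'. i \<noteq> j \<longrightarrow> u i x \<noteq> u j x)"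
    define S where "S = {s. x + s *\<^sub>R e \<in> ?K}"
    \<comment> \<open>The constraints from faces parallel to \<open>e\<close> do not depend on
      \<open>s\<close>; they are the condition \<open>V\<close> of
      \<open>signed_crossing_count\<close>.\<close>
    have S: "S = {s. (\<forall>j\<in>J - J'. fst j \<bullet> x \<le> snd j) \<and>
       (\<forall>j\<in>J'. if 0 < fst j \<bullet> e then s \<le> u j x else u j x \<le> s)}"
    proof -
      have 1: "fst j \<bullet> (x + s *\<^sub>R e) \<le> snd j \<longleftrightarrow> (if 0 < fst j \<bullet> e then s \<le> u j x else u j x \<le> s)"
        if "j \<in> J'" for j s
        using that by (auto simp: J'_def u_def inner_add_right field_simps not_less)
      have 2: "fst j \<bullet> (x + s *\<^sub>R e) \<le> snd j \<longleftrightarrow> fst j \<bullet> x \<le> snd j" if "j \<in> J - J'" for j s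
        using that by (auto simp: J'_def inner_add_right)
      have "J = (J - J') \<union> J'" by (auto simp: J'_def)
      then have "x + s *\<^sub>R e \<in> ?K \<longleftrightarrow> (\<forall>j\<in>J - J'. fst j \<bullet> (x + s *\<^sub>R e) \<le> snd j) \<and> (\<forall>j\<in>J'. fst j \<bullet> (x + s *\<^sub>R e) \<le> snd j)" for s
        unfolding halfspaces_def by blast
      then show ?thesis unfolding S_def using 1 2 by auto
    qed
    have bS: "bounded S"
      unfolding bounded_iff
    proof (intro exI ballI)
      fix s assume "s \<in> S"
      then have "norm (x + s *\<^sub>R e) \<le> r" using r by (simp add: S_def)
      then show "norm s \<le> r + norm x" using norm_triangle_ineq4[of "x + s *\<^sub>R e" x] e by simp
    qed
    have "(\<Sum>j\<in>J'. sgn (fst j \<bullet> e) * of_bool (0 \<le> u j x \<and> u j x \<in> S)) = (of_bool (0 \<in> S) :: real)"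
    proof (rule signed_crossing_count[OF finJ' _ _ _ S bS])
      show "fst j \<bullet> e \<noteq> 0" if "j \<in> J'" for j using that by (simp add: J'_def)
      show "inj_on (\<lambda>j. u j x) J'" using x unfolding inj_on_def by blast
      show "u j x \<noteq> 0" if "j \<in> J'" for j using x that by blast
    qed
    then have "(\<Sum>j\<in>J'. sgn (fst j \<bullet> e) * \<theta> j x) = (of_bool (x \<in> ?K) :: real)"
      by (simp add: S_def \<theta>_def)
    then have "(\<Sum>j\<in>J'. sgn (fst j \<bullet> e) * \<theta> j x) * h x = of_bool (x \<in> ?K) * h x" by simp
    \<comment> \<open>The polytope lies above the level \<open>- r\<close>, so the artificial
      continuation in \<open>h\<close> is not seen from inside.\<close>
    also have "of_bool (x \<in> ?K) * h x = indicator ?K x * D x"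
      using m[of x] by (auto simp: h_def indicator_def)
    finally show "indicator ?K x * D x = (\<Sum>j\<in>J'. sgn (fst j \<bullet> e) * (\<theta> j x * h x))"
      by (simp add: sum_distrib_right mult.assoc)
  qed
  have [measurable]: "D \<in> borel_measurable borel" "?K \<in> sets borel"
    using D K by (auto intro: borel_measurable_continuous_onI borel_compact)
  have "(LINT x|lborel. indicator ?K x * D x) = (LINT x|lborel. (\<Sum>j\<in>J'. sgn (fst j \<bullet> e) * (\<theta> j x * h x)))"
  proof (rule integral_cong_AE[OF _ _ count])
    show "(\<lambda>x. \<Sum>j\<in>J'. sgn (fst j \<bullet> e) * (\<theta> j x * h x)) \<in> borel_measurable lborel"
      using cross(1) by (intro borel_measurable_integrable Bochner_Integration.integrable_sum integrable_mult_right)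
  qed simp
  also have "\<dots> = (\<Sum>j\<in>J'. sgn (fst j \<bullet> e) * ?T j)"
    using cross(1) by (subst Bochner_Integration.integral_sum) auto
  \<comment> \<open>The sign from the crossing count and the modulus from the fibration multiply to
    the normal component.\<close>
  also have "\<dots> = (\<Sum>j\<in>J'. (fst j \<bullet> e) * ?S j)"
  proof (rule sum.cong[OF refl])
    fix j assume "j \<in> J'"
    then have "sgn (fst j \<bullet> e) * ?T j
      = (sgn (fst j \<bullet> e) * \<bar>fst j \<bullet> e\<bar>) * ?S j"
      using cross(2) by simp
    then show "sgn (fst j \<bullet> e) * ?T j = (fst j \<bullet> e) * ?S j"
      by (simp add: sgn_mult_abs)
  qed
  also have "\<dots> = (\<Sum>j\<in>J. (fst j \<bullet> e) * ?S j)"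
    by (rule sum.mono_neutral_left) (use J in \<open>auto simp: J'_def\<close>)
  finally show ?thesis .
qed

subsection \<open>Geometry of the mesh\<close>

lemma polytope_halfspaces:
  assumes "polytope K"
  obtains J where "finite J" "\<forall>j\<in>J. norm (fst j) = 1" "K = halfspaces J"
proof -
  obtain F where F: "finite F" "K = \<Inter>F" "\<forall>h\<in>F. \<exists>a b. a \<noteq> 0 \<and> h = {x. a \<bullet> x \<le> b}"
    using polytope_imp_polyhedron[OF assms] unfolding polyhedron_def by (elim exE conjE) (rule that)
  have "\<exists>j. norm (fst j) = 1 \<and> h = {x. fst j \<bullet> x \<le> snd j}" if hF: "h \<in> F" for h
  proof -
    obtain a b where ab: "a \<noteq> 0" "h = {x. a \<bullet> x \<le> b}" using bspec[OF F(3) hF] by (elim exE conjE) (rule that)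
    have "(a /\<^sub>R norm a) \<bullet> x \<le> b / norm a \<longleftrightarrow> a \<bullet> x \<le> b" for x
      using ab(1) by (simp add: divide_inverse mult.commute mult_le_cancel_left_pos)
    then have "h = {x. (a /\<^sub>R norm a) \<bullet> x \<le> b / norm a}" unfolding ab(2) by simp
    then show ?thesis using ab(1) by (intro exI[of _ "(a /\<^sub>R norm a, b / norm a)"]) simp
  qed
  then obtain k where k: "\<forall>h\<in>F. norm (fst (k h)) = 1 \<and> h = {x. fst (k h) \<bullet> x \<le> snd (k h)}" by metis
  show thesis
  proof
    show "finite (k ` F)" using F(1) by simp
    show "\<forall>j\<in>k ` F. norm (fst j) = 1" using k by auto
    have "x \<in> K \<longleftrightarrow> x \<in> halfspaces (k ` F)" for x
    proof -
      have "x \<in> K \<longleftrightarrow> (\<forall>h\<in>F. x \<in> h)" by (simp add: F(2))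
      also have "\<dots> \<longleftrightarrow> (\<forall>h\<in>F. fst (k h) \<bullet> x \<le> snd (k h))" using k by (metis mem_Collect_eq)
      also have "\<dots> \<longleftrightarrow> x \<in> halfspaces (k ` F)" by (simp add: halfspaces_def)
      finally show ?thesis .
    qed
    then show "K = halfspaces (k ` F)" by blast
  qed
qed

text \<open>Moving from \<open>p\<close> along the part \<open>v\<close> of the second normal
  orthogonal to the first stays in the common plane, so \<open>v\<close> is orthogonal to the second
  normal as well and vanishes. Unit length leaves only the sign open.\<close>

lemma bounding_plane_eq_cases:
  assumes "norm (fst i) = 1" "norm (fst j) = 1" "bounding_plane i = bounding_plane j"
  shows "i = j \<or> (fst i = - fst j \<and> snd i = - snd j)"
proof -
  let ?a = "fst i" and ?c = "fst j"
  have aa: "?a \<bullet> ?a = 1" "?c \<bullet> ?c = 1" using assms by (simp_all add: dot_square_norm)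
  define p where "p = snd i *\<^sub>R ?a"
  have p: "?a \<bullet> p = snd i" by (simp add: p_def aa)
  have mem: "?a \<bullet> x = snd i \<longleftrightarrow> ?c \<bullet> x = snd j" for x
    using assms(3) by (auto simp: bounding_plane_def set_eq_iff)
  define v where "v = ?c - (?c \<bullet> ?a) *\<^sub>R ?a"
  have "?a \<bullet> v = 0" by (simp add: v_def inner_diff_right aa inner_commute)
  then have "?a \<bullet> (p + v) = snd i" by (simp add: inner_add_right p)
  then have "?c \<bullet> (p + v) = snd j" "?c \<bullet> p = snd j" using mem p by auto
  then have "?c \<bullet> v = 0" by (simp add: inner_add_right)
  then have "v \<bullet> v = 0" using \<open>?a \<bullet> v = 0\<close> by (simp add: v_def inner_diff_left)
  then have c: "?c = (?c \<bullet> ?a) *\<^sub>R ?a" by (simp add: v_def)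
  have d: "snd j = (?c \<bullet> ?a) * snd i" using \<open>?c \<bullet> p = snd j\<close> by (simp add: p_def mult.commute)
  have "norm ?c = \<bar>?c \<bullet> ?a\<bar> * norm ?a" using c by (metis norm_scaleR)
  then have "?c \<bullet> ?a = 1 \<or> ?c \<bullet> ?a = - 1" using assms by (simp add: abs_if split: if_splits)
  then show ?thesis
  proof
    assume 1: "?c \<bullet> ?a = 1"
    then have "?c = ?a" "snd j = snd i" using c d by simp_all
    then show ?thesis by (simp add: prod_eq_iff)
  next
    assume 1: "?c \<bullet> ?a = - 1"
    then have "?c = - ?a" "snd j = - snd i" using c d by simp_all
    then show ?thesis by simp
  qed
qed

lemma interior_halfspaces:
  assumes "finite J" "\<And>j. j \<in> J \<Longrightarrow> norm (fst j) = 1"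
  shows "interior (halfspaces J) = {x. \<forall>j\<in>J. fst j \<bullet> x < snd j}"
proof (rule interior_unique)
  show "{x. \<forall>j\<in>J. fst j \<bullet> x < snd j} \<subseteq> halfspaces J" by (auto simp: halfspaces_def intro: less_imp_le)
  have "{x. \<forall>j\<in>J. fst j \<bullet> x < snd j} = (\<Inter>j\<in>J. {x. fst j \<bullet> x < snd j})" by auto
  then show "open {x. \<forall>j\<in>J. fst j \<bullet> x < snd j}" using assms(1) by (auto intro: open_halfspace_lt)
  fix T assume T: "T \<subseteq> halfspaces J" "open T"
  show "T \<subseteq> {x. \<forall>j\<in>J. fst j \<bullet> x < snd j}"
  proof safe
    fix x a b assume x: "x \<in> T" and j: "(a, b) \<in> J"
    obtain r where r: "r > 0" "ball x r \<subseteq> T" using T(2) x by (auto simp: open_contains_ball)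
    have a: "norm a = 1" using assms(2)[OF j] by simp
    \<comment> \<open>A step along the normal stays inside \<open>T\<close>; this leaves room in the
      inequality and makes it strict at \<open>x\<close>.\<close>
    have "x + (r/2) *\<^sub>R a \<in> halfspaces J" using r a T(1) by (auto simp: dist_norm subset_iff)
    then have "a \<bullet> (x + (r/2) *\<^sub>R a) \<le> b" using j by (auto simp: halfspaces_def)
    then show "fst (a, b) \<bullet> x < snd (a, b)" using r(1) a by (simp add: inner_add_right dot_square_norm)
  qed
qed

text \<open>Two descriptions with the same plane would be opposite half-spaces, and no interior
  point satisfies both inequalities strictly.\<close>

lemma inj_on_bounding_plane:
  assumes "finite J" "\<And>j. j \<in> J \<Longrightarrow> norm (fst j) = 1" "interior (halfspaces J) \<noteq> {}"
  shows "inj_on bounding_plane J"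
proof (rule inj_onI, rule ccontr)
  fix i j assume ij: "i \<in> J" "j \<in> J" "bounding_plane i = bounding_plane j" "i \<noteq> j"
  obtain x where "x \<in> interior (halfspaces J)" using assms(3) by blast
  then have "fst i \<bullet> x < snd i" "fst j \<bullet> x < snd j" using ij interior_halfspaces[OF assms(1,2)] by auto
  moreover have "fst i = - fst j \<and> snd i = - snd j" using bounding_plane_eq_cases ij assms(2) by blast
  ultimately show False by simp
qed

lemma is_plane_bounding_plane: "norm (fst j) = 1 \<Longrightarrow> is_plane (bounding_plane j)"
  unfolding bounding_plane_def by (rule is_planeI) auto

text \<open>Inequalities strict at \<open>x\<close> remain strict nearby, so only the one belonging
  to \<open>j\<close> is felt there.\<close>

lemma halfspaces_locally:
  assumes J: "finite J" and x: "x \<in> halfspaces J" and j: "j \<in> J" "x \<in> bounding_plane j"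
    and strict: "\<And>i. i \<in> J \<Longrightarrow> i \<noteq> j \<Longrightarrow> x \<notin> bounding_plane i"
  shows "\<exists>r>0. halfspaces J \<inter> ball x r = {y \<in> ball x r. (y - x) \<bullet> fst j \<le> 0}"
proof -
  let ?U = "\<Inter>i\<in>J - {j}. {y. fst i \<bullet> y < snd i}"
  have "open ?U" using J by (auto intro: open_halfspace_lt)
  moreover have "x \<in> ?U" using x strict by (fastforce simp: halfspaces_def bounding_plane_def order_le_less)
  ultimately obtain r where r: "r > 0" "ball x r \<subseteq> ?U" by (rule openE)
  have "y \<in> halfspaces J \<longleftrightarrow> (y - x) \<bullet> fst j \<le> 0" if "y \<in> ball x r" for y
  proof -
    have "\<forall>i\<in>J - {j}. fst i \<bullet> y < snd i" using r that by blast
    then have "y \<in> halfspaces J \<longleftrightarrow> fst j \<bullet> y \<le> snd j" using j(1) by (force simp: halfspaces_def)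
    then show ?thesis using j(2) by (simp add: bounding_plane_def inner_diff_left inner_diff_right inner_commute)
  qed
  then show ?thesis using r(1) by (intro exI[of _ r]) auto
qed

text \<open>Makes the definite description in \<open>outward_normal\<close> well defined. Testing
  the common half-space with the part of \<open>n'\<close> orthogonal to \<open>n\<close> gives
  \<open>1 \<le> (n \<bullet> n') * (n \<bullet> n')\<close>, and testing with \<open>- n\<close>
  excludes the opposite direction.\<close>

lemma unit_normal_unique:
  fixes n n' :: "'a::real_inner"
  assumes n: "norm n = 1" "norm n' = 1" and r: "r > 0"
    and eq: "\<And>y. y \<in> ball x r \<Longrightarrow> (y - x) \<bullet> n \<le> 0 \<longleftrightarrow> (y - x) \<bullet> n' \<le> 0"
  shows "n = n'"
proof -
  have all: "y \<bullet> n \<le> 0 \<longleftrightarrow> y \<bullet> n' \<le> 0" for y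
  proof -
    \<comment> \<open>The condition is invariant under positive scaling, so any vector may be shrunk
      into the ball; the added 1 keeps the divisor positive at \<open>y = 0\<close>.\<close>
    define \<delta> where "\<delta> = r / (norm y + 1) / 2"
    have d: "\<delta> > 0" using r by (simp add: \<delta>_def add_nonneg_pos)
    have "\<delta> * norm y < r"
    proof -
      have "\<delta> * norm y \<le> r / 2" using r by (simp add: \<delta>_def divide_simps) (smt (verit) norm_ge_zero)
      then show ?thesis using r by simp
    qed
    then have "x + \<delta> *\<^sub>R y \<in> ball x r" using d by (simp add: dist_norm)
    from eq[OF this] show ?thesis using d by (simp add: mult_le_0_iff)
  qed
  have nn: "n \<bullet> n = 1" "n' \<bullet> n' = 1" using n by (simp_all add: dot_square_norm)
  have "(n' - (n \<bullet> n') *\<^sub>R n) \<bullet> n = 0" by (simp add: inner_diff_left inner_diff_right nn inner_commute)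
  then have "(n' - (n \<bullet> n') *\<^sub>R n) \<bullet> n' \<le> 0" using all by (metis order_refl)
  then have 1: "1 \<le> (n \<bullet> n') * (n \<bullet> n')" by (simp add: inner_diff_left nn)
  have "(- n) \<bullet> n' \<le> 0" using all[of "- n"] nn by simp
  then have pos: "0 \<le> n \<bullet> n'" by simp
  have "n \<bullet> n' \<ge> 1"
  proof (rule ccontr)
    assume "\<not> ?thesis"
    then have "(n \<bullet> n') * (n \<bullet> n') < 1" using pos mult_strict_mono'[of "n \<bullet> n'" 1 "n \<bullet> n'" 1] by simp
    then show False using 1 by simp
  qed
  then have "(n - n') \<bullet> (n - n') \<le> 0" by (simp add: inner_diff_left inner_diff_right nn inner_commute)
  then show ?thesis by (metis inner_ge_zero inner_eq_zero_iff order_antisym right_minus_eq)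
qed

lemma outward_normal_eqI:
  assumes "norm n = 1" "r > 0" "closure D \<inter> ball x r = {y \<in> ball x r. (y - x) \<bullet> n \<le> 0}"
  shows "outward_normal D x = n"
  unfolding outward_normal_def
proof (rule the_equality)
  show "norm n = 1 \<and> (\<exists>r>0. closure D \<inter> ball x r = {y \<in> ball x r. (y - x) \<bullet> n \<le> 0})"
    using assms by blast
  fix m assume "norm m = 1 \<and> (\<exists>r>0. closure D \<inter> ball x r = {y \<in> ball x r. (y - x) \<bullet> m \<le> 0})"
  then obtain s where s: "norm m = 1" "s > 0" "closure D \<inter> ball x s = {y \<in> ball x s. (y - x) \<bullet> m \<le> 0}" by blast
  show "m = n"
  proof (rule unit_normal_unique[OF s(1) assms(1), of "min r s" x])
    show "0 < min r s" using assms s by simp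
    fix y assume "y \<in> ball x (min r s)"
    then have y: "y \<in> ball x r" "y \<in> ball x s" by auto
    show "(y - x) \<bullet> m \<le> 0 \<longleftrightarrow> (y - x) \<bullet> n \<le> 0" using assms(3) s(3) y by blast
  qed
qed

text \<open>A domain below a Lipschitz graph does not lie on both sides of its boundary, so slits
  are excluded. Points just above the graph have a neighbourhood missing the domain, hence lie
  outside its closure.\<close>

lemma interior_closure_lipschitz:
  assumes "lipschitz_boundary \<Omega>" "open \<Omega>"
  shows "interior (closure \<Omega>) = \<Omega>"
proof
  show "\<Omega> \<subseteq> interior (closure \<Omega>)" using assms(2) by (simp add: closure_subset interior_maximal)
  show "interior (closure \<Omega>) \<subseteq> \<Omega>"
  proof (rule ccontr)
    assume "\<not> interior (closure \<Omega>) \<subseteq> \<Omega>"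
    then obtain x where x: "x \<in> interior (closure \<Omega>)" "x \<notin> \<Omega>" by blast
    then have xf: "x \<in> frontier \<Omega>" using assms(2) interior_subset by (auto simp: frontier_def interior_open)
    obtain e U L and \<phi> :: "real^3 \<Rightarrow> real" where e: "norm e = 1" "open U" "x \<in> U"
       "L-lipschitz_on {y. y \<bullet> e = 0} \<phi>" "\<Omega> \<inter> U = {y \<in> U. y \<bullet> e < \<phi> (y - (y \<bullet> e) *\<^sub>R e)}"
      using bspec[OF assms(1)[unfolded lipschitz_boundary_def] xf] by (elim exE conjE) (rule that)
    have "x \<notin> \<Omega> \<inter> U" using x by simp
    then have xge: "x \<bullet> e \<ge> \<phi> (x - (x \<bullet> e) *\<^sub>R e)" unfolding e(5) using e(3) by simp
    have ee: "e \<bullet> e = 1" using e(1) by (simp add: dot_square_norm)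
    define \<pi> where "\<pi> = (\<lambda>y. y - (y \<bullet> e) *\<^sub>R e)"
    have contphi: "continuous_on UNIV (\<lambda>y. \<phi> (\<pi> y))"
    proof (rule continuous_on_compose2[OF lipschitz_on_continuous_on[OF e(4)]])
      show "continuous_on UNIV \<pi>" unfolding \<pi>_def by (intro continuous_intros)
      show "\<pi> ` UNIV \<subseteq> {y. y \<bullet> e = 0}" by (auto simp: \<pi>_def inner_diff_left ee)
    qed
    define W where "W = U \<inter> interior (closure \<Omega>)"
    have "open W" "x \<in> W" using e x by (auto simp: W_def)
    then obtain r where r: "r > 0" "ball x r \<subseteq> W" by (auto simp: open_contains_ball)
    \<comment> \<open>Moving up from \<open>x\<close> in the graph direction keeps the base point
      and lands strictly above the graph, still inside \<open>W\<close>.\<close>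
    define z where "z = x + (r/2) *\<^sub>R e"
    have zW: "z \<in> W" using r e(1) by (auto simp: z_def dist_norm subset_iff)
    have \<pi>z: "\<pi> z = \<pi> x" by (simp add: \<pi>_def z_def inner_add_left ee algebra_simps)
    have zgt: "z \<bullet> e > \<phi> (\<pi> z)" unfolding \<pi>z using xge r by (simp add: z_def inner_add_left ee \<pi>_def)
    define O' where "O' = U \<inter> {y. \<phi> (\<pi> y) < y \<bullet> e}"
    have "open {y. \<phi> (\<pi> y) < y \<bullet> e}" by (intro open_Collect_less contphi continuous_intros)
    then have "open O'" using e(2) by (simp add: O'_def open_Int)
    moreover have "z \<in> O'" using zW zgt by (auto simp: O'_def W_def)
    moreover have "O' \<inter> \<Omega> = {}"
    proof -
      have "O' \<inter> \<Omega> \<subseteq> \<Omega> \<inter> U" by (auto simp: O'_def)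
      then show ?thesis unfolding e(5) by (force simp: O'_def \<pi>_def)
    qed
    ultimately have "z \<notin> closure \<Omega>" using open_Int_closure_eq_empty[of O' \<Omega>] by blast
    then show False using zW interior_subset by (auto simp: W_def)
  qed
qed


text \<open>The description may contain redundant half-spaces. For an element of the mesh the plane
  of such a half-space meets the element at most in edges, so it behaves like a face of zero
  area.\<close>

definition faces :: "(real^3) set \<Rightarrow> ((real^3) \<times> real) set" where
  "faces K = (SOME J. finite J \<and> (\<forall>j\<in>J. norm (fst j) = 1) \<and> K = halfspaces J)"

section \<open>Faces, edges and adjacency of elements\<close>

locale polyhedral_mesh =
  fixes \<Omega> :: "(real^3) set" and \<K> :: "(real^3) set set"
  assumes domain: "polyhedral_lipschitz_domain \<Omega>" and mesh: "element_partition \<Omega> \<K>"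
begin

lemma finite_mesh: "finite \<K>" and union_mesh: "\<Union>\<K> = closure \<Omega>" and open_domain: "open \<Omega>"
  and bounded_domain: "bounded \<Omega>" and interior_closure_domain: "interior (closure \<Omega>) = \<Omega>"
  using mesh domain interior_closure_lipschitz
  by (auto simp: element_partition_def polyhedral_lipschitz_domain_def)

lemma polytope_element: "K \<in> \<K> \<Longrightarrow> polytope K" and interior_element: "K \<in> \<K> \<Longrightarrow> interior K \<noteq> {}"
  using mesh by (auto simp: element_partition_def)

lemma disjoint_elements: "K \<in> \<K> \<Longrightarrow> K' \<in> \<K> \<Longrightarrow> K \<noteq> K' \<Longrightarrow> interior K \<inter> interior K' = {}"
  using mesh by (auto simp: element_partition_def pairwise_def)

lemma compact_element: "K \<in> \<K> \<Longrightarrow> compact K" and closed_element: "K \<in> \<K> \<Longrightarrow> closed K"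
  and convex_element: "K \<in> \<K> \<Longrightarrow> convex K"
  using polytope_element polytope_imp_compact polytope_imp_closed polytope_imp_convex by blast+

lemma closure_interior_element: "K \<in> \<K> \<Longrightarrow> closure (interior K) = K"
  using convex_closure_interior[OF convex_element interior_element] closed_element by simp

lemma element_subset: "K \<in> \<K> \<Longrightarrow> K \<subseteq> closure \<Omega>"
  using union_mesh by blast

lemma interior_element_subset: "K \<in> \<K> \<Longrightarrow> interior K \<subseteq> \<Omega>"
  using interior_mono[OF element_subset] interior_closure_domain by blast

lemma
  assumes "K \<in> \<K>"
  shows finite_faces: "finite (faces K)"
    and norm_face: "j \<in> faces K \<Longrightarrow> norm (fst j) = 1"
    and halfspaces_faces: "halfspaces (faces K) = K"
proof -
  obtain J where "finite J" "\<forall>j\<in>J. norm (fst j) = 1" "K = halfspaces J"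
    by (rule polytope_halfspaces[OF polytope_element[OF assms]])
  then have "\<exists>J. finite J \<and> (\<forall>j\<in>J. norm (fst j) = 1) \<and> K = halfspaces J" by blast
  from someI_ex[OF this]
  have *: "finite (faces K) \<and> (\<forall>j\<in>faces K. norm (fst j) = 1) \<and> K = halfspaces (faces K)"
    unfolding faces_def .
  then show "finite (faces K)" "j \<in> faces K \<Longrightarrow> norm (fst j) = 1" "halfspaces (faces K) = K" by auto
qed

lemma inj_on_faces: "K \<in> \<K> \<Longrightarrow> inj_on bounding_plane (faces K)"
  using inj_on_bounding_plane[OF finite_faces norm_face] halfspaces_faces interior_element by simp

lemma frontier_element: "K \<in> \<K> \<Longrightarrow> frontier K = K \<inter> (\<Union>j\<in>faces K. bounding_plane j)"
proof -
  assume K: "K \<in> \<K>"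
  have 1: "interior K = {x. \<forall>j\<in>faces K. fst j \<bullet> x < snd j}"
    using interior_halfspaces[OF finite_faces[OF K] norm_face[OF K]] halfspaces_faces[OF K] by simp
  have 2: "x \<in> K \<longleftrightarrow> (\<forall>j\<in>faces K. fst j \<bullet> x \<le> snd j)" for x
    using halfspaces_faces[OF K] by (auto simp: halfspaces_def)
  show ?thesis
    unfolding frontier_def closure_closed[OF closed_element[OF K]] 1
    using 2 by (force simp: bounding_plane_def)
qed

text \<open>Edges are contained in intersections of two distinct planes spanned by faces.\<close>

definition face_planes :: "(real^3) set set" where
  "face_planes = (\<Union>K\<in>\<K>. bounding_plane ` faces K)"

definition edge_set :: "(real^3) set" where
  "edge_set = (\<Union>P\<in>face_planes. \<Union>Q\<in>face_planes - {P}. P \<inter> Q)"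

lemma face_plane: "P \<in> face_planes \<Longrightarrow> is_plane P"
  by (auto simp: face_planes_def intro!: is_plane_bounding_plane norm_face)

lemma edge_set_null: "edge_set \<in> null_sets polyhedral_area"
proof -
  have "finite face_planes" using finite_mesh finite_faces by (simp add: face_planes_def)
  then show ?thesis unfolding edge_set_def
    by (intro null_sets.finite_UN) (auto intro: polyhedral_area_null_inter face_plane)
qed

lemma face_unique:
  assumes "K \<in> \<K>" "j \<in> faces K" "x \<in> bounding_plane j" "x \<notin> edge_set" "K' \<in> \<K>" "i \<in> faces K'" "x \<in> bounding_plane i"
  shows "bounding_plane i = bounding_plane j"
  using assms unfolding edge_set_def face_planes_def by blast

lemma element_locally:
  assumes "K \<in> \<K>" "j \<in> faces K" "x \<in> K" "x \<in> bounding_plane j" "x \<notin> edge_set"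
  shows "\<exists>r>0. K \<inter> ball x r = {y \<in> ball x r. (y - x) \<bullet> fst j \<le> 0}"
proof -
  have "x \<notin> bounding_plane i" if "i \<in> faces K" "i \<noteq> j" for i
    using face_unique[OF assms(1,2,4,5,1) that(1)] inj_on_faces[OF assms(1)] that assms(2)
    by (auto simp: inj_on_def)
  then show ?thesis
    using halfspaces_locally[OF finite_faces[OF assms(1)], of x j] assms halfspaces_faces[OF assms(1)] by simp
qed

lemma outward_normal_element:
  assumes "K \<in> \<K>" "j \<in> faces K" "x \<in> K" "x \<in> bounding_plane j" "x \<notin> edge_set"
  shows "outward_normal K x = fst j"
proof -
  obtain r where "r > 0" "K \<inter> ball x r = {y \<in> ball x r. (y - x) \<bullet> fst j \<le> 0}"
    using element_locally[OF assms] by blast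
  then show ?thesis
    using norm_face[OF assms(1,2)] closed_element[OF assms(1)] by (intro outward_normal_eqI) auto
qed

lemma frontier_face:
  assumes "K \<in> \<K>" "x \<in> frontier K"
  obtains j where "j \<in> faces K" "x \<in> K" "x \<in> bounding_plane j"
  using assms frontier_element by blast

text \<open>An element is the closure of its interior, so a point of \<open>K'\<close> interior to
  \<open>K\<close> would have interior points of \<open>K'\<close> nearby, and the interiors would
  overlap.\<close>

lemma elements_meet_in_frontier:
  assumes "K \<in> \<K>" "K' \<in> \<K>" "K \<noteq> K'" "x \<in> K" "x \<in> K'"
  shows "x \<in> frontier K"
proof (rule ccontr)
  assume "x \<notin> frontier K"
  then have "x \<in> interior K" using assms(1,4) closed_element[OF assms(1)] by (simp add: frontier_def)
  moreover have "x \<in> closure (interior K')" using assms closure_interior_element by simp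
  ultimately have "interior K \<inter> interior K' \<noteq> {}"
    using open_Int_closure_eq_empty[OF open_interior, of K "interior K'"] by blast
  then show False using disjoint_elements assms by blast
qed

text \<open>Off the edges both faces through \<open>x\<close> lie in one plane, so the normals agree
  up to sign. If they were equal, both elements would contain the same open half-ball.\<close>

lemma opposite_normals:
  assumes K: "K \<in> \<K>" "j \<in> faces K" "x \<in> K" "x \<in> bounding_plane j"
    and K': "K' \<in> \<K>" "i \<in> faces K'" "x \<in> K'" "x \<in> bounding_plane i"
    and x: "x \<notin> edge_set" and ne: "K \<noteq> K'"
  shows "fst i = - fst j"
proof -
  have "fst i \<noteq> fst j"
  proof
    assume eq: "fst i = fst j"
    obtain r where r: "r > 0" "K \<inter> ball x r = {y \<in> ball x r. (y - x) \<bullet> fst j \<le> 0}"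
      using element_locally[OF K x] by blast
    obtain s where s: "s > 0" "K' \<inter> ball x s = {y \<in> ball x s. (y - x) \<bullet> fst j \<le> 0}"
      using element_locally[OF K' x] eq by auto
    let ?H = "{y. (y - x) \<bullet> fst j < 0} \<inter> ball x (min r s)"
    have "open {y. (y - x) \<bullet> fst j < 0}" by (intro open_Collect_less continuous_intros)
    then have o: "open ?H" by auto
    have "?H \<subseteq> K" "?H \<subseteq> K'" using r(2) s(2) by (force, force)
    then have "?H \<subseteq> interior K \<inter> interior K'" using o by (simp add: interior_maximal)
    then have "?H = {}" using disjoint_elements[OF K(1) K'(1) ne] by blast
    \<comment> \<open>A step against the outward normal gives a point of the common
      half-ball.\<close>
    moreover have "x - (min r s / 2) *\<^sub>R fst j \<in> ?H"
      using r(1) s(1) norm_face[OF K(1,2)] by (auto simp: dist_norm dot_square_norm min_def)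
    ultimately show False by blast
  qed
  moreover have "bounding_plane i = bounding_plane j"
    by (rule face_unique[OF K(1,2,4) x K'(1,2,4)])
  ultimately show ?thesis
    using bounding_plane_eq_cases[of i j] norm_face K K' by auto
qed

lemma outward_normal_neighbour:
  assumes K: "K \<in> \<K>" "x \<in> frontier K" and K': "K' \<in> \<K>" "x \<in> frontier K'"
    and x: "x \<notin> edge_set" and ne: "K \<noteq> K'"
  shows "outward_normal K' x = - outward_normal K x"
proof -
  obtain j where j: "j \<in> faces K" "x \<in> K" "x \<in> bounding_plane j" by (rule frontier_face[OF K])
  obtain i where i: "i \<in> faces K'" "x \<in> K'" "x \<in> bounding_plane i" by (rule frontier_face[OF K'])
  show ?thesis
    using opposite_normals[OF K(1) j K'(1) i x ne] outward_normal_element[OF K(1) j x]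
      outward_normal_element[OF K'(1) i x] by simp
qed

text \<open>Three elements at \<open>x\<close> would have pairwise opposite normals there; then a
  normal is its own negative, contrary to unit length.\<close>

lemma at_most_two_elements:
  assumes "K \<in> \<K>" "K' \<in> \<K>" "K'' \<in> \<K>" "x \<in> K" "x \<in> K'" "x \<in> K''" "x \<notin> edge_set"
    "K \<noteq> K'" "K \<noteq> K''"
  shows "K' = K''"
proof (rule ccontr)
  assume ne: "K' \<noteq> K''"
  have f: "x \<in> frontier K" "x \<in> frontier K'" "x \<in> frontier K''"
    using elements_meet_in_frontier assms by metis+
  have "outward_normal K' x = - outward_normal K x" "outward_normal K'' x = - outward_normal K x"
    "outward_normal K'' x = - outward_normal K' x"
    using outward_normal_neighbour assms f ne by metis+
  then have "outward_normal K x = - outward_normal K x" by (metis minus_minus)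
  then have "outward_normal K x = 0" by (simp add: vec_eq_iff)
  moreover obtain j where j: "j \<in> faces K" "x \<in> K" "x \<in> bounding_plane j" by (rule frontier_face[OF assms(1) f(1)])
  ultimately show False using outward_normal_element[OF assms(1) j assms(7)] norm_face[OF assms(1) j(1)] by auto
qed

lemma frontier_elementD: "K \<in> \<K> \<Longrightarrow> x \<in> frontier K \<Longrightarrow> x \<in> K"
  using closed_element frontier_subset_closed by blast

lemma others_closed: "closed (\<Union>(\<K> - {K}))"
  using finite_mesh closed_element by (intro closed_Union) auto

text \<open>If the closed union of the other elements missed \<open>x\<close>, a small ball in the
  domain would be covered by \<open>K\<close> alone and \<open>x\<close> would be interior to
  \<open>K\<close>.\<close>

lemma interior_face_neighbour:
  assumes K: "K \<in> \<K>" "x \<in> frontier K" and x: "x \<notin> edge_set" "x \<notin> frontier \<Omega>"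
  shows "\<exists>K'\<in>\<K>. K' \<noteq> K \<and> x \<in> frontier K'"
proof -
  obtain j where j: "j \<in> faces K" "x \<in> K" "x \<in> bounding_plane j" by (rule frontier_face[OF K])
  have "x \<in> closure \<Omega>" using element_subset K(1) j by blast
  then have "x \<in> \<Omega>" using x(2) open_domain by (simp add: frontier_def interior_open)
  then obtain s where s: "s > 0" "ball x s \<subseteq> \<Omega>" using open_domain by (metis open_contains_ball)
  have "x \<in> closure (\<Union>(\<K> - {K}))"
  proof (rule ccontr)
    assume "x \<notin> closure (\<Union>(\<K> - {K}))"
    then have "x \<in> - closure (\<Union>(\<K> - {K}))" "open (- closure (\<Union>(\<K> - {K})))" by auto
    then obtain r where r: "r > 0" "ball x r \<subseteq> - closure (\<Union>(\<K> - {K}))" by (metis open_contains_ball)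
    have "ball x (min r s) \<subseteq> K"
    proof
      fix y assume y: "y \<in> ball x (min r s)"
      then have "y \<in> \<Union>\<K>" using s closure_subset[of \<Omega>] unfolding union_mesh by auto
      moreover have "y \<in> ball x r" using y by simp
      then have "y \<notin> \<Union>(\<K> - {K})" using r(2) closure_subset[of "\<Union>(\<K> - {K})"] by blast
      ultimately show "y \<in> K" by blast
    qed
    then have "x \<in> interior K" using r s by (meson centre_in_ball interior_maximal min_less_iff_conj open_ball subsetD)
    then show False using K(2) by (simp add: frontier_def)
  qed
  then have "x \<in> \<Union>(\<K> - {K})" using others_closed by simp
  then obtain K' where "K' \<in> \<K>" "K' \<noteq> K" "x \<in> K'" by blast
  then show ?thesis using elements_meet_in_frontier[of K' K x] K(1) j by blast
qed

lemma neighbour_eq: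
  assumes "K \<in> \<K>" "x \<in> frontier K" "K' \<in> \<K>" "K' \<noteq> K" "x \<in> frontier K'" "x \<notin> edge_set"
  shows "neighbour \<K> K x = K'"
  unfolding neighbour_def
proof (rule the_equality)
  show "K' \<in> \<K> \<and> K' \<noteq> K \<and> x \<in> frontier K'" using assms by blast
  fix L assume "L \<in> \<K> \<and> L \<noteq> K \<and> x \<in> frontier L"
  then show "L = K'" using at_most_two_elements[of K L K' x] assms frontier_elementD by metis
qed

text \<open>Two elements at \<open>x\<close> would contribute opposite half-balls, which fill a
  ball. Then \<open>x\<close> is interior to the closure of the domain, and for a Lipschitz boundary
  this means that it belongs to the domain.\<close>

lemma boundary_point_one_element:
  assumes x: "x \<in> frontier \<Omega>" "x \<notin> edge_set" and K: "K \<in> \<K>" "x \<in> K" and K': "K' \<in> \<K>" "x \<in> K'"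
  shows "K = K'"
proof (rule ccontr)
  assume ne: "K \<noteq> K'"
  have f: "x \<in> frontier K" "x \<in> frontier K'" using elements_meet_in_frontier K K' ne by metis+
  obtain j where j: "j \<in> faces K" "x \<in> K" "x \<in> bounding_plane j" by (rule frontier_face[OF K(1) f(1)])
  obtain i where i: "i \<in> faces K'" "x \<in> K'" "x \<in> bounding_plane i" by (rule frontier_face[OF K'(1) f(2)])
  have n: "fst i = - fst j" by (rule opposite_normals[OF K(1) j K'(1) i x(2) ne])
  obtain r where r: "r > 0" "K \<inter> ball x r = {y \<in> ball x r. (y - x) \<bullet> fst j \<le> 0}"
    using element_locally[OF K(1) j x(2)] by blast
  obtain s where s: "s > 0" "K' \<inter> ball x s = {y \<in> ball x s. (y - x) \<bullet> fst i \<le> 0}"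
    using element_locally[OF K'(1) i x(2)] by blast
  have "ball x (min r s) \<subseteq> K \<union> K'"
  proof
    fix y assume y: "y \<in> ball x (min r s)"
    show "y \<in> K \<union> K'"
    proof (cases "(y - x) \<bullet> fst j \<le> 0")
      case True
      then have "y \<in> K \<inter> ball x r" unfolding r(2) using y by simp
      then show ?thesis by blast
    next
      case False
      then have "y \<in> K' \<inter> ball x s" unfolding s(2) n using y by simp
      then show ?thesis by blast
    qed
  qed
  also have "\<dots> \<subseteq> closure \<Omega>" using element_subset K K' by blast
  finally have "x \<in> interior (closure \<Omega>)"
    using r s by (meson centre_in_ball interior_maximal min_less_iff_conj open_ball subsetD)
  then have "x \<in> \<Omega>" using interior_closure_domain by simp
  then show False using x(1) open_domain by (simp add: frontier_def interior_open)
qed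

lemma frontier_domain_subset: "frontier \<Omega> \<subseteq> (\<Union>K\<in>\<K>. frontier K)"
proof
  fix x assume x: "x \<in> frontier \<Omega>"
  then have "x \<in> \<Union>\<K>" unfolding union_mesh by (simp add: frontier_def)
  then obtain K where K: "K \<in> \<K>" "x \<in> K" by blast
  have "x \<notin> \<Omega>" using x open_domain by (simp add: frontier_def interior_open)
  then have "x \<notin> interior K" using interior_element_subset[OF K(1)] by blast
  then have "x \<in> frontier K" using K closed_element[OF K(1)] by (simp add: frontier_def)
  then show "x \<in> (\<Union>K\<in>\<K>. frontier K)" using K by blast
qed

text \<open>Lets normals and traces taken from the domain be computed from the single element at the
  point.\<close>

lemma boundary_locally:
  assumes x: "x \<in> frontier \<Omega>" "x \<notin> edge_set" and K: "K \<in> \<K>" "x \<in> K"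
  shows "\<exists>r>0. closure \<Omega> \<inter> ball x r = K \<inter> ball x r \<and> \<Omega> \<inter> ball x r \<subseteq> interior K"
proof -
  have "x \<notin> \<Union>(\<K> - {K})" using boundary_point_one_element[OF x K] by blast
  then have "x \<in> - \<Union>(\<K> - {K})" "open (- \<Union>(\<K> - {K}))" using others_closed by auto
  then obtain r where r: "r > 0" "ball x r \<subseteq> - \<Union>(\<K> - {K})" by (metis open_contains_ball)
  have 1: "closure \<Omega> \<inter> ball x r = K \<inter> ball x r"
    unfolding union_mesh[symmetric] using r(2) K(1) by blast
  have "\<Omega> \<inter> ball x r \<subseteq> K" using 1 closure_subset[of \<Omega>] by blast
  then have "\<Omega> \<inter> ball x r \<subseteq> interior K" using open_domain by (simp add: interior_maximal open_Int)
  then show ?thesis using 1 r(1) by blast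
qed

lemma outward_normal_boundary:
  assumes x: "x \<in> frontier \<Omega>" "x \<notin> edge_set" and K: "K \<in> \<K>" "x \<in> frontier K"
  shows "outward_normal \<Omega> x = outward_normal K x"
proof -
  obtain j where j: "j \<in> faces K" "x \<in> K" "x \<in> bounding_plane j" by (rule frontier_face[OF K])
  obtain r where r: "r > 0" "K \<inter> ball x r = {y \<in> ball x r. (y - x) \<bullet> fst j \<le> 0}"
    using element_locally[OF K(1) j x(2)] by blast
  obtain s where s: "s > 0" "closure \<Omega> \<inter> ball x s = K \<inter> ball x s"
    using boundary_locally[OF x K(1) j(2)] by blast
  have "closure \<Omega> \<inter> ball x (min r s) = {y \<in> ball x (min r s). (y - x) \<bullet> fst j \<le> 0}"
  proof (rule set_eqI)
    fix y
    have "y \<in> closure \<Omega> \<longleftrightarrow> (y - x) \<bullet> fst j \<le> 0" if "y \<in> ball x (min r s)"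
    proof -
      have "y \<in> ball x r" "y \<in> ball x s" using that by auto
      then show ?thesis using r(2) s(2) by blast
    qed
    then show "y \<in> closure \<Omega> \<inter> ball x (min r s) \<longleftrightarrow> y \<in> {y \<in> ball x (min r s). (y - x) \<bullet> fst j \<le> 0}" by blast
  qed
  then have "outward_normal \<Omega> x = fst j"
    using r s norm_face[OF K(1) j(1)] by (intro outward_normal_eqI[of _ "min r s"]) auto
  then show ?thesis using outward_normal_element[OF K(1) j x(2)] by simp
qed

end

subsection \<open>Surface and volume integrals\<close>

text \<open>A class closed under the algebra of the integrands and integrable over sets of finite
  measure. Measurability is global and boundedness only on \<open>S\<close>, since smooth extensions
  may grow at infinity.\<close>

definition bdd_borel_on :: "'a::topological_space set \<Rightarrow> ('a \<Rightarrow> 'b::real_normed_vector) \<Rightarrow> bool" where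
  "bdd_borel_on S f \<longleftrightarrow> f \<in> borel_measurable borel \<and> bounded (f ` S)"

lemma bdd_borel_onD:
  "bdd_borel_on S f \<Longrightarrow> f \<in> borel_measurable borel"
  "bdd_borel_on S f \<Longrightarrow> \<exists>C. \<forall>x\<in>S. norm (f x) \<le> C"
  by (auto simp: bdd_borel_on_def bounded_iff)

lemma bdd_borel_onI:
  "f \<in> borel_measurable borel \<Longrightarrow> (\<And>x. x \<in> S \<Longrightarrow> norm (f x) \<le> C) \<Longrightarrow> bdd_borel_on S f"
  by (auto simp: bdd_borel_on_def bounded_iff)

lemma bdd_borel_on_subset: "bdd_borel_on S f \<Longrightarrow> T \<subseteq> S \<Longrightarrow> bdd_borel_on T f"
  by (auto simp: bdd_borel_on_def intro: bounded_subset)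

lemma bdd_borel_on_continuous:
  fixes f :: "'a::t2_space \<Rightarrow> 'b::real_normed_vector"
  assumes "continuous_on UNIV f" "compact S"
  shows "bdd_borel_on S f"
  unfolding bdd_borel_on_def
  using assms by (auto intro!: borel_measurable_continuous_onI compact_imp_bounded compact_continuous_image
      intro: continuous_on_subset)

lemma bdd_borel_on_const: "bdd_borel_on S (\<lambda>x. c)"
  by (rule bdd_borel_onI[of _ _ "norm c"]) auto

lemma bdd_borel_on_bilinear:
  fixes f :: "'a::topological_space \<Rightarrow> 'b::{real_normed_vector, second_countable_topology}"
    and g :: "'a \<Rightarrow> 'c::{real_normed_vector, second_countable_topology}"
  assumes P: "bounded_bilinear P" and f: "bdd_borel_on S f" and g: "bdd_borel_on S g"
  shows "bdd_borel_on S (\<lambda>x. P (f x) (g x))"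
proof -
  interpret bounded_bilinear P by fact
  have [measurable]: "f \<in> borel_measurable borel" "g \<in> borel_measurable borel" using f g by (auto dest: bdd_borel_onD)
  have c: "continuous_on UNIV (\<lambda>z. P (fst z) (snd z))" by (intro continuous_on continuous_intros)
  obtain C1 C2 where C: "\<And>x. x \<in> S \<Longrightarrow> norm (f x) \<le> C1" "\<And>x. x \<in> S \<Longrightarrow> norm (g x) \<le> C2"
    using bdd_borel_onD(2)[OF f] bdd_borel_onD(2)[OF g] by metis
  obtain M where M: "M > 0" "\<And>a b. norm (P a b) \<le> norm a * norm b * M" using pos_bounded by metis
  show ?thesis
  proof (rule bdd_borel_onI)
    show "(\<lambda>x. P (f x) (g x)) \<in> borel_measurable borel"
      using borel_measurable_continuous_on[OF c, of "\<lambda>x. (f x, g x)" borel] by simp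
    fix x assume x: "x \<in> S"
    have "norm (P (f x) (g x)) \<le> norm (f x) * norm (g x) * M" by (rule M)
    also have "\<dots> \<le> C1 * C2 * M"
      using C(1)[OF x] C(2)[OF x] M(1) by (intro mult_right_mono mult_mono) (auto intro: order_trans[OF norm_ge_zero])
    finally show "norm (P (f x) (g x)) \<le> C1 * C2 * M" .
  qed
qed

lemma bdd_borel_on_add:
  fixes f g :: "'a::topological_space \<Rightarrow> 'b::{real_normed_vector, second_countable_topology}"
  assumes f: "bdd_borel_on S f" and g: "bdd_borel_on S g"
  shows "bdd_borel_on S (\<lambda>x. f x + g x)"
proof -
  obtain C1 C2 where C: "\<And>x. x \<in> S \<Longrightarrow> norm (f x) \<le> C1" "\<And>x. x \<in> S \<Longrightarrow> norm (g x) \<le> C2"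
    using bdd_borel_onD(2)[OF f] bdd_borel_onD(2)[OF g] by metis
  show ?thesis
    using bdd_borel_onD(1)[OF f] bdd_borel_onD(1)[OF g] C
    by (intro bdd_borel_onI[of _ _ "C1 + C2"]) (auto intro!: norm_triangle_le add_mono)
qed

lemma bdd_borel_on_sum:
  fixes f :: "'i \<Rightarrow> 'a::topological_space \<Rightarrow> 'b::{real_normed_vector, second_countable_topology}"
  assumes "\<And>i. i \<in> I \<Longrightarrow> bdd_borel_on S (f i)"
  shows "bdd_borel_on S (\<lambda>x. \<Sum>i\<in>I. f i x)"
proof (cases "finite I")
  case True
  then show ?thesis using assms
    by (induction I) (auto intro: bdd_borel_on_const bdd_borel_on_add)
qed (simp add: bdd_borel_on_const)

lemma bdd_borel_on_indicator_fst:
  fixes A :: "'a::{second_countable_topology} set"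
  assumes "A \<in> sets borel"
  shows "bdd_borel_on S (\<lambda>z :: 'a \<times> 'b::second_countable_topology. indicator A (fst z) :: real)"
proof (rule bdd_borel_onI[of _ _ 1])
  have "fst \<in> measurable (borel :: ('a \<times> 'b) measure) borel" by (intro borel_measurable_continuous_onI continuous_intros)
  then show "(\<lambda>z :: 'a \<times> 'b. indicator A (fst z) :: real) \<in> borel_measurable borel"
    using assms by (rule measurable_compose[OF _ borel_measurable_indicator])
qed (simp add: indicator_def)

lemma bounded_bilinear_cross3: "bounded_bilinear cross3"
  using bilinear_cross bilinear_conv_bounded_bilinear by blast

lemmas bdd_borel_on_mult = bdd_borel_on_bilinear[OF bounded_bilinear_mult]
  and bdd_borel_on_inner = bdd_borel_on_bilinear[OF bounded_bilinear_inner]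
  and bdd_borel_on_scaleR = bdd_borel_on_bilinear[OF bounded_bilinear_scaleR]
  and bdd_borel_on_cross3 = bdd_borel_on_bilinear[OF bounded_bilinear_cross3]

lemma integrable_bdd_borel_on:
  fixes f :: "'a::topological_space \<Rightarrow> real"
  assumes "S \<in> sets borel" "sets M = sets borel" "emeasure M S < \<infinity>" "bdd_borel_on S f"
  shows "integrable M (\<lambda>x. indicator S x * f x)"
proof -
  obtain C where "\<And>x. x \<in> S \<Longrightarrow> norm (f x) \<le> C" using bdd_borel_onD(2)[OF assms(4)] by metis
  then have "integrable M (\<lambda>x. indicator S x *\<^sub>R f x)"
    using assms bdd_borel_onD(1)[OF assms(4)] measurable_cong_sets[OF assms(2) refl]
    by (intro integrableI_bounded_set_indicator) auto
  then show ?thesis by simp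
qed

text \<open>Lets integrands that are only known off the edges count as measurable; the completion in
  \<open>surface_time_measure\<close> exists for this purpose.\<close>

lemma borel_measurable_AE_completion:
  assumes f: "f \<in> measurable (completion M) N" and ae: "AE x in M. g x = f x"
    and g: "g \<in> space M \<rightarrow> space N"
  shows "g \<in> measurable (completion M) N"
proof (rule measurableI)
  fix A assume A: "A \<in> sets N"
  have ae': "AE x in completion M. g x = f x" using ae by (rule AE_completion)
  show "g -` A \<inter> space (completion M) \<in> sets (completion M)"
  proof (rule completion.in_sets_AE)
    show "f -` A \<inter> space (completion M) \<in> sets (completion M)" using f A by (rule measurable_sets)
    show "AE x in completion M. (x \<in> f -` A \<inter> space (completion M)) = (x \<in> g -` A \<inter> space (completion M))"
      using ae' by eventually_elim auto
  qed auto
qed (use g in auto)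

text \<open>\<open>f\<close> is meant to be an integrand of the scheme, known only off element
  boundaries, and \<open>g\<close> the corresponding expression in the smooth extensions.\<close>

lemma integral_lebesgue_on_cong:
  fixes f g :: "'a::euclidean_space \<Rightarrow> real"
  assumes S: "S \<in> sets borel" "bounded S" and N: "negligible N"
    and g: "bdd_borel_on S g" and eq: "\<And>z. z \<in> S - N \<Longrightarrow> f z = g z"
  shows "integrable (lebesgue_on S) f"
    and "(LINT z|lebesgue_on S. f z) = (LINT z|lborel. indicator S z * g z)"
proof -
  have [measurable]: "g \<in> borel_measurable borel" "S \<in> sets borel" using g S by (auto dest: bdd_borel_onD)
  have ig: "integrable lborel (\<lambda>z. indicator S z * g z)"
    using S g by (intro integrable_bdd_borel_on emeasure_bounded_finite) auto
  have "N \<in> null_sets lebesgue" using N by (simp add: negligible_iff_null_sets)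
  then have "AE z in lebesgue. z \<notin> N" by (rule AE_not_in)
  then have "AE z in lborel. z \<notin> N" by (simp add: AE_completion_iff)
  then have ae: "AE z in lborel. indicator S z * f z = indicator S z * g z"
    by eventually_elim (use eq in \<open>auto simp: indicator_def\<close>)
  have gm: "(\<lambda>z. indicator S z * g z) \<in> borel_measurable lebesgue" by (rule measurable_completion) simp
  have fm: "(\<lambda>z. indicator S z * f z) \<in> borel_measurable lebesgue"
    by (rule borel_measurable_AE_completion[OF gm ae]) simp
  have ae': "AE z in lebesgue. indicator S z * f z = indicator S z * g z" using ae by (rule AE_completion)
  have ig': "integrable lebesgue (\<lambda>z. indicator S z * g z)" using ig by (simp add: integrable_completion)
  then have "integrable lebesgue (\<lambda>z. indicator S z * f z)"
    using integrable_cong_AE[OF fm gm ae'] by simp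
  then show "integrable (lebesgue_on S) f"
    using S by (simp add: integrable_restrict_space)
  have "(LINT z|lebesgue_on S. f z) = (LINT z|lebesgue. indicator S z * f z)"
    using S by (simp add: integral_restrict_space)
  also have "\<dots> = (LINT z|lebesgue. indicator S z * g z)" by (rule integral_cong_AE[OF fm gm ae'])
  also have "\<dots> = (LINT z|lborel. indicator S z * g z)" by (rule integral_completion) simp
  finally show "(LINT z|lebesgue_on S. f z) = (LINT z|lborel. indicator S z * g z)" .
qed

lemma finite_measure_restrict_area:
  assumes "A \<in> sets borel" "emeasure polyhedral_area A < \<infinity>"
  shows "finite_measure (restrict_space polyhedral_area A)"
  by (rule finite_measureI) (use assms in \<open>simp add: emeasure_restrict_space space_restrict_space\<close>)

lemma AE_restrict_area:
  assumes "A \<in> sets borel" "N \<in> null_sets polyhedral_area"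
  shows "AE x in restrict_space polyhedral_area A. x \<notin> N"
  using AE_not_in[OF assms(2)] assms(1)
  by (simp add: AE_restrict_space_iff) (metis (mono_tags, lifting) eventually_mono)

lemma measurable_ident_pair_borel:
  fixes M :: "'a::second_countable_topology measure" and N :: "'b::second_countable_topology measure"
  assumes [measurable]: "(\<lambda>x. x) \<in> measurable M borel" "(\<lambda>t. t) \<in> measurable N borel"
  shows "(\<lambda>z. z) \<in> measurable (M \<Otimes>\<^sub>M N) borel"
proof -
  have "(\<lambda>z. (fst z, snd z)) \<in> measurable (M \<Otimes>\<^sub>M N) (borel \<Otimes>\<^sub>M borel)" by measurable
  then show ?thesis by (simp add: borel_prod)
qed

text \<open>Replaces an integrand known off a null set by a Borel one and puts the time integral
  outside, so that the balance over the surfaces can be carried out at each fixed time.\<close>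

lemma integral_surface_time_measure:
  fixes f' :: "(real^3) \<times> real \<Rightarrow> real" and I :: "real set"
  assumes A: "A \<in> sets borel" "emeasure polyhedral_area A < \<infinity>"
    and I: "I \<in> sets borel" "bounded I" and N: "N \<in> null_sets polyhedral_area"
    and f': "bdd_borel_on (A \<times> I) f'"
    and eq: "\<And>x t. x \<in> A - N \<Longrightarrow> t \<in> I \<Longrightarrow> f x t = f' (x, t)"
  shows "integrable (surface_time_measure A I) (\<lambda>(x, t). f x t)" (is ?A)
    and "integrable lborel (\<lambda>t. indicator I t * (LINT x|polyhedral_area. indicator A x * f' (x, t)))" (is ?B)
    and "(LINT (x, t)|surface_time_measure A I. f x t)
      = (LINT t|lborel. indicator I t * (LINT x|polyhedral_area. indicator A x * f' (x, t)))" (is ?C)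
proof -
  let ?M1 = "restrict_space polyhedral_area A" and ?M2 = "restrict_space lborel I"
  let ?P = "?M1 \<Otimes>\<^sub>M ?M2"
  have [measurable]: "f' \<in> borel_measurable borel" using f' by (rule bdd_borel_onD)
  interpret M1: finite_measure ?M1
    by (rule finite_measure_restrict_area[OF A])
  interpret M2: finite_measure ?M2
    by (rule finite_measureI)
       (use I emeasure_bounded_finite[of I] in \<open>simp add: emeasure_restrict_space space_restrict_space\<close>)
  interpret P: pair_sigma_finite ?M1 ?M2 ..
  interpret PF: finite_measure ?P
    by (rule finite_measure_pair_measure) (unfold_locales)
  have spP: "space ?P = A \<times> I" using A I by (simp add: space_pair_measure space_restrict_space)
  have idm: "(\<lambda>z. z) \<in> measurable ?P borel"
    by (intro measurable_ident_pair_borel measurable_restrict_space1) simp_all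
  have f'm: "f' \<in> borel_measurable ?P" using measurable_compose[OF idm \<open>f' \<in> borel_measurable borel\<close>] by simp
  obtain C where C: "\<And>z. z \<in> A \<times> I \<Longrightarrow> norm (f' z) \<le> C" using bdd_borel_onD(2)[OF f'] by metis
  have intP: "integrable ?P f'"
    by (rule PF.integrable_const_bound[OF _ f'm, of C]) (intro AE_I2 C, simp only: spP)
  have AEN: "AE x in ?M1. x \<notin> N"
    by (rule AE_restrict_area[OF A(1) N])
  have "AE z in ?P. fst z \<notin> N"
  proof (rule P.AE_pair_measure)
    have Nb: "N \<in> sets borel" using N by auto
    have "{z \<in> space ?P. fst z \<notin> N} = (\<lambda>z. z) -` (fst -` (- N)) \<inter> space ?P" by auto
    also have "\<dots> \<in> sets ?P"
      by (rule measurable_sets[OF idm]) (intro measurable_sets_borel[of fst borel] borel_measurable_continuous_onI continuous_intros; use Nb in auto)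
    finally show "{z \<in> space ?P. fst z \<notin> N} \<in> sets ?P" .
    show "AE x in ?M1. AE y in ?M2. fst (x, y) \<notin> N" using AEN by eventually_elim simp
  qed
  then have ae: "AE z in ?P. case_prod f z = f' z"
    using AE_space by eventually_elim (auto simp: spP intro!: eq)
  have f'c: "f' \<in> borel_measurable (completion ?P)" by (rule measurable_completion[OF f'm])
  have fc: "(\<lambda>(x, t). f x t) \<in> borel_measurable (completion ?P)"
    by (rule borel_measurable_AE_completion[OF f'c ae]) simp
  have ae': "AE z in completion ?P. case_prod f z = f' z" using ae by (rule AE_completion)
  have "integrable (completion ?P) f'" using intP f'm by (simp add: integrable_completion)
  then show ?A
    unfolding surface_time_measure_def using integrable_cong_AE[OF fc f'c ae'] by simp
  have inner: "(LINT x|?M1. f' (x, t)) = (LINT x|polyhedral_area. indicator A x * f' (x, t))" for t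
    using A by (subst integral_restrict_space) auto
  have "integrable ?M2 (\<lambda>t. LINT x|?M1. f' (x, t))" by (rule P.integrable_snd) (use intP in \<open>simp add: case_prod_unfold\<close>)
  then show ?B using I by (simp add: integrable_restrict_space inner)
  have "(LINT (x, t)|surface_time_measure A I. f x t) = integral\<^sup>L (completion ?P) f'"
    unfolding surface_time_measure_def by (rule integral_cong_AE[OF fc f'c ae'])
  also have "\<dots> = integral\<^sup>L ?P f'" by (rule integral_completion[OF f'm])
  also have "\<dots> = (LINT t|?M2. LINT x|?M1. f' (x, t))"
    using P.integral_snd[of "\<lambda>x t. f' (x, t)"] intP by (simp add: case_prod_unfold)
  also have "\<dots> = (LINT t|lborel. indicator I t * (LINT x|polyhedral_area. indicator A x * f' (x, t)))"
    using I by (subst integral_restrict_space) (auto simp: inner)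
  finally show ?C .
qed


subsection \<open>Smooth fields in space and time\<close>

lemma continuous_on_slice: "continuous_on UNIV G \<Longrightarrow> continuous_on UNIV (\<lambda>x. G (x, t))"
  by (rule continuous_on_compose2[where t = UNIV]) (auto intro!: continuous_intros)

lemma tendsto_slice: "continuous_on UNIV G \<Longrightarrow> ((\<lambda>y. G (y, t)) \<longlongrightarrow> G (x, t)) (at x within S)"
  using continuous_on_slice[of G t]
  by (meson UNIV_I continuous_on_def tendsto_within_subset top_greatest)

abbreviation dir_deriv :: "((real^3) \<times> real \<Rightarrow> real^3) \<Rightarrow> (real^3) \<times> real \<Rightarrow> (real^3) \<times> real \<Rightarrow> real^3" where
  "dir_deriv G v z \<equiv> frechet_derivative G (at z) v"

text \<open>The curl written with the space-time derivative of an extension; for smooth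
  \<open>G\<close> it is continuous everywhere, including across element boundaries.\<close>

definition spatial_curl :: "((real^3) \<times> real \<Rightarrow> real^3) \<Rightarrow> (real^3) \<times> real \<Rightarrow> real^3" where
  "spatial_curl G z = vector
     [dir_deriv G (axis 2 1, 0) z $ 3 - dir_deriv G (axis 3 1, 0) z $ 2,
      dir_deriv G (axis 3 1, 0) z $ 1 - dir_deriv G (axis 1 1, 0) z $ 3,
      dir_deriv G (axis 1 1, 0) z $ 2 - dir_deriv G (axis 2 1, 0) z $ 1]"

lemma smooth_has_derivative: "smooth G \<Longrightarrow> (G has_derivative frechet_derivative G (at z)) (at z)"
  unfolding smooth_def
  by (drule spec[of _ "Suc 0"]) (auto simp: differentiable_on_def frechet_derivative_works[symmetric])

lemma smooth_continuous: "smooth G \<Longrightarrow> continuous_on UNIV G"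
  unfolding smooth_def by (drule spec[of _ 0]) auto

lemma smooth_continuous_deriv: "smooth G \<Longrightarrow> continuous_on UNIV (\<lambda>z. frechet_derivative G (at z) v)"
  unfolding smooth_def by (drule spec[of _ "Suc 0"]) auto

lemma continuous_on_vec3:
  fixes f g h :: "'a::topological_space \<Rightarrow> real"
  assumes "continuous_on S f" "continuous_on S g" "continuous_on S h"
  shows "continuous_on S (\<lambda>x. vector [f x, g x, h x] :: real^3)"
proof -
  have "(\<lambda>x. vector [f x, g x, h x] :: real^3) = (\<lambda>x. f x *\<^sub>R axis 1 1 + g x *\<^sub>R axis 2 1 + h x *\<^sub>R axis 3 1)"
    by (auto simp: fun_eq_iff vec_eq_iff forall_3 axis_def)
  then show ?thesis using assms by (simp only:) (intro continuous_intros)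
qed

lemma smooth_continuous_curl: "smooth G \<Longrightarrow> continuous_on UNIV (spatial_curl G)"
  unfolding spatial_curl_def
  by (intro continuous_on_vec3 continuous_on_diff continuous_on_component smooth_continuous_deriv)

lemma smooth_line_derivative:
  assumes "smooth G"
  shows "((\<lambda>s. G (z + s *\<^sub>R v)) has_vector_derivative dir_deriv G v (z + s *\<^sub>R v)) (at s)"
proof -
  have "((\<lambda>s. z + s *\<^sub>R v) has_vector_derivative v) (at s)" by (auto intro!: derivative_eq_intros)
  then show ?thesis
    using vector_derivative_diff_chain_within[of "\<lambda>s. z + s *\<^sub>R v" v s UNIV G]
      smooth_has_derivative[OF assms] by (simp add: has_derivative_at_withinI o_def)
qed

text \<open>The field agrees with its extension on an open set of times around \<open>s\<close>, so
  the derivatives agree too. The end points of a slab are not reached, but they are null.\<close>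

lemma dir_deriv_time:
  assumes "smooth G" "open U" "s \<in> U" "\<And>t. t \<in> U \<Longrightarrow> u x t = G (x, t)"
  shows "time_deriv u x s = dir_deriv G (0, 1) (x, s)"
proof -
  have "((\<lambda>t. G ((x, 0) + t *\<^sub>R (0, 1))) has_vector_derivative dir_deriv G (0, 1) ((x, 0) + s *\<^sub>R (0, 1))) (at s)"
    by (rule smooth_line_derivative[OF assms(1)])
  then have "((\<lambda>t. G (x, t)) has_vector_derivative dir_deriv G (0, 1) (x, s)) (at s)" by simp
  then have "(u x has_vector_derivative dir_deriv G (0, 1) (x, s)) (at s)"
    by (rule has_vector_derivative_transform_within_open[OF _ assms(2,3)]) (use assms(4) in simp)
  then show ?thesis unfolding time_deriv_def by (rule vector_derivative_at)
qed

lemma curl_eq_spatial_curl: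
  assumes "smooth G" "open U" "x \<in> U" "\<And>y. y \<in> U \<Longrightarrow> u y t = G (y, t)"
  shows "curl u x t = spatial_curl G (x, t)"
proof -
  have "((\<lambda>y. (y, t)) has_derivative (\<lambda>v. (v, 0))) (at x)" by (auto intro!: derivative_eq_intros)
  then have "((\<lambda>y. G (y, t)) has_derivative (\<lambda>v. dir_deriv G (v, 0) (x, t))) (at x)"
    using diff_chain_at[OF _ smooth_has_derivative[OF assms(1)], of "\<lambda>y. (y, t)"] by (simp add: o_def)
  then have "((\<lambda>y. u y t) has_derivative (\<lambda>v. dir_deriv G (v, 0) (x, t))) (at x)"
    by (rule has_derivative_transform_within_open[OF _ assms(2,3)]) (use assms(4) in simp)
  then have "frechet_derivative (\<lambda>y. u y t) (at x) = (\<lambda>v. dir_deriv G (v, 0) (x, t))"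
    by (rule frechet_derivative_at[symmetric])
  then show ?thesis by (simp add: curl_def spatial_curl_def partial_def Let_def)
qed

text \<open>This is \<open>div (A \<times> B) = curl A \<bullet> B - curl B \<bullet> A\<close>,
  with the product rule already carried out on the left.\<close>

lemma curl_cross_identity:
  "(\<Sum>i\<in>UNIV. (cross3 (dir_deriv A (axis i 1, 0) z) (B z) + cross3 (A z) (dir_deriv B (axis i 1, 0) z)) $ i)
    = spatial_curl A z \<bullet> B z - spatial_curl B z \<bullet> A z"
  by (simp add: sum_3 spatial_curl_def cross3_def inner_vec_def algebra_simps)

text \<open>The directional theorem is applied to component \<open>i\<close> of the cross product in
  direction \<open>axis i 1\<close>; summed over \<open>i\<close>, the coefficients of the normal
  assemble its inner product with the field.\<close>

lemma integral_curl_polytope: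
  assumes J: "finite J" "\<And>j. j \<in> J \<Longrightarrow> norm (fst j) = 1" "inj_on bounding_plane J"
    and bdd: "bounded (halfspaces J)" and A: "smooth A" and B: "smooth B"
  shows "(LINT x|lborel. indicator (halfspaces J) x * (spatial_curl A (x, t) \<bullet> B (x, t) - spatial_curl B (x, t) \<bullet> A (x, t)))
    = (\<Sum>j\<in>J. LINT x|plane_area (bounding_plane j). indicator (halfspaces J) x * (fst j \<bullet> cross3 (A (x, t)) (B (x, t))))"
proof -
  let ?K = "halfspaces J"
  define G where "G = (\<lambda>i x. cross3 (A (x, t)) (B (x, t)) $ i)"
  define D where "D = (\<lambda>i x. (cross3 (dir_deriv A (axis i 1, 0) (x, t)) (B (x, t)) + cross3 (A (x, t)) (dir_deriv B (axis i 1, 0) (x, t))) $ i)"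
  have K: "compact ?K" using bdd closed_halfspaces compact_eq_bounded_closed by blast
  have pair: "continuous_on UNIV (\<lambda>x :: real^3. (x, t))" by (intro continuous_intros)
  note cc = continuous_on_compose2[OF _ pair]
  have contG: "continuous_on UNIV (G i)" for i
    unfolding G_def by (intro continuous_on_component continuous_on_cross cc[OF smooth_continuous] A B) auto
  have contD: "continuous_on UNIV (D i)" for i
    unfolding D_def
    by (intro continuous_on_component continuous_on_cross continuous_on_add cc[OF smooth_continuous]
        cc[OF smooth_continuous_deriv] A B) auto
  have deriv: "((\<lambda>s. G i (x + s *\<^sub>R axis i 1)) has_real_derivative D i x) (at 0)" for i x
  proof -
    have a: "((\<lambda>s. A (x + s *\<^sub>R axis i 1, t)) has_vector_derivative dir_deriv A (axis i 1, 0) (x, t)) (at 0)"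
      using smooth_line_derivative[OF A, of "(x, t)" "(axis i 1, 0)" 0] by simp
    have b: "((\<lambda>s. B (x + s *\<^sub>R axis i 1, t)) has_vector_derivative dir_deriv B (axis i 1, 0) (x, t)) (at 0)"
      using smooth_line_derivative[OF B, of "(x, t)" "(axis i 1, 0)" 0] by simp
    have "((\<lambda>s. cross3 (A (x + s *\<^sub>R axis i 1, t)) (B (x + s *\<^sub>R axis i 1, t))) has_vector_derivative
       cross3 (A (x + 0 *\<^sub>R axis i 1, t)) (dir_deriv B (axis i 1, 0) (x, t)) +
       cross3 (dir_deriv A (axis i 1, 0) (x, t)) (B (x + 0 *\<^sub>R axis i 1, t))) (at 0)"
      by (rule bounded_bilinear.has_vector_derivative[OF bounded_bilinear_cross3 a b])
    from bounded_linear.has_vector_derivative[OF bounded_linear_vec_nth this]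
    show ?thesis
      by (simp add: G_def D_def has_real_derivative_iff_has_vector_derivative add.commute)
  qed
  have area: "integrable (plane_area (bounding_plane j)) (\<lambda>x. indicator ?K x * G i x)" if "j \<in> J" for i j
    using K emeasure_plane_area_bounded[OF is_plane_bounding_plane[OF J(2)[OF that]] bdd] contG
    by (intro integrable_bdd_borel_on bdd_borel_on_continuous) (auto simp: borel_compact)
  have "(LINT x|lborel. indicator ?K x * (spatial_curl A (x, t) \<bullet> B (x, t) - spatial_curl B (x, t) \<bullet> A (x, t)))
    = (LINT x|lborel. (\<Sum>i\<in>UNIV. indicator ?K x * D i x))"
    by (simp add: curl_cross_identity[symmetric] D_def sum_distrib_left)
  also have "\<dots> = (\<Sum>i\<in>UNIV. LINT x|lborel. indicator ?K x * D i x)"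
    using K contD bdd emeasure_bounded_finite[OF bdd]
    by (intro Bochner_Integration.integral_sum integrable_bdd_borel_on bdd_borel_on_continuous)
       (auto simp: borel_compact)
  also have "\<dots> = (\<Sum>i\<in>UNIV. \<Sum>j\<in>J. (fst j \<bullet> axis i 1) * (LINT x|plane_area (bounding_plane j). indicator ?K x * G i x))"
    by (intro sum.cong polytope_directional_divergence[OF J bdd _ deriv contD contG]) auto
  also have "\<dots> = (\<Sum>j\<in>J. \<Sum>i\<in>UNIV. (fst j \<bullet> axis i 1) * (LINT x|plane_area (bounding_plane j). indicator ?K x * G i x))"
    by (rule sum.swap)
  also have "\<dots> = (\<Sum>j\<in>J. LINT x|plane_area (bounding_plane j). (\<Sum>i\<in>UNIV. (fst j \<bullet> axis i 1) * (indicator ?K x * G i x)))"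
    using area by (intro sum.cong refl) (simp add: Bochner_Integration.integral_sum)
  also have "\<dots> = (\<Sum>j\<in>J. LINT x|plane_area (bounding_plane j). indicator ?K x * (fst j \<bullet> cross3 (A (x, t)) (B (x, t))))"
  proof (intro sum.cong refl Bochner_Integration.integral_cong)
    fix j x
    have "(\<Sum>i\<in>UNIV. (a \<bullet> axis i 1) * (c * w $ i)) = c * (a \<bullet> w)" for a w :: "real^3" and c
      by (simp add: inner_axis inner_vec_def[of a w] sum_distrib_left mult.left_commute)
    then show "(\<Sum>i\<in>UNIV. (fst j \<bullet> axis i 1) * (indicator ?K x * G i x)) = indicator ?K x * (fst j \<bullet> cross3 (A (x, t)) (B (x, t)))"
      unfolding G_def .
  qed
  finally show ?thesis .
qed

subsection \<open>Traces and fluxes\<close>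

lemma borel_measurable_slice:
  fixes g :: "(real^3) \<times> real \<Rightarrow> real"
  assumes "g \<in> borel_measurable borel"
  shows "(\<lambda>x. g (x, t)) \<in> borel_measurable borel"
  by (rule measurable_compose[OF borel_measurable_continuous_onI assms]) (intro continuous_intros)

lemma AE_plane_area:
  assumes "is_plane P"
  shows "AE x in plane_area P. x \<in> P"
proof -
  obtain a b where ab: "a \<noteq> 0" "P = {x. a \<bullet> x = b}" using assms by (auto simp: is_plane_def)
  obtain L :: "real^2 \<Rightarrow> real^3" and p where L: "linear L" "\<forall>y. norm (L y) = norm y"
    "range (\<lambda>y. p + L y) = P" "plane_area P = distr lborel borel (\<lambda>y. p + L y)"
    "(\<lambda>y. p + L y) \<in> borel_measurable borel"
    unfolding ab(2) by (rule plane_chart[OF ab(1), of b])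
  have "P \<in> sets borel" using is_plane_closed[OF assms] by (rule borel_closed)
  moreover have "p + L y \<in> P" for y using L(3) by blast
  ultimately show ?thesis
    unfolding L(4) by (subst AE_distr_iff) (auto intro!: L(5))
qed

context polyhedral_mesh
begin

text \<open>The limit is taken through the interior, where field and extension agree. The element is
  the closure of its interior, so the filter is nontrivial and \<open>Lim\<close> is
  determined.\<close>

lemma inner_trace_element:
  assumes K: "K \<in> \<K>" and G: "continuous_on UNIV G" and u: "\<And>y. y \<in> interior K \<Longrightarrow> u y t = G (y, t)"
    and x: "x \<in> K"
  shows "inner_trace K u x t = G (x, t)"
proof -
  have "x \<in> closure (interior K)" using x closure_interior_element[OF K] by simp
  then have lim: "x islimpt interior K"
    by (cases "x \<in> interior K") (auto simp: interior_limit_point closure_def islimpt_Un intro: interior_limit_point)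
  then have nt: "at x within interior K \<noteq> bot" by (simp add: trivial_limit_within)
  have "((\<lambda>y. G (y, t)) \<longlongrightarrow> G (x, t)) (at x within interior K)"
    by (rule tendsto_slice[OF G])
  then have "((\<lambda>y. u y t) \<longlongrightarrow> G (x, t)) (at x within interior K)"
    by (rule Lim_transform_eventually) (auto simp: eventually_at_filter u)
  then show ?thesis unfolding inner_trace_def by (rule tendsto_Lim[OF nt])
qed

text \<open>Near \<open>x\<close> the domain lies in the interior of the only element there, so its
  trace is that of the element.\<close>

lemma inner_trace_boundary:
  assumes K: "K \<in> \<K>" "x \<in> frontier K" and x: "x \<in> frontier \<Omega>" "x \<notin> edge_set"
    and G: "continuous_on UNIV G" and u: "\<And>y. y \<in> interior K \<Longrightarrow> u y t = G (y, t)"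
  shows "inner_trace \<Omega> u x t = G (x, t)"
proof -
  have xK: "x \<in> K" by (rule frontier_elementD[OF K])
  obtain r where r: "r > 0" "\<Omega> \<inter> ball x r \<subseteq> interior K" using boundary_locally[OF x K(1) xK] by blast
  have "x \<notin> \<Omega>" "x \<in> closure \<Omega>" using x(1) open_domain by (auto simp: frontier_def interior_open)
  then have "x islimpt \<Omega>" by (simp add: closure_def)
  then have nt: "at x within \<Omega> \<noteq> bot" by (simp add: trivial_limit_within)
  have "((\<lambda>y. G (y, t)) \<longlongrightarrow> G (x, t)) (at x within \<Omega>)"
    by (rule tendsto_slice[OF G])
  moreover have "eventually (\<lambda>y. G (y, t) = u y t) (at x within \<Omega>)"
    unfolding eventually_at using r u by (intro exI[of _ r]) (auto simp: dist_commute subset_iff)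
  ultimately have "((\<lambda>y. u y t) \<longlongrightarrow> G (x, t)) (at x within \<Omega>)"
    by (rule Lim_transform_eventually)
  then show ?thesis unfolding inner_trace_def interior_open[OF open_domain] by (rule tendsto_Lim[OF nt])
qed

lemma closed_frontier_in_borel [measurable]: "frontier (S :: (real^3) set) \<in> sets borel"
  by (simp add: borel_closed)

lemma area_frontier_element:
  assumes K: "K \<in> \<K>"
  shows "emeasure polyhedral_area (frontier K) < \<infinity>"
proof -
  have bK: "bounded K" "K \<in> sets borel" using compact_element[OF K] by (auto simp: compact_imp_bounded borel_compact)
  have "emeasure polyhedral_area (K \<inter> bounding_plane j) < \<infinity>" if j: "j \<in> faces K" for j
  proof -
    have P: "is_plane (bounding_plane j)" by (rule is_plane_bounding_plane[OF norm_face[OF K j]])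
    have B: "K \<inter> bounding_plane j \<in> sets borel" using bK is_plane_closed[OF P] by (auto simp: borel_closed)
    have "bounded (K \<inter> bounding_plane j)" using bK by blast
    then show ?thesis
      using emeasure_polyhedral_area_plane[OF P _ B] emeasure_plane_area_bounded[OF P _ B] by simp
  qed
  moreover have "emeasure polyhedral_area (frontier K) \<le> (\<Sum>j\<in>faces K. emeasure polyhedral_area (K \<inter> bounding_plane j))"
  proof -
    have "frontier K = (\<Union>j\<in>faces K. K \<inter> bounding_plane j)" using frontier_element[OF K] by auto
    moreover have "K \<inter> bounding_plane j \<in> sets borel" if "j \<in> faces K" for j
      using bK is_plane_closed[OF is_plane_bounding_plane[OF norm_face[OF K that]]] by (auto simp: borel_closed)
    then have "(\<lambda>j. K \<inter> bounding_plane j) ` faces K \<subseteq> sets polyhedral_area"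
      by (intro image_subsetI) (simp only: sets_polyhedral_area)
    from emeasure_subadditive_finite[OF finite_faces[OF K] this] calculation show ?thesis by simp
  qed
  ultimately show ?thesis
    by (rule_tac le_less_trans) (auto simp: finite_faces[OF K] less_top[symmetric])
qed

lemma area_frontier_domain: "emeasure polyhedral_area (frontier \<Omega>) < \<infinity>"
proof -
  have "emeasure polyhedral_area (frontier \<Omega>) \<le> emeasure polyhedral_area (\<Union>K\<in>\<K>. frontier K)"
    using frontier_domain_subset finite_mesh by (intro emeasure_mono) auto
  also have "\<dots> \<le> (\<Sum>K\<in>\<K>. emeasure polyhedral_area (frontier K))"
    using finite_mesh by (intro emeasure_subadditive_finite) auto
  also have "\<dots> < \<infinity>" using area_frontier_element finite_mesh by (auto simp: less_top[symmetric])
  finally show ?thesis .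
qed

text \<open>A representative of the outward normal that is visibly Borel, unlike a pointwise
  definite description. On the frontier off the edges exactly one summand survives; on an edge the
  normals simply add up.\<close>

definition normal_field :: "(real^3) set \<Rightarrow> real^3 \<Rightarrow> real^3" where
  "normal_field K x = (\<Sum>j\<in>faces K. indicator (bounding_plane j) x *\<^sub>R fst j)"

lemma normal_field_eq:
  assumes K: "K \<in> \<K>" "x \<in> frontier K" and x: "x \<notin> edge_set"
  shows "normal_field K x = outward_normal K x"
proof -
  obtain j where j: "j \<in> faces K" "x \<in> K" "x \<in> bounding_plane j" by (rule frontier_face[OF K])
  have uniq: "i = j" if "i \<in> faces K" "x \<in> bounding_plane i" for i
    using face_unique[OF K(1) j(1,3) x K(1) that] inj_on_faces[OF K(1)] that j by (auto simp: inj_on_def)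
  have "normal_field K x = indicator (bounding_plane j) x *\<^sub>R fst j"
    unfolding normal_field_def
  proof (rule sum_single[OF finite_faces[OF K(1)] j(1)])
    fix i assume "i \<in> faces K" "i \<noteq> j"
    then have "x \<notin> bounding_plane i" using uniq by blast
    then show "indicator (bounding_plane i) x *\<^sub>R fst i = 0" by simp
  qed
  then show ?thesis using outward_normal_element[OF K(1) j x] j(3) by simp
qed

lemma norm_outward_normal_element:
  assumes K: "K \<in> \<K>" "x \<in> frontier K" and x: "x \<notin> edge_set"
  shows "norm (outward_normal K x) = 1"
proof -
  obtain j where j: "j \<in> faces K" "x \<in> K" "x \<in> bounding_plane j" by (rule frontier_face[OF K])
  then show ?thesis using outward_normal_element[OF K(1) j x] norm_face[OF K(1)] by simp
qed

lemma bounding_plane_borel: "K \<in> \<K> \<Longrightarrow> j \<in> faces K \<Longrightarrow> bounding_plane j \<in> sets borel"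
  using is_plane_closed[OF is_plane_bounding_plane[OF norm_face]] by (simp add: borel_closed)

lemma bdd_borel_on_normal_field:
  assumes "K \<in> \<K>"
  shows "bdd_borel_on S (\<lambda>z :: (real^3) \<times> real. normal_field K (fst z))"
  unfolding normal_field_def
  by (intro bdd_borel_on_sum bdd_borel_on_scaleR bdd_borel_on_indicator_fst bdd_borel_on_const bounding_plane_borel[OF assms])

end

definition triple :: "real^3 \<Rightarrow> real^3 \<Rightarrow> real^3 \<Rightarrow> real" where
  "triple n u v = n \<bullet> cross3 u v"

text \<open>On a face the surface integrand of \<open>dg_B\<close>, tested with the solution itself, is the
  Poynting flux of the element with reversed sign plus, on \<open>\<partial>\<Omega>\<close>, the dissipation \<open>\<beta> |n \<times> H|\<^sup>2\<close>, and
  elsewhere a term which changes its sign when the two elements are interchanged.\<close>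

lemma flux_interior_algebra:
  "cross3 n (HK - (1/2) *\<^sub>R (HK + HL)) \<bullet> EK - (cross3 n EK - cross3 n ((1/2) *\<^sub>R (EK + EL))) \<bullet> HK
    = - triple n EK HK + 1/2 * (triple n EK HL + triple n EL HK)"
  by (simp add: triple_def cross3_def inner_vec_def sum_3 algebra_simps)

lemma flux_boundary_algebra:
  assumes "norm n = 1"
  shows "cross3 n (HK - HK) \<bullet> EK - (cross3 n EK - \<beta> *\<^sub>R cross3 n (cross3 HK n)) \<bullet> HK
    = - triple n EK HK + \<beta> * (norm (cross3 n HK))\<^sup>2"
proof -
  have "cross3 n (cross3 HK n) \<bullet> HK = cross3 n HK \<bullet> cross3 n HK"
    by (simp add: cross3_def inner_vec_def sum_3 algebra_simps)
  then show ?thesis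
    by (simp add: triple_def inner_diff_left power2_norm_eq_inner)
       (simp add: cross3_def inner_vec_def sum_3 algebra_simps)
qed

section \<open>One slab, with the discrete fields given by smooth extensions on each element\<close>

locale smooth_slab = polyhedral_mesh +
  fixes \<beta> a b :: real and E H :: field and GE GH :: "(real^3) set \<Rightarrow> (real^3) \<times> real \<Rightarrow> real^3"
  assumes ab: "a < b"
    and GE: "\<And>K. K \<in> \<K> \<Longrightarrow> smooth (GE K)" and GH: "\<And>K. K \<in> \<K> \<Longrightarrow> smooth (GH K)"
    and E: "\<And>K x t. K \<in> \<K> \<Longrightarrow> x \<in> interior K \<Longrightarrow> t \<in> {a..b} \<Longrightarrow> E x t = GE K (x, t)"
    and H: "\<And>K x t. K \<in> \<K> \<Longrightarrow> x \<in> interior K \<Longrightarrow> t \<in> {a..b} \<Longrightarrow> H x t = GH K (x, t)"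
begin

lemma traces:
  assumes "K \<in> \<K>" "x \<in> K" "t \<in> {a..b}"
  shows "inner_trace K E x t = GE K (x, t)" "inner_trace K H x t = GH K (x, t)"
  using assms by (auto intro!: inner_trace_element smooth_continuous GE GH E H)

definition surface_integrand :: "(real^3) set \<Rightarrow> field \<Rightarrow> field \<Rightarrow> real^3 \<Rightarrow> real \<Rightarrow> real" where
  "surface_integrand K v w x t =
    cross3 (outward_normal K x) (inner_trace K H x t - H_flux \<Omega> \<K> K H x t) \<bullet> inner_trace K v x t
    - (cross3 (outward_normal K x) (inner_trace K E x t) - nE_flux \<Omega> \<K> \<beta> K E H x t) \<bullet> inner_trace K w x t"

definition poynting :: "(real^3) set \<Rightarrow> (real^3) \<times> real \<Rightarrow> real" where
  "poynting K z = triple (normal_field K (fst z)) (GE K z) (GH K z)"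

definition dissipation :: "(real^3) set \<Rightarrow> (real^3) \<times> real \<Rightarrow> real" where
  "dissipation K z = \<beta> * (norm (cross3 (normal_field K (fst z)) (GH K z)))\<^sup>2"

definition exchange :: "(real^3) set \<Rightarrow> (real^3) set \<Rightarrow> (real^3) \<times> real \<Rightarrow> real" where
  "exchange K L z = 1/2 * (triple (normal_field K (fst z)) (GE K z) (GH L z) + triple (normal_field K (fst z)) (GE L z) (GH K z))"

text \<open>Summing over all other elements with indicators avoids the description
  \<open>neighbour\<close> and keeps the function Borel. Off the edges at most one summand is active
  on \<open>frontier K\<close>, and none on the boundary of the domain.\<close>

definition surface_term :: "(real^3) set \<Rightarrow> (real^3) \<times> real \<Rightarrow> real" where
  "surface_term K z = - poynting K z + indicator (frontier \<Omega>) (fst z) * dissipation K z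
     + (\<Sum>L\<in>\<K> - {K}. indicator (frontier L) (fst z) * exchange K L z)"

lemma surface_integrand_eq:
  assumes K: "K \<in> \<K>" "x \<in> frontier K" and x: "x \<notin> edge_set" and t: "t \<in> {a..b}"
  shows "surface_integrand K E H x t = surface_term K (x, t)"
proof -
  note xK = frontier_elementD[OF K]
  note tr = traces[OF K(1) xK t]
  have n: "normal_field K x = outward_normal K x" by (rule normal_field_eq[OF K x])
  have n1: "norm (outward_normal K x) = 1" by (rule norm_outward_normal_element[OF K x])
  show ?thesis
  proof (cases "x \<in> frontier \<Omega>")
    case True
    have "x \<notin> frontier L" if "L \<in> \<K> - {K}" for L
      using boundary_point_one_element[OF True x K(1) xK, of L] frontier_elementD[of L x] that by blast
    then have "(\<Sum>L\<in>\<K> - {K}. indicator (frontier L) (fst (x, t)) * exchange K L (x, t)) = 0"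
      by (intro sum.neutral) auto
    then show ?thesis
      using flux_boundary_algebra[OF n1, of "GH K (x, t)" "GE K (x, t)" \<beta>] True
      by (simp add: surface_integrand_def surface_term_def H_flux_def nE_flux_def Let_def tr n poynting_def dissipation_def)
  next
    case False
    obtain L where L: "L \<in> \<K>" "L \<noteq> K" "x \<in> frontier L" using interior_face_neighbour[OF K x False] by blast
    have nb: "neighbour \<K> K x = L" by (rule neighbour_eq[OF K L x])
    note trL = traces[OF L(1) frontier_elementD[OF L(1,3)] t]
    have uniq: "M = L" if "M \<in> \<K> - {K}" "x \<in> frontier M" for M
      using at_most_two_elements[OF K(1), of M L x] that L frontier_elementD xK x by blast
    have "(\<Sum>M\<in>\<K> - {K}. indicator (frontier M) x * exchange K M (x, t)) = indicator (frontier L) x * exchange K L (x, t)"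
    proof (rule sum_single)
      fix M assume "M \<in> \<K> - {K}" "M \<noteq> L"
      then have "x \<notin> frontier M" using uniq by blast
      then show "indicator (frontier M) x * exchange K M (x, t) = 0" by simp
    qed (use L finite_mesh in auto)
    then have s: "(\<Sum>M\<in>\<K> - {K}. indicator (frontier M) x * exchange K M (x, t)) = exchange K L (x, t)"
      using L(3) by simp
    have st: "surface_term K (x, t) = - poynting K (x, t) + exchange K L (x, t)"
      using s False by (simp add: surface_term_def)
    show ?thesis unfolding st
      using flux_interior_algebra[of "outward_normal K x" "GH K (x, t)" "GH L (x, t)" "GE K (x, t)" "GE L (x, t)"] False
      by (simp add: surface_integrand_def H_flux_def nE_flux_def Let_def average_def tr trL nb n
          poynting_def exchange_def)
  qed
qed

lemma bdd_smooth:
  assumes "K \<in> \<K>" "bounded S"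
  shows "bdd_borel_on S (GE K)" "bdd_borel_on S (GH K)"
  using assms by (auto intro!: bdd_borel_on_subset[OF bdd_borel_on_continuous[OF smooth_continuous], of _ "closure S"] GE GH closure_subset)

lemma bdd_terms:
  assumes K: "K \<in> \<K>" and S: "bounded S"
  shows "bdd_borel_on S (poynting K)" "bdd_borel_on S (dissipation K)"
    "L \<in> \<K> \<Longrightarrow> bdd_borel_on S (exchange K L)" "bdd_borel_on S (surface_term K)"
proof -
  note i = bdd_borel_on_normal_field bdd_borel_on_inner bdd_borel_on_cross3 bdd_borel_on_mult bdd_borel_on_add
    bdd_borel_on_const bdd_smooth bdd_borel_on_sum bdd_borel_on_indicator_fst
  show 1: "bdd_borel_on S (poynting K)" unfolding poynting_def[abs_def] triple_def by (intro i K S)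
  show 2: "bdd_borel_on S (dissipation K)" unfolding dissipation_def[abs_def] power2_norm_eq_inner by (intro i K S)
  show 3: "bdd_borel_on S (exchange K L)" if "L \<in> \<K>" for L unfolding exchange_def[abs_def] triple_def by (intro i K S that)
  have "bdd_borel_on S (\<lambda>z. (- 1) * poynting K z + indicator (frontier \<Omega>) (fst z) * dissipation K z
     + (\<Sum>L\<in>\<K> - {K}. indicator (frontier L) (fst z) * exchange K L z))"
    by (intro i 1 2 3) auto
  then show "bdd_borel_on S (surface_term K)" unfolding surface_term_def[abs_def] by simp
qed


lemma integrable_slice:
  fixes g :: "(real^3) \<times> real \<Rightarrow> real"
  assumes "A \<in> sets borel" "bounded A" "emeasure polyhedral_area A < \<infinity>"
    and "\<And>S. bounded S \<Longrightarrow> bdd_borel_on S g"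
  shows "integrable polyhedral_area (\<lambda>x. indicator A x * g (x, t))"
proof -
  have b: "bdd_borel_on (A \<times> {t}) g" by (rule assms(4)) (simp add: bounded_Times assms(2))
  obtain C where "\<And>z. z \<in> A \<times> {t} \<Longrightarrow> norm (g z) \<le> C" using bdd_borel_onD(2)[OF b] by metis
  moreover have "(\<lambda>x. g (x, t)) \<in> borel_measurable borel"
    by (rule borel_measurable_slice[OF bdd_borel_onD(1)[OF b]])
  ultimately have "bdd_borel_on A (\<lambda>x. g (x, t))" by (intro bdd_borel_onI[of _ _ C]) auto
  then show ?thesis using assms by (intro integrable_bdd_borel_on) auto
qed

lemma bounded_frontier_element: "K \<in> \<K> \<Longrightarrow> bounded (frontier K)"
  using compact_element compact_imp_bounded compact_frontier by blast

lemma integrable_frontier: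
  fixes g :: "(real^3) \<times> real \<Rightarrow> real"
  assumes "K \<in> \<K>" "\<And>S. bounded S \<Longrightarrow> bdd_borel_on S g"
  shows "integrable polyhedral_area (\<lambda>x. indicator (frontier K) x * g (x, t))"
  using assms by (intro integrable_slice area_frontier_element bounded_frontier_element) auto

lemma integrable_frontier2:
  fixes g :: "(real^3) \<times> real \<Rightarrow> real"
  assumes "K \<in> \<K>" "\<And>S. bounded S \<Longrightarrow> bdd_borel_on S g" "B \<in> sets borel"
  shows "integrable polyhedral_area (\<lambda>x. indicator (frontier K) x * (indicator B x * g (x, t)))"
proof -
  have "integrable polyhedral_area (\<lambda>x. indicator (frontier K) x * (\<lambda>z. indicator B (fst z) * g z) (x, t))"
    by (rule integrable_frontier[OF assms(1)]) (rule bdd_borel_on_mult, rule bdd_borel_on_indicator_fst, rule assms(3), erule assms(2))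
  then show ?thesis by simp
qed

lemma integral_poynting:
  assumes K: "K \<in> \<K>"
  shows "(LINT x|polyhedral_area. indicator (frontier K) x * poynting K (x, t))
    = (LINT x|lborel. indicator K x * (spatial_curl (GE K) (x, t) \<bullet> GH K (x, t) - spatial_curl (GH K) (x, t) \<bullet> GE K (x, t)))"
proof -
  let ?B = "\<lambda>j x. indicator (K \<inter> bounding_plane j) x * (fst j \<bullet> cross3 (GE K (x, t)) (GH K (x, t)))"
  let ?A = "\<lambda>j. LINT x|plane_area (bounding_plane j). indicator K x * (fst j \<bullet> cross3 (GE K (x, t)) (GH K (x, t)))"
  let ?w = "\<lambda>x. cross3 (GE K (x, t)) (GH K (x, t))"
  have bK: "bounded K" "K \<in> sets borel" using compact_element[OF K] by (auto simp: compact_imp_bounded borel_compact)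
  have P: "is_plane (bounding_plane j)" if "j \<in> faces K" for j
    by (rule is_plane_bounding_plane[OF norm_face[OF K that]])
  have B: "K \<inter> bounding_plane j \<in> sets borel" if "j \<in> faces K" for j
    using bK bounding_plane_borel[OF K that] by auto
  have sub: "K \<inter> bounding_plane j \<subseteq> frontier K" if "j \<in> faces K" for j
    using frontier_element[OF K] that by blast
  have bw: "bdd_borel_on S (\<lambda>z. c \<bullet> cross3 (GE K z) (GH K z))" if "bounded S" for S c
    by (intro bdd_borel_on_inner bdd_borel_on_cross3 bdd_borel_on_const bdd_smooth K that)
  have wm: "(\<lambda>x. c \<bullet> ?w x) \<in> borel_measurable borel" for c
    using borel_measurable_slice[OF bdd_borel_onD(1)[OF bw[of "{}" c]]] by simp
  have area: "?A j
      = (LINT x|polyhedral_area. ?B j x)" if j: "j \<in> faces K" for j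
  proof -
    have "?A j
      = (LINT x|plane_area (bounding_plane j). ?B j x)"
    proof (rule integral_cong_AE)
      have ms: "borel_measurable (plane_area (bounding_plane j)) = (borel_measurable borel :: (real^3 \<Rightarrow> real) set)"
        by (rule measurable_cong_sets) simp_all
      show "(\<lambda>x. indicator K x * (fst j \<bullet> ?w x)) \<in> borel_measurable (plane_area (bounding_plane j))"
        "(?B j) \<in> borel_measurable (plane_area (bounding_plane j))"
        unfolding ms using bK B[OF j] wm by (auto intro!: borel_measurable_times borel_measurable_indicator)
      show "AE x in plane_area (bounding_plane j). indicator K x * (fst j \<bullet> ?w x) = ?B j x"
        using AE_plane_area[OF P[OF j]] by eventually_elim (simp add: indicator_def)
    qed
    also have "\<dots> = (LINT x|polyhedral_area. ?B j x)"
      by (rule integral_polyhedral_area_plane[symmetric, OF P[OF j] _ B[OF j]]) simp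
    finally show ?thesis .
  qed
  have int: "integrable polyhedral_area (?B j)" if j: "j \<in> faces K" for j
  proof (rule integrable_slice[OF B[OF j] _ _ bw])
    show "bounded (K \<inter> bounding_plane j)" using bK by blast
    show "emeasure polyhedral_area (K \<inter> bounding_plane j) < \<infinity>"
      using emeasure_mono[OF sub[OF j], of polyhedral_area] area_frontier_element[OF K] by (auto intro: le_less_trans)
  qed
  have "(LINT x|lborel. indicator K x * (spatial_curl (GE K) (x, t) \<bullet> GH K (x, t) - spatial_curl (GH K) (x, t) \<bullet> GE K (x, t)))
    = (\<Sum>j\<in>faces K. ?A j)"
    using integral_curl_polytope[OF finite_faces[OF K] norm_face[OF K] inj_on_faces[OF K] _ GE[OF K] GH[OF K], of t] bK
    by (simp add: halfspaces_faces[OF K])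
  also have "\<dots> = (\<Sum>j\<in>faces K. LINT x|polyhedral_area. ?B j x)"
    by (intro sum.cong refl area)
  also have "\<dots> = (LINT x|polyhedral_area. (\<Sum>j\<in>faces K. ?B j x))"
    using int by (subst Bochner_Integration.integral_sum) auto
  also have "\<dots> = (LINT x|polyhedral_area. indicator (frontier K) x * poynting K (x, t))"
  proof (rule Bochner_Integration.integral_cong[OF refl])
    fix x
    have "indicator (K \<inter> bounding_plane j) x = (indicator (frontier K) x * indicator (bounding_plane j) x :: real)" if "j \<in> faces K" for j
      using sub[OF that] closed_element[OF K] frontier_subset_closed[of K] by (auto simp: indicator_def)
    then have "(\<Sum>j\<in>faces K. ?B j x)
      = (\<Sum>j\<in>faces K. indicator (frontier K) x * (indicator (bounding_plane j) x * (fst j \<bullet> ?w x)))"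
      by (intro sum.cong) auto
    \<comment> \<open>This holds at every point: on an edge \<open>normal_field\<close> adds the
      same normals as the sum over the faces.\<close>
    also have "\<dots> = indicator (frontier K) x * poynting K (x, t)"
      by (simp add: poynting_def triple_def normal_field_def inner_sum_left sum_distrib_left)
    finally show "(\<Sum>j\<in>faces K. ?B j x) = indicator (frontier K) x * poynting K (x, t)" .
  qed
  finally show ?thesis by simp
qed

definition exchanged_energy :: "real \<Rightarrow> (real^3) set \<Rightarrow> (real^3) set \<Rightarrow> real" where
  "exchanged_energy t K L = (LINT x|polyhedral_area. indicator (frontier K) x * (indicator (frontier L) x * exchange K L (x, t)))"

text \<open>Apart from the normal, \<open>exchange\<close> is symmetric in the two elements, and off
  the edges the normals are opposite.\<close>

lemma exchanged_energy_antisym: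
  assumes K: "K \<in> \<K>" and L: "L \<in> \<K>" and ne: "K \<noteq> L"
  shows "exchanged_energy t L K = - exchanged_energy t K L"
proof -
  let ?X = "\<lambda>K L x. indicator (frontier K) x * (indicator (frontier L) x * exchange K L (x, t))"
  have i: "integrable polyhedral_area (?X K L)"
    if "K \<in> \<K>" "L \<in> \<K>" for K L
    using that by (intro integrable_frontier2 bdd_terms) auto
  have "exchanged_energy t L K = (LINT x|polyhedral_area. - (?X K L x))"
    unfolding exchanged_energy_def
  proof (rule integral_cong_AE)
    show "AE x in polyhedral_area. ?X L K x
        = - (?X K L x)"
      using AE_not_in[OF edge_set_null]
    proof eventually_elim
      case (elim x)
      show ?case
      proof (cases "x \<in> frontier K \<and> x \<in> frontier L")
        case True
        then have "normal_field L x = - normal_field K x"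
          using outward_normal_neighbour[OF K _ L _ elim ne] normal_field_eq K L elim by simp
        then show ?thesis using True by (simp add: exchange_def triple_def field_simps)
      qed (auto simp: indicator_def)
    qed
  qed (use i K L in \<open>auto intro!: borel_measurable_integrable\<close>)
  then show ?thesis by (simp add: exchanged_energy_def)
qed

text \<open>A sum of an antisymmetric quantity over ordered pairs equals its own negative.\<close>

lemma exchanged_energy_sum: "(\<Sum>K\<in>\<K>. \<Sum>L\<in>\<K> - {K}. exchanged_energy t K L) = 0"
proof -
  let ?g = "\<lambda>K L. if L = K then 0 else exchanged_energy t K L"
  have "(\<Sum>L\<in>\<K> - {K}. exchanged_energy t K L) = (\<Sum>L\<in>\<K>. ?g K L)" if "K \<in> \<K>" for K
    using finite_mesh by (intro sum.mono_neutral_cong_left) auto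
  then have eq: "(\<Sum>K\<in>\<K>. \<Sum>L\<in>\<K> - {K}. exchanged_energy t K L) = (\<Sum>K\<in>\<K>. \<Sum>L\<in>\<K>. ?g K L)" by simp
  have "(\<Sum>K\<in>\<K>. \<Sum>L\<in>\<K>. ?g K L) = (\<Sum>K\<in>\<K>. \<Sum>L\<in>\<K>. ?g L K)" by (rule sum.swap)
  also have "\<dots> = (\<Sum>K\<in>\<K>. \<Sum>L\<in>\<K>. - ?g K L)"
  proof (intro sum.cong refl)
    fix K L assume "K \<in> \<K>" "L \<in> \<K>"
    then show "?g L K = - ?g K L"
      using exchanged_energy_antisym[of K L t] by (cases "K = L") simp_all
  qed
  also have "\<dots> = - (\<Sum>K\<in>\<K>. \<Sum>L\<in>\<K>. ?g K L)" by (simp add: sum_negf)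
  finally show ?thesis unfolding eq by simp
qed

text \<open>The element at a boundary point is not named: the sum over all elements is Borel, and
  off the edges only one summand is active on the boundary of the domain.\<close>

definition boundary_dissipation :: "(real^3) \<times> real \<Rightarrow> real" where
  "boundary_dissipation z = (\<Sum>K\<in>\<K>. indicator (frontier K) (fst z) * dissipation K z)"

text \<open>At fixed time the Poynting parts cancel the curl integrals by the divergence theorem,
  and the exchange parts cancel in pairs, so only the dissipation is left.\<close>

lemma surface_balance:
  "(\<Sum>K\<in>\<K>. LINT x|polyhedral_area. indicator (frontier K) x * surface_term K (x, t))
   + (\<Sum>K\<in>\<K>. LINT x|lborel. indicator K x * (spatial_curl (GE K) (x, t) \<bullet> GH K (x, t) - spatial_curl (GH K) (x, t) \<bullet> GE K (x, t)))
   = (LINT x|polyhedral_area. indicator (frontier \<Omega>) x * boundary_dissipation (x, t))"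
proof -
  let ?X = "\<lambda>K L x. indicator (frontier K) x * (indicator (frontier L) x * exchange K L (x, t))"
  let ?P = "\<lambda>K x. indicator (frontier K) x * poynting K (x, t)"
  let ?S = "\<lambda>K. LINT x|polyhedral_area. indicator (frontier K) x * surface_term K (x, t)"
  let ?I = "\<lambda>f. LINT x|polyhedral_area. f x"
  let ?D = "\<lambda>K x. indicator (frontier K) x * (indicator (frontier \<Omega>) x * dissipation K (x, t))"
  have iD: "integrable polyhedral_area (?D K)" if "K \<in> \<K>" for K
    using that by (intro integrable_frontier2 bdd_terms) auto
  have iP: "integrable polyhedral_area (?P K)" if "K \<in> \<K>" for K
    using that by (intro integrable_frontier bdd_terms) auto
  have iX: "integrable polyhedral_area (?X K L)"
    if "K \<in> \<K>" "L \<in> \<K>" for K L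
    using that by (intro integrable_frontier2 bdd_terms) auto
  have "?S K
    = - ?I (?P K) + ?I (?D K)
      + (\<Sum>L\<in>\<K> - {K}. exchanged_energy t K L)" if K: "K \<in> \<K>" for K
  proof -
    have "?S K
      = (LINT x|polyhedral_area. - (?P K x) + ?D K x
          + (\<Sum>L\<in>\<K> - {K}. ?X K L x))"
      by (intro Bochner_Integration.integral_cong refl)
         (simp add: surface_term_def distrib_left right_diff_distrib sum_distrib_left)
    also have "\<dots> = - ?I (?P K) + ?I (?D K)
      + (\<Sum>L\<in>\<K> - {K}. ?I (?X K L))"
    proof -
      have "integrable polyhedral_area (\<lambda>x. \<Sum>L\<in>\<K> - {K}. ?X K L x)"
        using iX[OF K] by (intro Bochner_Integration.integrable_sum) auto
      moreover have "(LINT x|polyhedral_area. (\<Sum>L\<in>\<K> - {K}. ?X K L x))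
        = (\<Sum>L\<in>\<K> - {K}. ?I (?X K L))"
        using iX[OF K] by (intro Bochner_Integration.integral_sum) auto
      ultimately show ?thesis
        using iD[OF K] iP[OF K] by simp
    qed
    finally show ?thesis unfolding exchanged_energy_def .
  qed
  then have "(\<Sum>K\<in>\<K>. ?S K)
    = - (\<Sum>K\<in>\<K>. ?I (?P K))
      + (\<Sum>K\<in>\<K>. ?I (?D K))"
    by (simp add: sum.distrib sum_subtractf exchanged_energy_sum)
  moreover have "(\<Sum>K\<in>\<K>. ?I (?D K)) = (LINT x|polyhedral_area. (\<Sum>K\<in>\<K>. ?D K x))"
    using iD by (subst Bochner_Integration.integral_sum) auto
  moreover have "(LINT x|polyhedral_area. (\<Sum>K\<in>\<K>. ?D K x)) = (LINT x|polyhedral_area. indicator (frontier \<Omega>) x * boundary_dissipation (x, t))"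
    by (intro Bochner_Integration.integral_cong refl)
       (simp add: boundary_dissipation_def sum_distrib_left mult.left_commute)
  ultimately show ?thesis using integral_poynting by simp
qed

end

subsection \<open>Integrability of the boundary excitation\<close>

text \<open>The data live over the open interval up to \<open>T\<close>, the scheme over a closed
  slab. Both become restrictions of one product measure over all times, between which functions can
  be moved.\<close>

lemma pair_measure_restrict_space_snd:
  assumes "sigma_finite_measure M" "sigma_finite_measure N" and I: "I \<in> sets N"
  shows "M \<Otimes>\<^sub>M restrict_space N I = restrict_space (M \<Otimes>\<^sub>M N) (space M \<times> I)"
proof (rule pair_measure_eqI[OF assms(1)])
  interpret M: sigma_finite_measure M by fact
  interpret N: sigma_finite_measure N by fact
  show "sigma_finite_measure (restrict_space N I)"
    by (rule sigma_finite_measure_restrict_space[OF assms(2) I])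
  have MI: "space M \<times> I \<in> sets (M \<Otimes>\<^sub>M N)" using I by auto
  have IN: "I \<subseteq> space N" using I by (rule sets.sets_into_space)
  show "sets (M \<Otimes>\<^sub>M restrict_space N I) = sets (restrict_space (M \<Otimes>\<^sub>M N) (space M \<times> I))"
  proof (intro equalityI subsetI)
    fix X assume X: "X \<in> sets (M \<Otimes>\<^sub>M restrict_space N I)"
    have "(\<lambda>z. (fst z, snd z)) \<in> measurable (restrict_space (M \<Otimes>\<^sub>M N) (space M \<times> I)) (M \<Otimes>\<^sub>M restrict_space N I)"
      by (intro measurable_Pair measurable_restrict_space2 measurable_restrict_space1 measurable_fst measurable_snd)
         (auto simp: space_restrict_space)
    from measurable_sets[OF this X]
    have "X \<inter> space (restrict_space (M \<Otimes>\<^sub>M N) (space M \<times> I)) \<in> sets (restrict_space (M \<Otimes>\<^sub>M N) (space M \<times> I))"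
      by (simp add: vimage_def)
    moreover have "X \<subseteq> space (restrict_space (M \<Otimes>\<^sub>M N) (space M \<times> I))"
      using sets.sets_into_space[OF X] MI IN by (auto simp: space_pair_measure space_restrict_space)
    ultimately show "X \<in> sets (restrict_space (M \<Otimes>\<^sub>M N) (space M \<times> I))" by (simp add: Int_absorb2)
  next
    fix X assume X: "X \<in> sets (restrict_space (M \<Otimes>\<^sub>M N) (space M \<times> I))"
    have "(\<lambda>z. (fst z, snd z)) \<in> measurable (M \<Otimes>\<^sub>M restrict_space N I) (M \<Otimes>\<^sub>M N)"
      by (intro measurable_Pair measurable_fst measurable_compose[OF measurable_snd])
         (auto intro: measurable_restrict_space1)
    then have "(\<lambda>z. z) \<in> measurable (M \<Otimes>\<^sub>M restrict_space N I) (restrict_space (M \<Otimes>\<^sub>M N) (space M \<times> I))"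
      using IN by (intro measurable_restrict_space2) (auto simp: space_pair_measure space_restrict_space)
    from measurable_sets[OF this X] have "X \<inter> space (M \<Otimes>\<^sub>M restrict_space N I) \<in> sets (M \<Otimes>\<^sub>M restrict_space N I)"
      by simp
    moreover have "X \<subseteq> space (M \<Otimes>\<^sub>M restrict_space N I)"
      using sets.sets_into_space[OF X] MI IN by (auto simp: space_pair_measure space_restrict_space)
    ultimately show "X \<in> sets (M \<Otimes>\<^sub>M restrict_space N I)" by (simp add: Int_absorb2)
  qed
  fix A B assume A: "A \<in> sets M" and B: "B \<in> sets (restrict_space N I)"
  then have B': "B \<in> sets N" "B \<subseteq> I" using I by (auto simp: sets_restrict_space_iff)
  have "A \<times> B \<subseteq> space M \<times> I" using sets.sets_into_space[OF A] B' by auto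
  then show "emeasure M A * emeasure (restrict_space N I) B = emeasure (restrict_space (M \<Otimes>\<^sub>M N) (space M \<times> I)) (A \<times> B)"
    using MI A B' I by (simp add: emeasure_restrict_space N.emeasure_pair_measure_Times)
qed

lemma completion_ex_borel_measurable_vec:
  fixes g :: "'a \<Rightarrow> real^'n"
  assumes g: "g \<in> borel_measurable (completion M)"
  shows "\<exists>g'\<in>borel_measurable M. AE x in M. g x = g' x"
proof -
  have "\<exists>g'\<in>borel_measurable M. AE x in M. g x $ i = g' x" for i
    using g by (intro completion_ex_borel_measurable_real) simp
  then obtain c where c: "\<And>i. c i \<in> borel_measurable M" "\<And>i. AE x in M. g x $ i = c i x" by metis
  let ?g = "\<lambda>x. \<Sum>i\<in>UNIV. c i x *\<^sub>R (axis i 1 :: real^'n)"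
  have "AE x in M. \<forall>i\<in>UNIV. g x $ i = c i x" using c(2) by (intro AE_finite_allI) auto
  then have "AE x in M. g x = ?g x"
  proof eventually_elim
    case (elim x)
    have "?g x $ k = c k x" for k
      by (simp add: axis_def if_distrib[of "\<lambda>y. c _ x * y"] cong: if_cong)
    then show ?case using elim by (simp add: vec_eq_iff)
  qed
  moreover have "?g \<in> borel_measurable M" using c(1) by simp
  ultimately show ?thesis by (intro bexI)
qed

text \<open>The data \<open>g\<close> are only known on the open time interval; the end points of the slab form a null set.\<close>

lemma integrable_surface_time_product:
  fixes g :: field and h' :: "(real^3) \<times> real \<Rightarrow> real^3"
  assumes A: "A \<in> sets borel" "emeasure polyhedral_area A < \<infinity>" and ab: "{a..b} \<subseteq> {0..T}"
    and g: "square_integrable (surface_time_measure A {0<..<T}) (\<lambda>(x, s). g x s)"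
    and N: "N \<in> null_sets polyhedral_area" and h': "bdd_borel_on (A \<times> {a..b}) h'"
    and F: "\<And>x t. x \<in> A - N \<Longrightarrow> t \<in> {a..b} \<Longrightarrow> F x t = g x t \<bullet> h' (x, t)"
  shows "integrable (surface_time_measure A {a..b}) (\<lambda>(x, t). F x t)"
proof -
  let ?M = "restrict_space polyhedral_area A"
  interpret M: finite_measure ?M
    by (rule finite_measure_restrict_area[OF A])
  interpret Q: pair_sigma_finite ?M lborel ..
  let ?Q = "?M \<Otimes>\<^sub>M lborel"
  have spM: "space ?M = A" using A by (simp add: space_restrict_space)
  have P: "?M \<Otimes>\<^sub>M restrict_space lborel I = restrict_space ?Q (A \<times> I)" if "I \<in> sets borel" for I
    using pair_measure_restrict_space_snd[of ?M lborel I] that spM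
    by (simp add: M.sigma_finite_measure_axioms lborel.sigma_finite_measure_axioms)
  let ?J = "{0<..<T}" and ?I = "{a..b}"
  let ?RJ = "restrict_space ?Q (A \<times> ?J)" and ?RI = "restrict_space ?Q (A \<times> ?I)"
  have meas[simp]: "A \<times> ?J \<in> sets ?Q" "A \<times> ?I \<in> sets ?Q"
    using spM sets.top[of ?M] by (auto simp del: sets.top)
  have intJ: "A \<times> ?J \<inter> space ?Q \<in> sets ?Q" and intI: "A \<times> ?I \<inter> space ?Q \<in> sets ?Q"
    by (intro sets.Int sets.top meas)+
  have stm: "surface_time_measure A ?J = completion ?RJ" "surface_time_measure A ?I = completion ?RI"
    unfolding surface_time_measure_def using P[of ?J] P[of ?I] by auto
  have "(\<lambda>(x, s). g x s) \<in> borel_measurable (completion ?RJ)"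
    and g2: "integrable (completion ?RJ) (\<lambda>z. (norm (case_prod g z))\<^sup>2)"
    using g by (simp_all add: square_integrable_def stm)
  then obtain g0 where g0: "g0 \<in> borel_measurable ?RJ" and ae0: "AE z in ?RJ. case_prod g z = g0 z"
    using completion_ex_borel_measurable_vec by blast
  \<comment> \<open>A Borel version of the data, extended by zero in time, lives on the common
    measure and can be restricted to the slab.\<close>
  define g1 where "g1 z = indicator (A \<times> ?J) z *\<^sub>R g0 z" for z
  have g1m[measurable]: "g1 \<in> borel_measurable ?Q"
    using g0 unfolding g1_def[abs_def] borel_measurable_restrict_space_iff[OF intJ] .
  have ae1: "AE z in ?Q. z \<in> A \<times> ?J \<longrightarrow> case_prod g z = g1 z"
    using ae0[unfolded AE_restrict_space_iff[OF intJ]] by eventually_elim (auto simp: g1_def)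
  have "integrable (completion ?RJ) (\<lambda>z. (norm (g0 z))\<^sup>2)"
  proof (rule integrable_cong_AE_imp[OF g2])
    show "(\<lambda>z. (norm (g0 z))\<^sup>2) \<in> borel_measurable (completion ?RJ)"
      using measurable_completion[OF g0] by measurable
    show "AE z in completion ?RJ. (norm (case_prod g z))\<^sup>2 = (norm (g0 z))\<^sup>2"
      using AE_completion[OF ae0] by eventually_elim simp
  qed
  then have "integrable ?RJ (\<lambda>z. (norm (g0 z))\<^sup>2)" using g0 by (subst (asm) integrable_completion) auto
  then have "integrable ?Q (\<lambda>z. indicator (A \<times> ?J) z *\<^sub>R (norm (g0 z))\<^sup>2)"
    unfolding integrable_restrict_space[OF intJ] .
  moreover have "indicator (A \<times> ?J) z *\<^sub>R (norm (g0 z))\<^sup>2 = (norm (g1 z))\<^sup>2" for z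
    by (simp add: g1_def indicator_def)
  ultimately have "integrable ?Q (\<lambda>z. (norm (g1 z))\<^sup>2)" by simp
  then have "integrable ?Q (\<lambda>z. indicator (A \<times> ?I) z *\<^sub>R (norm (g1 z))\<^sup>2)"
    by (rule integrable_mult_indicator[OF meas(2)])
  then have g1int: "integrable ?RI (\<lambda>z. (norm (g1 z))\<^sup>2)"
    unfolding integrable_restrict_space[OF intI] .
  have emP: "emeasure ?RI (space ?RI) < \<infinity>"
  proof -
    have "emeasure ?RI (space ?RI) = emeasure ?Q (A \<times> ?I)"
      unfolding space_restrict_space using sets.sets_into_space[OF meas(2)]
      by (subst emeasure_restrict_space[OF intI]) (simp_all add: Int_absorb2)
    also have "\<dots> = emeasure ?M A * emeasure lborel ?I"
      using spM sets.top[of ?M] by (intro lborel.emeasure_pair_measure_Times) auto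
    also have "\<dots> < \<infinity>"
      using M.emeasure_finite[of A] emeasure_bounded_finite[of ?I]
      by (simp add: less_top[symmetric] ennreal_mult_eq_top_iff)
    finally show ?thesis .
  qed
  interpret PF: finite_measure ?RI by (rule finite_measureI) (use emP in auto)
  have idm: "(\<lambda>z. z) \<in> measurable ?Q borel"
    by (intro measurable_ident_pair_borel measurable_restrict_space1) simp_all
  have [measurable]: "h' \<in> borel_measurable ?Q"
    using measurable_compose[OF idm bdd_borel_onD(1)[OF h']] by simp
  obtain C where C: "\<And>z. z \<in> A \<times> ?I \<Longrightarrow> norm (h' z) \<le> C" using bdd_borel_onD(2)[OF h'] by metis
  \<comment> \<open>The slab has finite measure and \<open>h'\<close> is bounded, so square
    integrability of \<open>g1\<close> suffices, through
    \<open>norm (g1 z) \<le> 1 + (norm (g1 z))\<^sup>2\<close>.\<close>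
  have gh: "integrable ?RI (\<lambda>z. g1 z \<bullet> h' z)"
  proof (rule Bochner_Integration.integrable_bound)
    show "integrable ?RI (\<lambda>z. \<bar>C\<bar> * (1 + (norm (g1 z))\<^sup>2))"
      using g1int PF.integrable_const[of 1] by (intro integrable_mult_right Bochner_Integration.integrable_add) auto
    show "(\<lambda>z. g1 z \<bullet> h' z) \<in> borel_measurable ?RI" by (rule measurable_restrict_space1) measurable
    show "AE z in ?RI. norm (g1 z \<bullet> h' z) \<le> norm (\<bar>C\<bar> * (1 + (norm (g1 z))\<^sup>2))"
    proof (rule AE_I2)
      fix z assume "z \<in> space ?RI"
      then have z: "z \<in> A \<times> ?I" by (simp add: space_restrict_space)
      have "norm (g1 z \<bullet> h' z) \<le> norm (g1 z) * norm (h' z)" by (simp add: Cauchy_Schwarz_ineq2)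
      also have "\<dots> \<le> (1 + (norm (g1 z))\<^sup>2) * \<bar>C\<bar>"
      proof (rule mult_mono)
        show "norm (g1 z) \<le> 1 + (norm (g1 z))\<^sup>2"
          using zero_le_power2[of "norm (g1 z) - 1"] by (simp add: power2_diff) (smt (verit) zero_le_power2)
        show "norm (h' z) \<le> \<bar>C\<bar>" using C[OF z] by linarith
      qed auto
      finally show "norm (g1 z \<bullet> h' z) \<le> norm (\<bar>C\<bar> * (1 + (norm (g1 z))\<^sup>2))" by (simp add: mult.commute abs_mult)
    qed
  qed
  have AEN: "AE x in ?M. x \<notin> N"
    by (rule AE_restrict_area[OF A(1) N])
  have AE2: "AE z in ?Q. fst z \<notin> N \<and> snd z \<notin> {0, T}"
  proof (rule Q.AE_pair_measure)
    have Nb: "N \<in> sets borel" using N by auto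
    have "{z \<in> space ?Q. fst z \<notin> N \<and> snd z \<notin> {0, T}} = (\<lambda>z. z) -` ((- N) \<times> (- {0, T})) \<inter> space ?Q" by auto
    also have "\<dots> \<in> sets ?Q"
      using Nb by (intro measurable_sets[OF idm]) (auto simp: borel_prod[symmetric])
    finally show "{z \<in> space ?Q. fst z \<notin> N \<and> snd z \<notin> {0, T}} \<in> sets ?Q" .
    have "AE s in lborel. s \<notin> {0, T}" by (intro AE_not_in finite_imp_null_set_lborel) simp
    then show "AE x in ?M. AE y in lborel. fst (x, y) \<notin> N \<and> snd (x, y) \<notin> {0, T}"
      using AEN by (auto elim!: eventually_mono)
  qed
  have "AE z in ?Q. z \<in> A \<times> ?I \<longrightarrow> case_prod F z = g1 z \<bullet> h' z"
    using ae1 AE2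
  proof eventually_elim
    case (elim z)
    show ?case
    proof
      assume z: "z \<in> A \<times> ?I"
      then have "snd z \<in> {0..T}" using ab by auto
      then have "snd z \<in> ?J" using elim by auto
      then have "case_prod g z = g1 z" using elim z by auto
      then show "case_prod F z = g1 z \<bullet> h' z" using F z elim by (auto split: prod.splits)
    qed
  qed
  then have ae: "AE z in ?RI. case_prod F z = g1 z \<bullet> h' z"
    unfolding AE_restrict_space_iff[OF intI] .
  have ghm: "(\<lambda>z. g1 z \<bullet> h' z) \<in> borel_measurable (completion ?RI)"
    by (rule measurable_completion[OF borel_measurable_integrable[OF gh]])
  have "integrable (completion ?RI) (\<lambda>z. g1 z \<bullet> h' z)"
    using gh borel_measurable_integrable[OF gh] by (simp add: integrable_completion)
  then have "integrable (completion ?RI) (\<lambda>(x, t). F x t)"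
  proof (rule integrable_cong_AE_imp)
    show "(\<lambda>(x, t). F x t) \<in> borel_measurable (completion ?RI)"
      by (rule borel_measurable_AE_completion[OF ghm ae]) simp
    show "AE z in completion ?RI. g1 z \<bullet> h' z = case_prod F z"
      using AE_completion[OF ae] by eventually_elim simp
  qed
  then show ?thesis by (simp add: stm)
qed

subsection \<open>Mass terms and time derivatives\<close>

text \<open>On the completion either both functions are measurable or neither is; in the second case
  both integrals have the default value 0.\<close>

lemma completion_cong_AE:
  fixes f g :: "'a \<Rightarrow> real"
  assumes "AE x in M. f x = g x"
  shows "integrable (completion M) f \<longleftrightarrow> integrable (completion M) g"
    and "integral\<^sup>L (completion M) f = integral\<^sup>L (completion M) g"
proof -
  have ae: "AE x in M. g x = f x" using assms by eventually_elim simp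
  have m: "f \<in> borel_measurable (completion M) \<longleftrightarrow> g \<in> borel_measurable (completion M)"
    by (metis (no_types, lifting) borel_measurable_AE_completion[OF _ ae] borel_measurable_AE_completion[OF _ assms] UNIV_I Pi_I' space_borel)
  have ae': "AE x in completion M. f x = g x" using assms by (rule AE_completion)
  show i: "integrable (completion M) f \<longleftrightarrow> integrable (completion M) g"
  proof (cases "f \<in> borel_measurable (completion M)")
    case True
    then show ?thesis using m integrable_cong_AE[OF _ _ ae'] by blast
  next
    case False
    then show ?thesis using m borel_measurable_integrable by blast
  qed
  show "integral\<^sup>L (completion M) f = integral\<^sup>L (completion M) g"
  proof (cases "f \<in> borel_measurable (completion M)")
    case True
    then show ?thesis using m integral_cong_AE[OF _ _ ae'] by blast
  next
    case False
    then have "\<not> integrable (completion M) f" "\<not> integrable (completion M) g"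
      using i borel_measurable_integrable by blast+
    then show ?thesis by (simp add: not_integrable_integral_eq)
  qed
qed

lemma AE_lborel_negligible:
  assumes "negligible N" shows "AE x in lborel. x \<notin> N"
proof -
  have "AE x in lebesgue. x \<notin> N" using assms by (intro AE_not_in) (simp add: negligible_iff_null_sets)
  then show ?thesis by (simp add: AE_completion_iff)
qed

lemma lebesgue_on_cong:
  fixes f g :: "'a::euclidean_space \<Rightarrow> real"
  assumes S: "S \<in> sets lebesgue" and N: "negligible N" and eq: "\<And>x. x \<in> S - N \<Longrightarrow> f x = g x"
  shows "integrable (lebesgue_on S) f \<longleftrightarrow> integrable (lebesgue_on S) g"
    and "(LINT x|lebesgue_on S. f x) = (LINT x|lebesgue_on S. g x)"
proof -
  have "AE x in lborel. indicator S x * f x = indicator S x * g x"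
    using AE_lborel_negligible[OF N] by eventually_elim (use eq in \<open>auto simp: indicator_def\<close>)
  from completion_cong_AE[OF this] show "integrable (lebesgue_on S) f \<longleftrightarrow> integrable (lebesgue_on S) g"
     "(LINT x|lebesgue_on S. f x) = (LINT x|lebesgue_on S. g x)"
    using S by (simp_all add: integrable_restrict_space integral_restrict_space)
qed

text \<open>Used to pass initial data from the domain to a single element, and smooth extensions to
  fields with arbitrary values on the element boundary.\<close>

lemma square_integrable_transfer:
  fixes f g :: "'a::euclidean_space \<Rightarrow> real^3"
  assumes g: "square_integrable (lebesgue_on S) g" and S: "S \<in> sets lebesgue" and T: "T \<in> sets lebesgue"
    and N: "negligible N" and eq: "\<And>x. x \<in> T - N \<Longrightarrow> x \<in> S \<and> f x = g x"
  shows "square_integrable (lebesgue_on T) f"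
proof -
  have iS: "S \<inter> space lebesgue \<in> sets lebesgue" and iT: "T \<inter> space lebesgue \<in> sets lebesgue" using S T by auto
  have gm: "(\<lambda>x. indicator S x *\<^sub>R g x) \<in> borel_measurable lebesgue"
    and gi: "integrable lebesgue (\<lambda>x. indicator S x *\<^sub>R (norm (g x))\<^sup>2)"
    using g by (auto simp: square_integrable_def borel_measurable_restrict_space_iff[OF iS] integrable_restrict_space[OF iS])
  note ae = AE_lborel_negligible[OF N]
  have 1: "(\<lambda>x. indicator T x *\<^sub>R (indicator S x *\<^sub>R g x)) \<in> borel_measurable lebesgue"
    by (rule borel_measurable_scaleR[OF borel_measurable_indicator[OF T] gm])
  have "AE x in lborel. indicator T x *\<^sub>R f x = indicator T x *\<^sub>R (indicator S x *\<^sub>R g x)"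
    using ae by eventually_elim (use eq in \<open>auto simp: indicator_def\<close>)
  then have m: "(\<lambda>x. indicator T x *\<^sub>R f x) \<in> borel_measurable lebesgue"
    by (rule borel_measurable_AE_completion[OF 1]) simp
  have "integrable lebesgue (\<lambda>x. indicator T x *\<^sub>R (indicator S x *\<^sub>R (norm (g x))\<^sup>2))"
    by (rule integrable_mult_indicator[OF T gi])
  moreover have ae2: "AE x in lborel. indicator T x *\<^sub>R (indicator S x *\<^sub>R (norm (g x))\<^sup>2) = indicator T x *\<^sub>R (norm (f x))\<^sup>2"
    using ae by eventually_elim (use eq in \<open>auto simp: indicator_def\<close>)
  ultimately have "integrable lebesgue (\<lambda>x. indicator T x *\<^sub>R (norm (f x))\<^sup>2)"
    using completion_cong_AE(1)[OF ae2] by simp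
  then show ?thesis
    using m by (simp add: square_integrable_def borel_measurable_restrict_space_iff[OF iT] integrable_restrict_space[OF iT])
qed

lemma square_integrable_bdd:
  fixes g :: "'a::euclidean_space \<Rightarrow> real^3"
  assumes "S \<in> sets borel" "bounded S" "bdd_borel_on S g"
  shows "square_integrable (lebesgue_on S) g"
proof -
  have gm: "g \<in> borel_measurable borel" using assms(3) by (rule bdd_borel_onD)
  have "bdd_borel_on S (\<lambda>x. (norm (g x))\<^sup>2)"
    unfolding power2_norm_eq_inner by (intro bdd_borel_on_inner assms)
  from integral_lebesgue_on_cong(1)[OF assms(1,2) negligible_empty this]
  have "integrable (lebesgue_on S) (\<lambda>x. (norm (g x))\<^sup>2)" by simp
  moreover have "g \<in> borel_measurable (lebesgue_on S)"
    using gm by (intro measurable_restrict_space1 measurable_completion) simp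
  ultimately show ?thesis by (simp add: square_integrable_def)
qed

definition l2_inner :: "'a::euclidean_space set \<Rightarrow> ('a \<Rightarrow> real^3) \<Rightarrow> ('a \<Rightarrow> real^3) \<Rightarrow> real" where
  "l2_inner S f g = (LINT x|lebesgue_on S. f x \<bullet> g x)"

lemma square_integrable_inner:
  assumes "square_integrable M f" "square_integrable M g"
  shows "integrable M (\<lambda>x. f x \<bullet> g x)"
proof (rule Bochner_Integration.integrable_bound)
  show "integrable M (\<lambda>x. (norm (f x))\<^sup>2 + (norm (g x))\<^sup>2)"
    using assms by (auto simp: square_integrable_def)
  show "(\<lambda>x. f x \<bullet> g x) \<in> borel_measurable M" using assms by (auto simp: square_integrable_def)
  have "norm (u \<bullet> v) \<le> norm ((norm u)\<^sup>2 + (norm v)\<^sup>2)" for u v :: "real^3"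
  proof -
    have "\<bar>u \<bullet> v\<bar> \<le> norm u * norm v" by (rule Cauchy_Schwarz_ineq2)
    also have "\<dots> \<le> (norm u)\<^sup>2 + (norm v)\<^sup>2"
      using sum_squares_bound[of "norm u" "norm v"] mult_nonneg_nonneg[OF norm_ge_zero norm_ge_zero, of u v] by linarith
    finally show ?thesis by simp
  qed
  then show "AE x in M. norm (f x \<bullet> g x) \<le> norm ((norm (f x))\<^sup>2 + (norm (g x))\<^sup>2)" by simp
qed

lemma square_integrable_diff:
  assumes f: "square_integrable M f" and g: "square_integrable M g"
  shows "square_integrable M (\<lambda>x. f x - g x)"
proof -
  have "integrable M (\<lambda>x. f x \<bullet> f x - 2 * (f x \<bullet> g x) + g x \<bullet> g x)"
    using square_integrable_inner[OF f f] square_integrable_inner[OF f g] square_integrable_inner[OF g g] by simp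
  moreover have "(norm (u - v))\<^sup>2 = u \<bullet> u - 2 * (u \<bullet> v) + v \<bullet> v" for u v :: "real^3"
    by (simp add: power2_norm_eq_inner inner_diff_left inner_diff_right inner_commute)
  moreover have "(\<lambda>x. f x - g x) \<in> borel_measurable M"
    using assms unfolding square_integrable_def by (intro borel_measurable_diff) auto
  ultimately show ?thesis by (simp add: square_integrable_def)
qed

lemma l2_inner_diff:
  assumes f: "square_integrable (lebesgue_on S) f" and g: "square_integrable (lebesgue_on S) g"
  shows "l2_inner S (\<lambda>x. f x - g x) (\<lambda>x. f x - g x) = l2_inner S f f - 2 * l2_inner S g f + l2_inner S g g"
proof -
  have "(u - v) \<bullet> (u - v) = u \<bullet> u - 2 * (v \<bullet> u) + v \<bullet> v" for u v :: "real^3"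
    by (simp add: inner_diff_left inner_diff_right inner_commute)
  then show ?thesis
    unfolding l2_inner_def
    using square_integrable_inner[OF f f] square_integrable_inner[OF g f] square_integrable_inner[OF g g] by simp
qed

text \<open>The point is taken in the interior because a piecewise constant coefficient is arbitrary
  on the element boundary.\<close>

definition element_value :: "(real^3 \<Rightarrow> real) \<Rightarrow> (real^3) set \<Rightarrow> real" where
  "element_value c K = c (SOME x. x \<in> interior K)"

lemma element_value_eq:
  assumes "piecewise_constant \<K> c" "K \<in> \<K>" "x \<in> interior K"
  shows "c x = element_value c K"
proof -
  have "(SOME x. x \<in> interior K) \<in> interior K" using assms(3) by (rule someI)
  moreover obtain d where "\<forall>x\<in>interior K. c x = d"
    using assms unfolding piecewise_constant_def constant_on_def by blast
  ultimately show ?thesis using assms(3) by (simp add: element_value_def)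
qed

section \<open>Splitting integrals and energies over the elements\<close>

context polyhedral_mesh
begin

lemma element_lebesgue: "K \<in> \<K> \<Longrightarrow> K \<in> sets lebesgue" "K \<in> \<K> \<Longrightarrow> K \<in> sets borel" "K \<in> \<K> \<Longrightarrow> bounded K"
  and negligible_frontier_element: "K \<in> \<K> \<Longrightarrow> negligible (frontier K)"
  using compact_element negligible_convex_frontier[OF convex_element]
  by (auto simp: compact_imp_bounded borel_compact)

lemma domain_lebesgue: "\<Omega> \<in> sets lebesgue"
  using open_domain by simp

lemma interior_elementI: "K \<in> \<K> \<Longrightarrow> x \<in> K - frontier K \<Longrightarrow> x \<in> interior K"
  using closed_element by (auto simp: frontier_def)

text \<open>Almost every point avoids all element boundaries; such a point of the domain lies in
  exactly one element, and outside the domain in none.\<close>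

lemma integral_domain_split:
  fixes h :: "real^3 \<Rightarrow> real"
  assumes h: "\<And>K. K \<in> \<K> \<Longrightarrow> integrable (lebesgue_on K) h"
  shows "(LINT x|lebesgue_on \<Omega>. h x) = (\<Sum>K\<in>\<K>. LINT x|lebesgue_on K. h x)"
proof -
  have hK: "integrable lebesgue (\<lambda>x. indicator K x * h x)" if "K \<in> \<K>" for K
    using h[OF that] element_lebesgue[OF that] by (simp add: integrable_restrict_space)
  have "AE x in lborel. \<forall>K\<in>\<K>. x \<notin> frontier K"
    using finite_mesh by (intro AE_finite_allI AE_lborel_negligible negligible_frontier_element)
  then have ae: "AE x in lborel. indicator \<Omega> x * h x = (\<Sum>K\<in>\<K>. indicator K x * h x)"
  proof eventually_elim
    case (elim x)
    have int: "x \<in> interior K" if "K \<in> \<K>" "x \<in> K" for K using that elim interior_elementI by blast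
    show ?case
    proof (cases "x \<in> \<Omega>")
      case True
      then have "x \<in> \<Union>\<K>" using closure_subset[of \<Omega>] unfolding union_mesh by blast
      then obtain K where K: "K \<in> \<K>" "x \<in> K" by blast
      have uniq: "x \<notin> L" if "L \<in> \<K>" "L \<noteq> K" for L
        using int[OF that(1)] int[OF K] disjoint_elements[OF that(1) K(1) that(2)] by blast
      have "(\<Sum>L\<in>\<K>. indicator L x * h x) = indicator K x * h x"
        by (rule sum_single[OF finite_mesh K(1)]) (use uniq in simp)
      then show ?thesis using True K(2) by simp
    next
      case False
      have "x \<notin> K" if "K \<in> \<K>" for K using int[OF that] False interior_element_subset[OF that] by blast
      then have "(\<Sum>K\<in>\<K>. indicator K x * h x) = 0" by (intro sum.neutral) auto
      then show ?thesis using False by simp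
    qed
  qed
  have "(LINT x|lebesgue_on \<Omega>. h x) = (LINT x|lebesgue. indicator \<Omega> x * h x)"
    using domain_lebesgue by (simp add: integral_restrict_space)
  also have "\<dots> = (LINT x|lebesgue. (\<Sum>K\<in>\<K>. indicator K x * h x))" by (rule completion_cong_AE(2)[OF ae])
  also have "\<dots> = (\<Sum>K\<in>\<K>. LINT x|lebesgue. indicator K x * h x)" using hK by (rule Bochner_Integration.integral_sum)
  also have "\<dots> = (\<Sum>K\<in>\<K>. LINT x|lebesgue_on K. h x)"
    using element_lebesgue by (intro sum.cong refl) (simp add: integral_restrict_space)
  finally show ?thesis .
qed

lemma weighted_integral_element:
  assumes c: "piecewise_constant \<K> c" and K: "K \<in> \<K>"
  shows "(LINT x|lebesgue_on K. c x * h x) = element_value c K * (LINT x|lebesgue_on K. h x)"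
    and "integrable (lebesgue_on K) h \<Longrightarrow> integrable (lebesgue_on K) (\<lambda>x. c x * h x)"
proof -
  have eq: "c x * h x = element_value c K * h x" if "x \<in> K - frontier K" for x
    using element_value_eq[OF c K interior_elementI[OF K that]] by simp
  note cong = lebesgue_on_cong[OF element_lebesgue(1)[OF K] negligible_frontier_element[OF K] eq]
  show "(LINT x|lebesgue_on K. c x * h x) = element_value c K * (LINT x|lebesgue_on K. h x)"
    using cong(2) by simp
  show "integrable (lebesgue_on K) (\<lambda>x. c x * h x)" if "integrable (lebesgue_on K) h"
    using cong(1) that by simp
qed

lemma L2_norm_split:
  assumes c: "piecewise_constant \<K> c" "\<And>x. x \<in> \<Omega> \<Longrightarrow> c x > 0"
    and f: "\<And>K. K \<in> \<K> \<Longrightarrow> square_integrable (lebesgue_on K) f"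
  shows "(L2_norm \<Omega> (\<lambda>x. sqrt (c x) *\<^sub>R f x))\<^sup>2 = (\<Sum>K\<in>\<K>. element_value c K * l2_inner K f f)"
proof -
  have i: "integrable (lebesgue_on K) (\<lambda>x. f x \<bullet> f x)" if "K \<in> \<K>" for K
    by (rule square_integrable_inner[OF f f]) (use that in auto)
  have "(L2_norm \<Omega> (\<lambda>x. sqrt (c x) *\<^sub>R f x))\<^sup>2 = (LINT x|lebesgue_on \<Omega>. (norm (sqrt (c x) *\<^sub>R f x))\<^sup>2)"
    unfolding L2_norm_def by (intro real_sqrt_pow2 integral_nonneg_AE) simp
  also have "\<dots> = (LINT x|lebesgue_on \<Omega>. c x * (f x \<bullet> f x))"
  proof (rule Bochner_Integration.integral_cong[OF refl])
    fix x assume "x \<in> space (lebesgue_on \<Omega>)"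
    \<comment> \<open>Positivity makes the square of \<open>sqrt (c x)\<close> equal to
      \<open>c x\<close>.\<close>
    then have "c x > 0" using c(2) by (simp add: space_restrict_space)
    then show "(norm (sqrt (c x) *\<^sub>R f x))\<^sup>2 = c x * (f x \<bullet> f x)"
      by (simp add: power_mult_distrib power2_norm_eq_inner)
  qed
  also have "\<dots> = (\<Sum>K\<in>\<K>. LINT x|lebesgue_on K. c x * (f x \<bullet> f x))"
    by (rule integral_domain_split) (rule weighted_integral_element(2)[OF c(1) _ i])
  also have "\<dots> = (\<Sum>K\<in>\<K>. element_value c K * l2_inner K f f)"
    by (intro sum.cong refl) (simp add: weighted_integral_element(1)[OF c(1)] l2_inner_def)
  finally show ?thesis .
qed

lemma square_integrable_smooth:
  assumes K: "K \<in> \<K>" and G: "continuous_on UNIV G" and u: "\<And>x. x \<in> interior K \<Longrightarrow> u x = G (x, s)"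
  shows "square_integrable (lebesgue_on K) u"
proof (rule square_integrable_transfer)
  show "square_integrable (lebesgue_on K) (\<lambda>x. G (x, s))"
    using K by (intro square_integrable_bdd bdd_borel_on_continuous continuous_on_slice[OF G]) (auto simp: element_lebesgue compact_element)
  show "x \<in> K \<and> u x = G (x, s)" if "x \<in> K - frontier K" for x
    using that u interior_elementI[OF K that] by auto
qed (use K in \<open>auto simp: element_lebesgue negligible_frontier_element\<close>)

lemma l2_inner_smooth:
  assumes K: "K \<in> \<K>" and G: "continuous_on UNIV G" and u: "\<And>x. x \<in> interior K \<Longrightarrow> u x = G (x, s)"
  shows "l2_inner K u u = (LINT x|lborel. indicator K x * (G (x, s) \<bullet> G (x, s)))"
  unfolding l2_inner_def
proof (rule integral_lebesgue_on_cong(2)[OF element_lebesgue(2)[OF K] element_lebesgue(3)[OF K] negligible_frontier_element[OF K]])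
  show "bdd_borel_on K (\<lambda>x. G (x, s) \<bullet> G (x, s))"
    by (intro bdd_borel_on_continuous continuous_on_inner continuous_on_slice[OF G] compact_element K)
  show "u x \<bullet> u x = G (x, s) \<bullet> G (x, s)" if "x \<in> K - frontier K" for x
    using u interior_elementI[OF K that] by simp
qed

end

text \<open>Both orders occur: time outermost for the curl terms, to match the surface integrals,
  and space outermost for the time derivatives, where the inner integral is evaluated
  exactly.\<close>

lemma integral_slab_Fubini:
  fixes c :: "(real^3) \<times> real \<Rightarrow> real"
  assumes K: "compact K" and c: "continuous_on UNIV c"
  shows "(LINT z|lborel. indicator (K \<times> {a..b}) z * c z) = (LINT t|lborel. indicator {a..b} t * (LINT x|lborel. indicator K x * c (x, t)))"
    and "integrable lborel (\<lambda>t. indicator {a..b} t * (LINT x|lborel. indicator K x * c (x, t)))"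
    and "(LINT z|lborel. indicator (K \<times> {a..b}) z * c z) = (LINT x|lborel. indicator K x * (LINT t|lborel. indicator {a..b} t * c (x, t)))"
proof -
  have KI: "compact (K \<times> {a..b})" using K by (simp add: compact_Times)
  have "integrable lborel (\<lambda>z. indicator (K \<times> {a..b}) z * c z)"
    using KI c by (intro integrable_bdd_borel_on bdd_borel_on_continuous emeasure_bounded_finite)
      (auto simp: borel_compact compact_imp_bounded)
  then have i: "integrable (lborel \<Otimes>\<^sub>M lborel) (\<lambda>(x, t). indicator (K \<times> {a..b}) (x, t) * c (x, t))"
    by (simp add: lborel_prod case_prod_unfold)
  have 1: "(LINT x|lborel. indicator (K \<times> {a..b}) (x, t) * c (x, t)) = indicator {a..b} t * (LINT x|lborel. indicator K x * c (x, t))" for t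
    by (simp add: indicator_times mult.commute mult.left_commute flip: integral_mult_right_zero)
  have 2: "(LINT t|lborel. indicator (K \<times> {a..b}) (x, t) * c (x, t)) = indicator K x * (LINT t|lborel. indicator {a..b} t * c (x, t))" for x
    by (simp add: indicator_times mult.assoc flip: integral_mult_right_zero)
  show "integrable lborel (\<lambda>t. indicator {a..b} t * (LINT x|lborel. indicator K x * c (x, t)))"
    using lborel_pair.integrable_snd[OF i] by (simp add: 1)
  show "(LINT z|lborel. indicator (K \<times> {a..b}) z * c z) = (LINT t|lborel. indicator {a..b} t * (LINT x|lborel. indicator K x * c (x, t)))"
    using lborel_pair.integral_snd[OF i] by (simp add: 1 lborel_prod case_prod_unfold)
  show "(LINT z|lborel. indicator (K \<times> {a..b}) z * c z) = (LINT x|lborel. indicator K x * (LINT t|lborel. indicator {a..b} t * c (x, t)))"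
    using lborel_pair.integral_fst[OF i] by (simp add: 2 lborel_prod case_prod_unfold)
qed

text \<open>The integrand is the time derivative of \<open>1/2 * (G \<bullet> G)\<close>, integrated
  along each vertical line.\<close>

lemma integral_time_derivative:
  fixes G :: "(real^3) \<times> real \<Rightarrow> real^3"
  assumes K: "compact K" and G: "smooth G" and ab: "a \<le> b"
  shows "(LINT z|lborel. indicator (K \<times> {a..b}) z * (dir_deriv G (0, 1) z \<bullet> G z))
    = 1/2 * ((LINT x|lborel. indicator K x * (G (x, b) \<bullet> G (x, b))) - (LINT x|lborel. indicator K x * (G (x, a) \<bullet> G (x, a))))"
proof -
  let ?N = "\<lambda>s. LINT x|lborel. indicator K x * (G (x, s) \<bullet> G (x, s))"
  let ?d = "\<lambda>z. dir_deriv G (0, 1) z \<bullet> G z"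
  have cG: "continuous_on UNIV G" and cD: "continuous_on UNIV (dir_deriv G (0, 1))"
    by (rule smooth_continuous[OF G], rule smooth_continuous_deriv[OF G])
  have cont: "continuous_on UNIV (\<lambda>z. ?d z)" by (intro continuous_on_inner cG cD)
  have FTC: "(LINT t|lborel. indicator {a..b} t * ?d (x, t))
     = 1/2 * (G (x, b) \<bullet> G (x, b)) - 1/2 * (G (x, a) \<bullet> G (x, a))" for x
  proof -
    have d: "((\<lambda>t. G (x, t)) has_vector_derivative dir_deriv G (0, 1) (x, t)) (at t within {a..b})" for t
      using smooth_line_derivative[OF G, of "(x, 0)" "(0, 1)" t]
      by (simp add: has_vector_derivative_at_within)
    have d2: "((\<lambda>t. 1/2 * (G (x, t) \<bullet> G (x, t))) has_vector_derivative ?d (x, t)) (at t within {a..b})" for t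
    proof -
      have "((\<lambda>t. G (x, t) \<bullet> G (x, t)) has_vector_derivative (G (x, t) \<bullet> dir_deriv G (0, 1) (x, t) + ?d (x, t))) (at t within {a..b})"
        by (rule bounded_bilinear.has_vector_derivative[OF bounded_bilinear_inner d d])
      from has_vector_derivative_scaleR[OF DERIV_const this, of "1/2"]
      show ?thesis by (simp add: inner_commute)
    qed
    have "continuous_on {a..b} (\<lambda>t. ?d (x, t))"
      by (rule continuous_on_compose2[OF cont]) (auto intro!: continuous_intros)
    from integral_FTC_Icc[OF ab d2 this] show ?thesis by simp
  qed
  have i: "integrable lborel (\<lambda>x. indicator K x * (G (x, s) \<bullet> G (x, s)))" for s
  proof (rule integrable_bdd_borel_on)
    show "bdd_borel_on K (\<lambda>x. G (x, s) \<bullet> G (x, s))"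
      by (intro bdd_borel_on_continuous continuous_on_inner continuous_on_slice[OF cG] K)
  qed (use K emeasure_bounded_finite[OF compact_imp_bounded[OF K]] in \<open>auto simp: borel_compact\<close>)
  have "(LINT z|lborel. indicator (K \<times> {a..b}) z * ?d z)
    = (LINT x|lborel. 1/2 * (indicator K x * (G (x, b) \<bullet> G (x, b))) - 1/2 * (indicator K x * (G (x, a) \<bullet> G (x, a))))"
    unfolding integral_slab_Fubini(3)[OF K cont] FTC
    by (intro Bochner_Integration.integral_cong refl) (simp add: indicator_def)
  also have "\<dots> = 1/2 * ?N b - 1/2 * ?N a"
    using i by (subst Bochner_Integration.integral_diff) auto
  finally show ?thesis by (simp add: right_diff_distrib)
qed

subsection \<open>The energy identity\<close>

context smooth_slab
begin

definition curl_density :: "(real^3) set \<Rightarrow> (real^3) \<times> real \<Rightarrow> real" where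
  "curl_density K z = spatial_curl (GE K) z \<bullet> GH K z - spatial_curl (GH K) z \<bullet> GE K z"

lemma continuous_curl_density: "K \<in> \<K> \<Longrightarrow> continuous_on UNIV (curl_density K)"
  unfolding curl_density_def[abs_def]
  by (intro continuous_on_diff continuous_on_inner smooth_continuous smooth_continuous_curl GE GH)

lemma square_integrable_fields:
  assumes "K \<in> \<K>" "s \<in> {a..b}"
  shows "square_integrable (lebesgue_on K) (\<lambda>x. E x s)" "square_integrable (lebesgue_on K) (\<lambda>x. H x s)"
  by (rule square_integrable_smooth[OF assms(1) smooth_continuous[OF GE[OF assms(1)]]], rule E[OF assms(1) _ assms(2)], assumption)
     (rule square_integrable_smooth[OF assms(1) smooth_continuous[OF GH[OF assms(1)]]], rule H[OF assms(1) _ assms(2)], assumption)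

lemma volume_term:
  assumes \<epsilon>: "piecewise_constant \<K> \<epsilon>" and \<mu>: "piecewise_constant \<K> \<mu>" and K: "K \<in> \<K>"
  shows "(LINT (x, t)|lebesgue_on (K \<times> {a..b}).
        (\<epsilon> x *\<^sub>R time_deriv E x t - curl H x t) \<bullet> E x t
        + (\<mu> x *\<^sub>R time_deriv H x t + curl E x t) \<bullet> H x t)
    = element_value \<epsilon> K * (1/2 * (l2_inner K (\<lambda>x. E x b) (\<lambda>x. E x b) - l2_inner K (\<lambda>x. E x a) (\<lambda>x. E x a)))
      + element_value \<mu> K * (1/2 * (l2_inner K (\<lambda>x. H x b) (\<lambda>x. H x b) - l2_inner K (\<lambda>x. H x a) (\<lambda>x. H x a)))
      + (LINT t|lborel. indicator {a..b} t * (LINT x|lborel. indicator K x * curl_density K (x, t)))"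
    (is "?lhs = ?rhs")
proof -
  let ?n = "\<lambda>K u s. l2_inner K (\<lambda>x. u x s) (\<lambda>x. u x s)"
  let ?Q = "K \<times> {a..b}" and ?e = "element_value \<epsilon> K" and ?m = "element_value \<mu> K"
  let ?dE = "\<lambda>z. dir_deriv (GE K) (0, 1) z \<bullet> GE K z" and ?dH = "\<lambda>z. dir_deriv (GH K) (0, 1) z \<bullet> GH K z"
  have Q: "compact ?Q" using compact_element[OF K] by (simp add: compact_Times)
  have cont: "continuous_on UNIV ?dE" "continuous_on UNIV ?dH" "continuous_on UNIV (curl_density K)"
    by (intro continuous_on_inner smooth_continuous_deriv smooth_continuous[OF GE] GE K)
       (intro continuous_on_inner smooth_continuous_deriv smooth_continuous[OF GH] GH K, rule continuous_curl_density[OF K])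
  have int: "integrable lborel (\<lambda>z. indicator ?Q z * c z)" if "continuous_on UNIV c" for c :: "_ \<Rightarrow> real"
    using Q that emeasure_bounded_finite[OF compact_imp_bounded[OF Q]]
    by (intro integrable_bdd_borel_on bdd_borel_on_continuous) (auto simp: borel_compact)
  let ?g = "\<lambda>z. ?e * ?dE z + ?m * ?dH z + curl_density K z"
  have neg: "negligible (frontier ?Q)"
    by (intro negligible_convex_frontier convex_Times convex_element K) simp
  have eq: "(case z of (x, t) \<Rightarrow> (\<epsilon> x *\<^sub>R time_deriv E x t - curl H x t) \<bullet> E x t
        + (\<mu> x *\<^sub>R time_deriv H x t + curl E x t) \<bullet> H x t) = ?g z" if "z \<in> ?Q - frontier ?Q" for z
  proof -
    \<comment> \<open>Around an interior point of the space-time prism the fields agree with their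
      extensions in space and in time, so curl and time derivative may be read off from these; the
      frontier is negligible.\<close>
    have "z \<in> interior ?Q" using that Q compact_imp_closed[OF Q] by (simp add: frontier_def)
    then obtain x t where z: "z = (x, t)" "x \<in> interior K" "t \<in> {a<..<b}"
      by (auto simp: interior_Times)
    have t: "t \<in> {a..b}" using z by simp
    have "time_deriv E x t = dir_deriv (GE K) (0, 1) (x, t)" "time_deriv H x t = dir_deriv (GH K) (0, 1) (x, t)"
      using E[OF K z(2)] H[OF K z(2)] z(3)
      by (auto intro!: dir_deriv_time[OF GE[OF K], of "{a<..<b}"] dir_deriv_time[OF GH[OF K], of "{a<..<b}"])
    moreover have "curl E x t = spatial_curl (GE K) (x, t)"
      by (rule curl_eq_spatial_curl[OF GE[OF K] open_interior z(2)]) (rule E[OF K _ t])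
    moreover have "curl H x t = spatial_curl (GH K) (x, t)"
      by (rule curl_eq_spatial_curl[OF GH[OF K] open_interior z(2)]) (rule H[OF K _ t])
    ultimately show ?thesis
      using element_value_eq[OF \<epsilon> K z(2)] element_value_eq[OF \<mu> K z(2)] E[OF K z(2) t] H[OF K z(2) t]
      by (simp add: z(1) curl_density_def inner_diff_left inner_add_left)
  qed
  have "bdd_borel_on ?Q ?g"
    by (intro bdd_borel_on_continuous Q continuous_on_add continuous_on_mult continuous_on_const cont)
  from integral_lebesgue_on_cong(2)[OF borel_compact[OF Q] compact_imp_bounded[OF Q] neg this eq]
  have "?lhs = (LINT z|lborel. indicator ?Q z * ?g z)" by simp
  also have "\<dots> = (LINT z|lborel. ?e * (indicator ?Q z * ?dE z) + ?m * (indicator ?Q z * ?dH z) + indicator ?Q z * curl_density K z)"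
    by (intro Bochner_Integration.integral_cong refl) (simp add: algebra_simps)
  also have "\<dots> = ?e * (LINT z|lborel. indicator ?Q z * ?dE z) + ?m * (LINT z|lborel. indicator ?Q z * ?dH z)
      + (LINT z|lborel. indicator ?Q z * curl_density K z)"
    using int[OF cont(1)] int[OF cont(2)] int[OF cont(3)] by simp
  also have "(LINT z|lborel. indicator ?Q z * ?dE z) = 1/2 * (?n K E b - ?n K E a)"
  proof -
    have "?n K E s = (LINT x|lborel. indicator K x * (GE K (x, s) \<bullet> GE K (x, s)))" if "s \<in> {a..b}" for s
      by (rule l2_inner_smooth[OF K smooth_continuous[OF GE[OF K]]]) (rule E[OF K _ that])
    then show ?thesis using integral_time_derivative[OF compact_element[OF K] GE[OF K], of a b] ab by simp
  qed
  also have "(LINT z|lborel. indicator ?Q z * ?dH z) = 1/2 * (?n K H b - ?n K H a)"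
  proof -
    have "?n K H s = (LINT x|lborel. indicator K x * (GH K (x, s) \<bullet> GH K (x, s)))" if "s \<in> {a..b}" for s
      by (rule l2_inner_smooth[OF K smooth_continuous[OF GH[OF K]]]) (rule H[OF K _ that])
    then show ?thesis using integral_time_derivative[OF compact_element[OF K] GH[OF K], of a b] ab by simp
  qed
  also have "(LINT z|lborel. indicator ?Q z * curl_density K z)
      = (LINT t|lborel. indicator {a..b} t * (LINT x|lborel. indicator K x * curl_density K (x, t)))"
    by (rule integral_slab_Fubini(1)[OF compact_element[OF K] cont(3)])
  finally show ?thesis .
qed

lemma mass_term:
  assumes \<epsilon>: "piecewise_constant \<K> \<epsilon>" and \<mu>: "piecewise_constant \<K> \<mu>" and K: "K \<in> \<K>"
    and sq: "square_integrable (lebesgue_on K) e" "square_integrable (lebesgue_on K) h"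
      "square_integrable (lebesgue_on K) e'" "square_integrable (lebesgue_on K) h'"
  shows "(LINT x|lebesgue_on K. \<epsilon> x * (e x \<bullet> e' x) + \<mu> x * (h x \<bullet> h' x))
    = element_value \<epsilon> K * l2_inner K e e' + element_value \<mu> K * l2_inner K h h'"
proof -
  note i = square_integrable_inner[OF sq(1,3)] square_integrable_inner[OF sq(2,4)]
  show ?thesis
    using weighted_integral_element[OF \<epsilon> K] weighted_integral_element[OF \<mu> K] i
    by (simp add: l2_inner_def)
qed

lemma boundary_dissipation_eq:
  assumes x: "x \<in> frontier \<Omega>" "x \<notin> edge_set" and t: "t \<in> {a..b}"
  shows "boundary_dissipation (x, t) = \<beta> * (norm (cross3 (outward_normal \<Omega> x) (inner_trace \<Omega> H x t)))\<^sup>2"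
    and "\<exists>K\<in>\<K>. x \<in> frontier K \<and> outward_normal \<Omega> x = normal_field K x \<and> inner_trace \<Omega> H x t = GH K (x, t)
      \<and> (\<forall>L\<in>\<K>. x \<in> frontier L \<longrightarrow> L = K)"
proof -
  obtain K where K: "K \<in> \<K>" "x \<in> frontier K" using frontier_domain_subset x by blast
  have uniq: "L = K" if "L \<in> \<K>" "x \<in> frontier L" for L
    using boundary_point_one_element[OF x, of L K] that K frontier_elementD by blast
  have n: "outward_normal \<Omega> x = normal_field K x"
    using outward_normal_boundary[OF x K] normal_field_eq[OF K x(2)] by simp
  have tr: "inner_trace \<Omega> H x t = GH K (x, t)"
    by (rule inner_trace_boundary[OF K x smooth_continuous[OF GH[OF K(1)]]]) (rule H[OF K(1) _ t])
  show "\<exists>K\<in>\<K>. x \<in> frontier K \<and> outward_normal \<Omega> x = normal_field K x \<and> inner_trace \<Omega> H x t = GH K (x, t)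
      \<and> (\<forall>L\<in>\<K>. x \<in> frontier L \<longrightarrow> L = K)"
    using K n tr uniq by blast
  have "boundary_dissipation (x, t) = indicator (frontier K) (fst (x, t)) * dissipation K (x, t)"
    unfolding boundary_dissipation_def
  proof (rule sum_single[OF finite_mesh K(1)])
    fix L assume "L \<in> \<K>" "L \<noteq> K"
    then have "x \<notin> frontier L" using uniq by blast
    then show "indicator (frontier L) (fst (x, t)) * dissipation L (x, t) = 0" by simp
  qed
  then show "boundary_dissipation (x, t) = \<beta> * (norm (cross3 (outward_normal \<Omega> x) (inner_trace \<Omega> H x t)))\<^sup>2"
    using K(2) by (simp add: dissipation_def n tr)
qed

lemma bdd_boundary_dissipation: "bounded S \<Longrightarrow> bdd_borel_on S boundary_dissipation"
  unfolding boundary_dissipation_def[abs_def]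
  by (intro bdd_borel_on_sum bdd_borel_on_mult bdd_borel_on_indicator_fst bdd_terms) auto

lemma bounded_frontier_domain: "bounded (frontier \<Omega>)"
  using bounded_domain bounded_closure by (auto simp: frontier_def intro: bounded_subset)

text \<open>The triple product is rotated so that \<open>g\<close> stands alone against the cross
  product of trace and normal, for which a bounded Borel representative is available.\<close>

lemma integrable_excitation:
  assumes "{a..b} \<subseteq> {0..T}"
    and g: "square_integrable (surface_time_measure (frontier \<Omega>) {0<..<T}) (\<lambda>(x, s). g x s)"
  shows "integrable (surface_time_measure (frontier \<Omega>) {a..b})
    (\<lambda>(x, s). cross3 (outward_normal \<Omega> x) (g x s) \<bullet> inner_trace \<Omega> H x s)"
proof (rule integrable_surface_time_product[OF _ area_frontier_domain assms(1) g edge_set_null])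
  let ?h = "\<lambda>z. \<Sum>K\<in>\<K>. indicator (frontier K) (fst z) *\<^sub>R cross3 (GH K z) (normal_field K (fst z))"
  show "bdd_borel_on (frontier \<Omega> \<times> {a..b}) ?h"
    by (intro bdd_borel_on_sum bdd_borel_on_scaleR bdd_borel_on_cross3 bdd_borel_on_indicator_fst
        bdd_borel_on_normal_field bdd_smooth bounded_Times bounded_frontier_domain) auto
  fix x t assume xt: "x \<in> frontier \<Omega> - edge_set" "t \<in> {a..b}"
  then obtain K where K: "K \<in> \<K>" "x \<in> frontier K" "outward_normal \<Omega> x = normal_field K x"
    "inner_trace \<Omega> H x t = GH K (x, t)" "\<forall>L\<in>\<K>. x \<in> frontier L \<longrightarrow> L = K"
    using boundary_dissipation_eq(2)[of x t] by blast
  have "?h (x, t) = indicator (frontier K) (fst (x, t)) *\<^sub>R cross3 (GH K (x, t)) (normal_field K (fst (x, t)))"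
  proof (rule sum_single[OF finite_mesh K(1)])
    fix L assume "L \<in> \<K>" "L \<noteq> K"
    then have "x \<notin> frontier L" using K(5) by blast
    then show "indicator (frontier L) (fst (x, t)) *\<^sub>R cross3 (GH L (x, t)) (normal_field L (fst (x, t))) = 0" by simp
  qed
  then have h: "?h (x, t) = cross3 (GH K (x, t)) (normal_field K x)" using K(2) by simp
  show "cross3 (outward_normal \<Omega> x) (g x t) \<bullet> inner_trace \<Omega> H x t = g x t \<bullet> ?h (x, t)"
    unfolding h K(3,4) by (simp add: cross3_def inner_vec_def sum_3 algebra_simps)
qed simp

lemma surface_and_curl_terms:
  "(\<Sum>K\<in>\<K>. LINT (x, t)|surface_time_measure (frontier K) {a..b}. surface_integrand K E H x t)
    + (\<Sum>K\<in>\<K>. LINT t|lborel. indicator {a..b} t * (LINT x|lborel. indicator K x * curl_density K (x, t)))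
    = (LINT (x, t)|surface_time_measure (frontier \<Omega>) {a..b}.
        \<beta> * (norm (cross3 (outward_normal \<Omega> x) (inner_trace \<Omega> H x t)))\<^sup>2)"
proof -
  let ?I = "{a..b}"
  let ?s = "\<lambda>K t. LINT x|polyhedral_area. indicator (frontier K) x * surface_term K (x, t)"
  let ?c = "\<lambda>K t. LINT x|lborel. indicator K x * curl_density K (x, t)"
  have S: "integrable lborel (\<lambda>t. indicator ?I t * ?s K t)"
    "(LINT (x, t)|surface_time_measure (frontier K) ?I. surface_integrand K E H x t) = (LINT t|lborel. indicator ?I t * ?s K t)"
    if K: "K \<in> \<K>" for K
    using integral_surface_time_measure(2,3)[OF _ area_frontier_element[OF K] _ _ edge_set_null bdd_terms(4)[OF K],
        of ?I "surface_integrand K E H"] surface_integrand_eq[OF K] bounded_frontier_element[OF K]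
    by (auto simp: bounded_Times)
  have C: "integrable lborel (\<lambda>t. indicator ?I t * ?c K t)" if K: "K \<in> \<K>" for K
    by (rule integral_slab_Fubini(2)[OF compact_element[OF K] continuous_curl_density[OF K]])
  have "(\<Sum>K\<in>\<K>. LINT (x, t)|surface_time_measure (frontier K) ?I. surface_integrand K E H x t)
    + (\<Sum>K\<in>\<K>. LINT t|lborel. indicator ?I t * ?c K t)
    = (\<Sum>K\<in>\<K>. LINT t|lborel. indicator ?I t * ?s K t) + (\<Sum>K\<in>\<K>. LINT t|lborel. indicator ?I t * ?c K t)"
    using S(2) by simp
  also have "\<dots> = (LINT t|lborel. (\<Sum>K\<in>\<K>. indicator ?I t * ?s K t)) + (LINT t|lborel. (\<Sum>K\<in>\<K>. indicator ?I t * ?c K t))"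
    using S(1) C by (simp add: Bochner_Integration.integral_sum)
  also have "\<dots> = (LINT t|lborel. (\<Sum>K\<in>\<K>. indicator ?I t * ?s K t) + (\<Sum>K\<in>\<K>. indicator ?I t * ?c K t))"
    using S(1) C by (intro Bochner_Integration.integral_add[symmetric] Bochner_Integration.integrable_sum) auto
  also have "\<dots> = (LINT t|lborel. indicator ?I t * (LINT x|polyhedral_area. indicator (frontier \<Omega>) x * boundary_dissipation (x, t)))"
    unfolding sum_distrib_left[symmetric] distrib_left[symmetric] curl_density_def surface_balance ..
  also have "\<dots> = (LINT (x, t)|surface_time_measure (frontier \<Omega>) ?I.
        \<beta> * (norm (cross3 (outward_normal \<Omega> x) (inner_trace \<Omega> H x t)))\<^sup>2)"
    by (rule integral_surface_time_measure(3)[OF _ area_frontier_domain _ _ edge_set_null, symmetric])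
       (auto simp: boundary_dissipation_eq(1) intro!: bdd_boundary_dissipation bounded_Times bounded_frontier_domain)
  finally show ?thesis .
qed

text \<open>\<open>E'\<close> and \<open>H'\<close> stand for the fields of the preceding slab at
  its final time. They enter through square integrability, because before the first slab they are
  the initial data.\<close>

lemma energy_identity:
  assumes \<epsilon>: "piecewise_constant \<K> \<epsilon>" "\<And>x. x \<in> \<Omega> \<Longrightarrow> \<epsilon> x > 0"
    and \<mu>: "piecewise_constant \<K> \<mu>" "\<And>x. x \<in> \<Omega> \<Longrightarrow> \<mu> x > 0"
    and T: "{a..b} \<subseteq> {0..T}"
    and g: "square_integrable (surface_time_measure (frontier \<Omega>) {0<..<T}) (\<lambda>(x, s). g x s)"
    and E': "\<And>K. K \<in> \<K> \<Longrightarrow> square_integrable (lebesgue_on K) (\<lambda>x. E' x a)"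
    and H': "\<And>K. K \<in> \<K> \<Longrightarrow> square_integrable (lebesgue_on K) (\<lambda>x. H' x a)"
    and BR: "dg_B \<Omega> \<K> \<epsilon> \<mu> \<beta> a b E H E H = dg_R \<Omega> \<K> \<epsilon> \<mu> g a b E' H' E H"
  shows
    "1/2 * ((L2_norm \<Omega> (\<lambda>x. sqrt (\<epsilon> x) *\<^sub>R E x b))\<^sup>2 + (L2_norm \<Omega> (\<lambda>x. sqrt (\<mu> x) *\<^sub>R H x b))\<^sup>2)
     - 1/2 * ((L2_norm \<Omega> (\<lambda>x. sqrt (\<epsilon> x) *\<^sub>R E' x a))\<^sup>2 + (L2_norm \<Omega> (\<lambda>x. sqrt (\<mu> x) *\<^sub>R H' x a))\<^sup>2)
     = - (LINT (x, s)|surface_time_measure (frontier \<Omega>) {a..b}.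
            \<beta> * (norm (cross3 (outward_normal \<Omega> x) (inner_trace \<Omega> H x s)))\<^sup>2
            + cross3 (outward_normal \<Omega> x) (g x s) \<bullet> inner_trace \<Omega> H x s)
       - 1/2 * (L2_norm \<Omega> (\<lambda>x. sqrt (\<epsilon> x) *\<^sub>R (E x a - E' x a)))\<^sup>2
       - 1/2 * (L2_norm \<Omega> (\<lambda>x. sqrt (\<mu> x) *\<^sub>R (H x a - H' x a)))\<^sup>2"
proof -
  let ?n = "\<lambda>K u s. l2_inner K (\<lambda>x. u x s) (\<lambda>x. u x s)"
  let ?M = "surface_time_measure (frontier \<Omega>) {a..b}"
  let ?e = "element_value \<epsilon>" and ?m = "element_value \<mu>"
  let ?l = "\<lambda>K u v. l2_inner K u v"
  define D where "D = (LINT (x, s)|?M. \<beta> * (norm (cross3 (outward_normal \<Omega> x) (inner_trace \<Omega> H x s)))\<^sup>2)"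
  define X where "X = (LINT (x, s)|?M. cross3 (outward_normal \<Omega> x) (g x s) \<bullet> inner_trace \<Omega> H x s)"
  have a: "a \<in> {a..b}" and b: "b \<in> {a..b}" using ab by auto
  note sqa = square_integrable_fields[OF _ a] and sqb = square_integrable_fields[OF _ b]
  \<comment> \<open>Dissipation and excitation form one integral in the claim; it may be split
    because both parts are integrable.\<close>
  have iD: "integrable ?M (\<lambda>(x, s). \<beta> * (norm (cross3 (outward_normal \<Omega> x) (inner_trace \<Omega> H x s)))\<^sup>2)"
    by (rule integral_surface_time_measure(1)[OF _ area_frontier_domain _ _ edge_set_null])
       (auto simp: boundary_dissipation_eq(1)[symmetric] intro!: bdd_boundary_dissipation bounded_Times bounded_frontier_domain)
  note iX = integrable_excitation[OF T g]
  have DX: "(LINT (x, s)|?M. \<beta> * (norm (cross3 (outward_normal \<Omega> x) (inner_trace \<Omega> H x s)))\<^sup>2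
            + cross3 (outward_normal \<Omega> x) (g x s) \<bullet> inner_trace \<Omega> H x s) = D + X"
    using Bochner_Integration.integral_add[OF iD iX] by (simp add: D_def X_def case_prod_unfold)
  have "dg_B \<Omega> \<K> \<epsilon> \<mu> \<beta> a b E H E H
    = (\<Sum>K\<in>\<K>. ?e K * (1/2 * (?n K E b - ?n K E a))
      + ?m K * (1/2 * (?n K H b - ?n K H a))
      + (LINT t|lborel. indicator {a..b} t * (LINT x|lborel. indicator K x * curl_density K (x, t))))
    + (\<Sum>K\<in>\<K>. ?e K * ?n K E a + ?m K * ?n K H a)
    + (\<Sum>K\<in>\<K>. LINT (x, t)|surface_time_measure (frontier K) {a..b}. surface_integrand K E H x t)"
    unfolding dg_B_def surface_integrand_def
    by (intro arg_cong2[where f = "(+)"] sum.cong refl volume_term[OF \<epsilon>(1) \<mu>(1)] mass_term[OF \<epsilon>(1) \<mu>(1)] sqa)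
  \<comment> \<open>The initial mass term turns half the difference of the energies into half their
    sum, and the curl and flux terms collapse to \<open>D\<close>.\<close>
  also have "\<dots> = (\<Sum>K\<in>\<K>. ?e K * (1/2 * (?n K E b + ?n K E a))
      + ?m K * (1/2 * (?n K H b + ?n K H a))) + D"
    unfolding D_def surface_and_curl_terms[symmetric] by (simp add: sum.distrib[symmetric] field_simps)
  finally have B: "dg_B \<Omega> \<K> \<epsilon> \<mu> \<beta> a b E H E H = \<dots>" .
  have R: "dg_R \<Omega> \<K> \<epsilon> \<mu> g a b E' H' E H
    = (\<Sum>K\<in>\<K>. ?e K * ?l K (\<lambda>x. E' x a) (\<lambda>x. E x a) + ?m K * ?l K (\<lambda>x. H' x a) (\<lambda>x. H x a)) - X"
    unfolding dg_R_def X_def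
    by (intro arg_cong2[where f = "(-)"] sum.cong refl mass_term[OF \<epsilon>(1) \<mu>(1)] sqa E' H')
  have n: "(L2_norm \<Omega> (\<lambda>x. sqrt (\<epsilon> x) *\<^sub>R E x b))\<^sup>2 = (\<Sum>K\<in>\<K>. ?e K * ?n K E b)"
    "(L2_norm \<Omega> (\<lambda>x. sqrt (\<mu> x) *\<^sub>R H x b))\<^sup>2 = (\<Sum>K\<in>\<K>. ?m K * ?n K H b)"
    "(L2_norm \<Omega> (\<lambda>x. sqrt (\<epsilon> x) *\<^sub>R E' x a))\<^sup>2 = (\<Sum>K\<in>\<K>. ?e K * ?n K E' a)"
    "(L2_norm \<Omega> (\<lambda>x. sqrt (\<mu> x) *\<^sub>R H' x a))\<^sup>2 = (\<Sum>K\<in>\<K>. ?m K * ?n K H' a)"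
    by (intro L2_norm_split \<epsilon> \<mu> sqb E' H'; assumption)+
  have dE: "(L2_norm \<Omega> (\<lambda>x. sqrt (\<epsilon> x) *\<^sub>R (E x a - E' x a)))\<^sup>2 = (\<Sum>K\<in>\<K>. ?e K *
      (?n K E a - 2 * ?l K (\<lambda>x. E' x a) (\<lambda>x. E x a) + ?n K E' a))"
    using L2_norm_split[OF \<epsilon> square_integrable_diff[OF sqa(1) E']] by (simp add: l2_inner_diff[OF sqa(1) E'])
  have dH: "(L2_norm \<Omega> (\<lambda>x. sqrt (\<mu> x) *\<^sub>R (H x a - H' x a)))\<^sup>2 = (\<Sum>K\<in>\<K>. ?m K *
      (?n K H a - 2 * ?l K (\<lambda>x. H' x a) (\<lambda>x. H x a) + ?n K H' a))"
    using L2_norm_split[OF \<mu> square_integrable_diff[OF sqa(2) H']] by (simp add: l2_inner_diff[OF sqa(2) H'])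
  \<comment> \<open>The test gives half the sum of both energies of the slab plus \<open>D\<close>,
    equal to the product of old and new values minus \<open>X\<close>. Subtracting half the old
    energy on both sides leaves minus half of \<open>(new - old)\<close> squared on the
    right.\<close>
  show ?thesis
    using BR unfolding B R DX n dE dH
    by (simp add: sum.distrib sum_subtractf sum_distrib_left[symmetric] algebra_simps sum_divide_distrib[symmetric])
qed

end

section \<open>From the scheme to a single slab\<close>

lemma piecewise_smoothD:
  assumes "piecewise_smooth \<K> I u"
  obtains G where "\<forall>K\<in>\<K>. smooth (G K) \<and> (\<forall>x\<in>interior K. \<forall>t\<in>I. u x t = G K (x, t))"
proof -
  have "\<forall>K\<in>\<K>. \<exists>G. smooth G \<and> (\<forall>x\<in>interior K. \<forall>t\<in>I. u x t = G (x, t))"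
    using assms unfolding piecewise_smooth_def .
  from bchoice[OF this] show thesis using that by blast
qed

lemma time_grid_mono:
  assumes "time_grid T N t" "i \<le> j" "j \<le> N"
  shows "t i \<le> t j"
  using assms(2,3)
proof (induction j rule: dec_induct)
  case (step m)
  then have "t m < t (Suc m)" using assms(1) by (simp add: time_grid_def)
  then show ?case using step by simp
qed simp

theorem theorem6:
  fixes \<Omega> :: "(real^3) set" and \<K> :: "(real^3) set set"
    and T \<beta> :: real and N n :: nat and t :: "nat \<Rightarrow> real"
    and \<epsilon> \<mu> :: "real^3 \<Rightarrow> real"
    and E0 H0 :: "real^3 \<Rightarrow> real^3" and g :: field
    and V :: "nat \<Rightarrow> (field \<times> field) set"
    and Eh Hh :: "nat \<Rightarrow> field"
  assumes domain: "polyhedral_lipschitz_domain \<Omega>"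
    and mesh: "element_partition \<Omega> \<K>"
    and grid: "time_grid T N t"
    and eps: "piecewise_constant \<K> \<epsilon>" "\<And>x. x \<in> \<Omega> \<Longrightarrow> \<epsilon> x > 0"
    and mu: "piecewise_constant \<K> \<mu>" "\<And>x. x \<in> \<Omega> \<Longrightarrow> \<mu> x > 0"
    and beta: "\<beta> \<ge> 0"
    and initial: "square_integrable (lebesgue_on \<Omega>) E0" "square_integrable (lebesgue_on \<Omega>) H0"
    and excitation:
      "square_integrable (surface_time_measure (frontier \<Omega>) {0<..<T}) (\<lambda>(x, s). g x s)"
    and spaces: "\<And>k. k \<in> {1..N} \<Longrightarrow> linear_space_of_pairs (V k)"
      "\<And>k v w. k \<in> {1..N} \<Longrightarrow> (v, w) \<in> V k \<Longrightarrow>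
         piecewise_smooth \<K> {t (k - 1)..t k} v \<and> piecewise_smooth \<K> {t (k - 1)..t k} w"
    and solution: "dg_solution \<Omega> \<K> \<epsilon> \<mu> \<beta> g E0 H0 N t V Eh Hh"
    and n: "n \<in> {1..N}"
  shows
    "1/2 * ((L2_norm \<Omega> (\<lambda>x. sqrt (\<epsilon> x) *\<^sub>R Eh n x (t n)))\<^sup>2
           + (L2_norm \<Omega> (\<lambda>x. sqrt (\<mu> x) *\<^sub>R Hh n x (t n)))\<^sup>2)
     - 1/2 * ((L2_norm \<Omega> (\<lambda>x. sqrt (\<epsilon> x) *\<^sub>R Eh (n - 1) x (t (n - 1))))\<^sup>2
             + (L2_norm \<Omega> (\<lambda>x. sqrt (\<mu> x) *\<^sub>R Hh (n - 1) x (t (n - 1))))\<^sup>2)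
     = - (LINT (x, s)|surface_time_measure (frontier \<Omega>) {t (n - 1)..t n}.
            \<beta> * (norm (cross3 (outward_normal \<Omega> x) (inner_trace \<Omega> (Hh n) x s)))\<^sup>2
            + cross3 (outward_normal \<Omega> x) (g x s) \<bullet> inner_trace \<Omega> (Hh n) x s)
       - 1/2 * (L2_norm \<Omega> (\<lambda>x. sqrt (\<epsilon> x) *\<^sub>R
                  (Eh n x (t (n - 1)) - Eh (n - 1) x (t (n - 1)))))\<^sup>2
       - 1/2 * (L2_norm \<Omega> (\<lambda>x. sqrt (\<mu> x) *\<^sub>R
                  (Hh n x (t (n - 1)) - Hh (n - 1) x (t (n - 1)))))\<^sup>2"
proof -
  interpret M: polyhedral_mesh \<Omega> \<K> by (rule polyhedral_mesh.intro) (fact domain mesh)+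
  have sol0: "Eh 0 x (t 0) = E0 x" "Hh 0 x (t 0) = H0 x" if "x \<in> \<Omega>" for x
    using solution that unfolding dg_solution_def by blast+
  have solV: "(Eh k, Hh k) \<in> V k" if "k \<in> {1..N}" for k
    using solution that unfolding dg_solution_def by blast
  have smooth: "piecewise_smooth \<K> {t (k - 1)..t k} (Eh k)" "piecewise_smooth \<K> {t (k - 1)..t k} (Hh k)"
    if "k \<in> {1..N}" for k
    using spaces(2)[OF that solV[OF that]] by auto
  have BR: "dg_B \<Omega> \<K> \<epsilon> \<mu> \<beta> (t (n - 1)) (t n) (Eh n) (Hh n) (Eh n) (Hh n) =
      dg_R \<Omega> \<K> \<epsilon> \<mu> g (t (n - 1)) (t n) (Eh (n - 1)) (Hh (n - 1)) (Eh n) (Hh n)"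
  proof -
    have "\<forall>(v, w)\<in>V n. dg_B \<Omega> \<K> \<epsilon> \<mu> \<beta> (t (n - 1)) (t n) (Eh n) (Hh n) v w =
        dg_R \<Omega> \<K> \<epsilon> \<mu> g (t (n - 1)) (t n) (Eh (n - 1)) (Hh (n - 1)) v w"
      using solution n unfolding dg_solution_def by blast
    from bspec[OF this solV[OF n]] show ?thesis by simp
  qed
  have t0: "t 0 = 0" and tN: "t N = T" using grid by (auto simp: time_grid_def)
  have lt: "t (k - 1) < t k" if "k \<in> {1..N}" for k
    using grid that unfolding time_grid_def by (cases k) auto
  have sub: "{t (n - 1)..t n} \<subseteq> {0..T}"
    using time_grid_mono[OF grid, of 0 "n - 1"] time_grid_mono[OF grid, of n N] n t0 tN by auto
  have sq: "square_integrable (lebesgue_on K) (\<lambda>x. u (n - 1) x (t (n - 1)))"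
    if K: "K \<in> \<K>" and u0: "\<And>x. x \<in> \<Omega> \<Longrightarrow> u 0 x (t 0) = f x" and f: "square_integrable (lebesgue_on \<Omega>) f"
      and us: "\<And>k. k \<in> {1..N} \<Longrightarrow> piecewise_smooth \<K> {t (k - 1)..t k} (u k)"
    for K f and u :: "nat \<Rightarrow> field"
  proof (cases "n = 1")
    \<comment> \<open>Before the first slab the preceding values are the initial data, given on the
      domain only; interior points of elements lie there.\<close>
    case True
    have "x \<in> \<Omega> \<and> u (n - 1) x (t (n - 1)) = f x" if "x \<in> K - frontier K" for x
      using M.interior_elementI[OF K that] M.interior_element_subset[OF K] u0 True by auto
    from square_integrable_transfer[OF f M.domain_lebesgue M.element_lebesgue(1)[OF K] M.negligible_frontier_element[OF K] this]
    show ?thesis .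
  next
    case False
    then have k: "n - 1 \<in> {1..N}" using n by auto
    \<comment> \<open>The time \<open>t (n - 1)\<close> is the end of the closed slab
      \<open>n - 1\<close>, so the extension on that slab also gives the final value.\<close>
    obtain G where G: "\<forall>K\<in>\<K>. smooth (G K) \<and> (\<forall>x\<in>interior K. \<forall>s\<in>{t (n - 1 - 1)..t (n - 1)}. u (n - 1) x s = G K (x, s))"
      by (rule piecewise_smoothD[OF us[OF k]])
    show ?thesis
      using G K lt[OF k] by (intro M.square_integrable_smooth[OF K, of "G K"] smooth_continuous) auto
  qed
  obtain GE where GE: "\<forall>K\<in>\<K>. smooth (GE K) \<and> (\<forall>x\<in>interior K. \<forall>s\<in>{t (n - 1)..t n}. Eh n x s = GE K (x, s))"
    by (rule piecewise_smoothD[OF smooth(1)[OF n]])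
  obtain GH where GH: "\<forall>K\<in>\<K>. smooth (GH K) \<and> (\<forall>x\<in>interior K. \<forall>s\<in>{t (n - 1)..t n}. Hh n x s = GH K (x, s))"
    by (rule piecewise_smoothD[OF smooth(2)[OF n]])
  interpret S: smooth_slab \<Omega> \<K> \<beta> "t (n - 1)" "t n" "Eh n" "Hh n" GE GH
    by unfold_locales (use GE GH lt[OF n] in auto)
  show ?thesis
    by (rule S.energy_identity[OF eps mu sub excitation _ _ BR])
       (use sq[of _ Eh, OF _ sol0(1) initial(1) smooth(1)] sq[of _ Hh, OF _ sol0(2) initial(2) smooth(2)] in auto)
qed

end
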